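(* Let $4\le p<\infty$. Then $H^2(T_\Omega)\hookrightarrow A^p_{\frac nr\left(\frac p2-1\right)}(T_\Omega)$; that is, there is a constant $C>0$ such that $\|F\|_{p,\frac nr(\frac p2-1)}\le C\|F\|_{H^2}$ for all $F\in H^2(T_\Omega)$.
   Context: $\Omega$ is an irreducible symmetric cone of rank $r$ in $V=\mathbb R^n$, equipped with the associated Euclidean Jordan algebra structure; $\Delta$ is the determinant function of this Jordan algebra, positive on $\Omega$. $T_\Omega=\mathbb R^n+i\Omega\subset\mathbb C^n$. For $0<p<\infty$, $H^p(T_\Omega)$ is the space of holomorphic $f$ on $T_\Omega$ with $\|f\|_{H^p}=\left(\sup_{t\in\Omega}\int_{\mathbb R^n}|f(x+it)|^pdx\right)^{1/p}<\infty$. For $0<p<\infty$ and $\nu\in\mathbb R$, $A^p_\nu(T_\Omega)$ is the space of holomorphic $f$ on $T_\Omega$ with $\|f\|_{p,\nu}=\left(\int_{T_\Omega}|f(x+iy)|^p\Delta^{\nu-\frac nr}(y)\,dx\,dy\right)^{1/p}<\infty$. $X\hookrightarrow Y$ means there is $C>0$ with $\|f\|_Y\le C\|f\|_X$ for all $f\in X$. *)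

theory Defs
  imports "HOL-Analysis.Analysis" "HOL-Computational_Algebra.Polynomial"
begin

section \<open>Symmetric cones\<close>

text \<open>
  The ambient space is a parameter \<open>S\<close> (a linear subspace) because irreducibility speaks about
  symmetric cones in proper subspaces. The cone is open, so only dilations by positive
  scalars are required; the library's \<open>cone\<close> would force \<open>0 \<in> \<Omega>\<close>.
  Every automorphism of \<open>S\<close> is the restriction of a linear map of the whole space.
\<close>

definition symmetric_cone_in :: "'a::euclidean_space set \<Rightarrow> 'a set \<Rightarrow> bool" where
  "symmetric_cone_in S \<Omega> \<longleftrightarrow>
     subspace S \<and> \<Omega> \<subseteq> S \<and> \<Omega> \<noteq> {} \<and>
     openin (top_of_set S) \<Omega> \<and> convex \<Omega> \<and> (\<forall>c>0. \<forall>x\<in>\<Omega>. c *\<^sub>R x \<in> \<Omega>) \<and>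
     \<Omega> = {y \<in> S. \<forall>x \<in> closure \<Omega> - {0}. x \<bullet> y > 0} \<and>
     (\<forall>x\<in>\<Omega>. \<forall>y\<in>\<Omega>. \<exists>g. linear g \<and> g ` S = S \<and> g ` \<Omega> = \<Omega> \<and> g x = y)"

definition irreducible_symmetric_cone :: "'a::euclidean_space set \<Rightarrow> bool" where
  "irreducible_symmetric_cone \<Omega> \<longleftrightarrow>
     symmetric_cone_in UNIV \<Omega> \<and>
     \<not> (\<exists>S1 S2 \<Omega>1 \<Omega>2.
          symmetric_cone_in S1 \<Omega>1 \<and> symmetric_cone_in S2 \<Omega>2 \<and>
          S1 \<noteq> {0} \<and> S2 \<noteq> {0} \<and>
          S1 \<inter> S2 = {0} \<and> {x + y | x y. x \<in> S1 \<and> y \<in> S2} = UNIV \<and>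
          \<Omega> = {x + y | x y. x \<in> \<Omega>1 \<and> y \<in> \<Omega>2})"

section \<open>Euclidean Jordan algebras\<close>

text \<open>The associative inner product is the one of the ambient Euclidean space.\<close>

definition euclidean_jordan_algebra ::
    "('a::euclidean_space \<Rightarrow> 'a \<Rightarrow> 'a) \<Rightarrow> 'a \<Rightarrow> bool" where
  "euclidean_jordan_algebra m e \<longleftrightarrow>
     bilinear m \<and>
     (\<forall>x y. m x y = m y x) \<and>
     (\<forall>x y. m x (m (m x x) y) = m (m x x) (m x y)) \<and>
     (\<forall>x. m e x = x) \<and>
     (\<forall>x y z. m x y \<bullet> z = y \<bullet> m x z)"

text \<open>The associated cone is the interior of the set of squares.\<close>

definition jordan_cone :: "('a::euclidean_space \<Rightarrow> 'a \<Rightarrow> 'a) \<Rightarrow> 'a set" where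
  "jordan_cone m = interior (range (\<lambda>x. m x x))"

primrec jordan_power :: "('a \<Rightarrow> 'a \<Rightarrow> 'a) \<Rightarrow> 'a \<Rightarrow> 'a \<Rightarrow> nat \<Rightarrow> 'a" where
  "jordan_power m e x 0 = e"
| "jordan_power m e x (Suc k) = m x (jordan_power m e x k)"

definition jordan_poly ::
    "('a::real_vector \<Rightarrow> 'a \<Rightarrow> 'a) \<Rightarrow> 'a \<Rightarrow> real poly \<Rightarrow> 'a \<Rightarrow> 'a" where
  "jordan_poly m e q x = (\<Sum>k\<le>degree q. coeff q k *\<^sub>R jordan_power m e x k)"

definition jordan_min_poly ::
    "('a::real_vector \<Rightarrow> 'a \<Rightarrow> 'a) \<Rightarrow> 'a \<Rightarrow> 'a \<Rightarrow> real poly" where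
  "jordan_min_poly m e x =
     (THE q. lead_coeff q = 1 \<and> jordan_poly m e q x = 0 \<and>
        (\<forall>s. s \<noteq> 0 \<and> jordan_poly m e s x = 0 \<longrightarrow> degree q \<le> degree s))"

definition jordan_rank :: "('a::real_vector \<Rightarrow> 'a \<Rightarrow> 'a) \<Rightarrow> 'a \<Rightarrow> nat" where
  "jordan_rank m e = Max (range (\<lambda>x. degree (jordan_min_poly m e x)))"

definition jordan_regular :: "('a::real_vector \<Rightarrow> 'a \<Rightarrow> 'a) \<Rightarrow> 'a \<Rightarrow> 'a \<Rightarrow> bool" where
  "jordan_regular m e x \<longleftrightarrow> degree (jordan_min_poly m e x) = jordan_rank m e"

text \<open>
  Following Faraut and Koranyi, the determinant is \<open>(-1)\<^sup>r\<close> times the constant coefficient of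
  the generic minimal polynomial: the polynomial function on the algebra that takes this value
  at every regular element. It is unique because the regular elements are dense.
\<close>

definition is_jordan_det ::
    "('a::real_normed_vector \<Rightarrow> 'a \<Rightarrow> 'a) \<Rightarrow> 'a \<Rightarrow> ('a \<Rightarrow> real) \<Rightarrow> bool" where
  "is_jordan_det m e \<Delta> \<longleftrightarrow>
     real_polynomial_function \<Delta> \<and>
     (\<forall>x. jordan_regular m e x \<longrightarrow>
        \<Delta> x = (- 1) ^ jordan_rank m e * coeff (jordan_min_poly m e x) 0)"

section \<open>Hardy and Bergman spaces on tube domains\<close>

definition complex_point :: "real^'n \<Rightarrow> real^'n \<Rightarrow> complex^'n" where
  "complex_point x y = (\<chi> j. Complex (x $ j) (y $ j))"

definition tube_domain :: "(real^'n) set \<Rightarrow> (complex^'n) set" where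
  "tube_domain \<Omega> = {complex_point x y | x y. y \<in> \<Omega>}"

text \<open>Holomorphy in several variables: complex Frechet differentiability on an open set.\<close>

definition holomorphic_multi_on ::
    "(complex^'n \<Rightarrow> complex) \<Rightarrow> (complex^'n) set \<Rightarrow> bool" where
  "holomorphic_multi_on F D \<longleftrightarrow>
     (\<forall>z\<in>D. \<exists>F'. (F has_derivative F') (at z) \<and> (\<forall>c v. F' (c *s v) = c * F' v))"

text \<open>
  The norms are the real values of extended integrals, and thus are meaningful only for
  members of the respective spaces.
\<close>

definition hardy_sup :: "(real^'n) set \<Rightarrow> real \<Rightarrow> (complex^'n \<Rightarrow> complex) \<Rightarrow> ennreal" where
  "hardy_sup \<Omega> p F =
     (SUP t\<in>\<Omega>. \<integral>\<^sup>+ x. ennreal (norm (F (complex_point x t)) powr p) \<partial>lborel)"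

definition hardy_space :: "(real^'n) set \<Rightarrow> real \<Rightarrow> (complex^'n \<Rightarrow> complex) set" where
  "hardy_space \<Omega> p = {F. holomorphic_multi_on F (tube_domain \<Omega>) \<and> hardy_sup \<Omega> p F < \<infinity>}"

definition hardy_norm :: "(real^'n) set \<Rightarrow> real \<Rightarrow> (complex^'n \<Rightarrow> complex) \<Rightarrow> real" where
  "hardy_norm \<Omega> p F = enn2real (hardy_sup \<Omega> p F) powr (1 / p)"

definition bergman_integral ::
    "(real^'n) set \<Rightarrow> (real^'n \<Rightarrow> real) \<Rightarrow> nat \<Rightarrow> real \<Rightarrow> real \<Rightarrow> (complex^'n \<Rightarrow> complex) \<Rightarrow> ennreal"
  where
  "bergman_integral \<Omega> \<Delta> r p \<nu> F =
     (\<integral>\<^sup>+ (x, y) \<in> UNIV \<times> \<Omega>.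
        ennreal (norm (F (complex_point x y)) powr p
                 * \<Delta> y powr (\<nu> - real CARD('n) / real r))
      \<partial>(lborel :: ((real^'n) \<times> (real^'n)) measure))"

definition bergman_space ::
    "(real^'n) set \<Rightarrow> (real^'n \<Rightarrow> real) \<Rightarrow> nat \<Rightarrow> real \<Rightarrow> real \<Rightarrow> (complex^'n \<Rightarrow> complex) set" where
  "bergman_space \<Omega> \<Delta> r p \<nu> =
     {F. holomorphic_multi_on F (tube_domain \<Omega>) \<and> bergman_integral \<Omega> \<Delta> r p \<nu> F < \<infinity>}"

definition bergman_norm ::
    "(real^'n) set \<Rightarrow> (real^'n \<Rightarrow> real) \<Rightarrow> nat \<Rightarrow> real \<Rightarrow> real \<Rightarrow> (complex^'n \<Rightarrow> complex) \<Rightarrow> real" where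
  "bergman_norm \<Omega> \<Delta> r p \<nu> F = enn2real (bergman_integral \<Omega> \<Delta> r p \<nu> F) powr (1 / p)"

end

theory Submission
  imports Defs "HOL-Computational_Algebra.Fundamental_Theorem_Algebra" "HOL-Probability.Probability"
    "HOL-Complex_Analysis.Complex_Analysis"
begin

text \<open>
  For \<open>p = 4\<close> the weight is trivial. Write \<open>F(x + i y)\<close> as the Fourier-Laplace transform of some
  \<open>g\<close> with \<open>L\<^sup>2\<close> norm that of \<open>F\<close>, supported in the closed cone; then \<open>F\<^sup>2\<close> is the transform of
  \<open>g * g\<close>, and by Plancherel and the Cauchy-Schwarz inequality the integral of \<open>|F|\<^sup>4\<close> over the
  tube is at most the integral over \<open>\<zeta>\<close> of \<open>(|g|\<^sup>2 * |g|\<^sup>2)(\<zeta>)\<close> times the product of the volume of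
  \<open>\<Omega> \<inter> (\<zeta> - \<Omega>)\<close> and the Laplace transform of \<open>\<Omega>\<close> at \<open>2\<zeta>\<close>. Under a cone automorphism these
  two factors scale by the determinant and by its inverse, so their product is constant.

  For \<open>p > 4\<close> the remaining \<open>p - 4\<close> factors are absorbed by the pointwise bound
  \<open>|F(x + i y)|\<^sup>2 \<Delta>(y) powr (n/r) \<le> C\<close>, which follows from the mean value property at the unit by
  moving \<open>y\<close> there with an automorphism of determinant \<open>\<Delta>(y) powr (n/r)\<close>. That this is the
  determinant is where irreducibility enters: any two members of a Jordan frame have the same trace
  as multiplication operators, because otherwise the frame would split the algebra into two ideals.
\<close>

section \<open>Linear changes of variables\<close>

text \<open>The Fourier steps want integrable slices, which a Hardy function need not have. So it is
  shifted into the cone, where the mean value bound makes it bounded, and multiplied by a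
  holomorphic damping factor; the estimate for the modified function depends only on the Hardy
  bound, and Fatou's lemma removes both changes. Plancherel then serves only as an inequality. That
  the transforms of the slices differ by the factors \<open>exp (- (y \<bullet> \<xi>))\<close>
  comes from a contour shift; running \<open>y\<close> to infinity along rays yields the support,
  running it to 0 the norm of \<open>g\<close>. The two factors scale inversely because an
  automorphism acts on the volume and its adjoint on the Laplace transform, so automorphisms are
  built together with an adjoint of the same determinant. Determinants appear only as the factor
  \<open>J\<close> in a change of variables and are computed from orthonormal eigenbases. The
  automorphisms are exponentials of multiplication operators, one for each spectral idempotent.
  Since \<Delta> is prescribed only at regular elements, the pointwise bound is proved there and
  extended by density and continuity.\<close>

definition has_modulus :: "('a::euclidean_space \<Rightarrow> 'a) \<Rightarrow> real \<Rightarrow> bool" where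
  "has_modulus g J \<longleftrightarrow> J > 0 \<and>
     (\<forall>f\<in>borel_measurable borel. (\<integral>\<^sup>+x. f x \<partial>lborel) = ennreal J * (\<integral>\<^sup>+x. f (g x) \<partial>lborel))"

lemma nn_integral_lborel_translate:
  fixes a :: "'a::euclidean_space"
  assumes [measurable]: "f \<in> borel_measurable borel"
  shows "(\<integral>\<^sup>+x. f (x + a) \<partial>lborel) = (\<integral>\<^sup>+x. f x \<partial>lborel)"
proof -
  have "(\<integral>\<^sup>+x. f x \<partial>lborel) = (\<integral>\<^sup>+x. f x \<partial>distr lborel borel ((+) a))"
    by (simp add: lborel_distr_plus)
  also have "\<dots> = (\<integral>\<^sup>+x. f (a + x) \<partial>lborel)"
    by (subst nn_integral_distr) auto
  finally show ?thesis by (simp add: add.commute)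
qed

lemma emeasure_lborel_open_pos:
  fixes U :: "'a::euclidean_space set"
  assumes "open U" "U \<noteq> {}"
  shows "emeasure lborel U > 0"
proof (rule ccontr)
  assume "\<not> emeasure lborel U > 0"
  then have "U \<in> null_sets lborel"
    using assms by auto
  then have "U \<in> null_sets lebesgue"
    using null_sets_completionI by blast
  then have "negligible U"
    by (simp add: negligible_iff_null_sets)
  then show False
    using assms open_not_negligible by blast
qed

text \<open>Uniqueness of Haar measure: both sides are computed from
  \<open>\<integral>\<integral> 1\<^sub>B(y) f(g x + y) dx dy\<close> by translating in \<open>x\<close> or in \<open>y\<close>.\<close>

lemma linear_has_modulus:
  fixes g :: "'a::euclidean_space \<Rightarrow> 'a"
  assumes "linear g" "bij g"
  shows "\<exists>J. has_modulus g J"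
proof -
  define B where "B = ball (0::'a) 1"
  define K where "K = emeasure lborel (g -` B)"
  have cont: "continuous_on UNIV g"
    using assms(1) by (simp add: linear_continuous_on linear_linear)
  have g[measurable]: "g \<in> borel_measurable borel"
    using cont by (rule borel_measurable_continuous_onI)
  have B[measurable]: "B \<in> sets borel" by (simp add: B_def)
  have opn: "open (g -` B)" using cont unfolding B_def
    by (simp add: open_vimage)
  have "0 \<in> g -` B" using assms(1) by (simp add: B_def linear_0)
  then have Kpos: "K > 0" unfolding K_def using opn emeasure_lborel_open_pos by blast
  obtain h where h: "linear h" "h \<circ> g = id" "g \<circ> h = id"
    using assms by (metis bij_betw_def linear_injective_left_inverse linear_surjective_right_inverse left_right_inverse_eq)
  have hg: "h (g x) = x" "g (h x) = x" for x using h(2,3) by (auto simp: fun_eq_iff)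
  have "g -` B = h ` B" using hg by (auto simp: image_iff) (metis hg(1))
  then have "bounded (g -` B)" 
    using h(1) by (simp add: B_def bounded_linear_image linear_linear)
  then have Kfin: "K < \<infinity>" unfolding K_def using emeasure_bounded_finite by auto
  define b where "b = emeasure lborel B"
  have bpos: "b > 0" unfolding b_def B_def by (rule emeasure_lborel_open_pos) auto
  have bfin: "b < \<infinity>" unfolding b_def B_def using emeasure_bounded_finite[of "ball (0::'a) 1"] by auto
  have main: "b * (\<integral>\<^sup>+x. f (g x) \<partial>lborel) = K * (\<integral>\<^sup>+x. f x \<partial>lborel)"
    if f[measurable]: "f \<in> borel_measurable borel" for f
  proof -
    have fg[measurable]: "(\<lambda>x. f (g x)) \<in> borel_measurable borel" by measurable
    have "b * (\<integral>\<^sup>+x. f (g x) \<partial>lborel) = (\<integral>\<^sup>+y. indicator B y * (\<integral>\<^sup>+x. f (g x) \<partial>lborel) \<partial>lborel)"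
      by (simp add: b_def nn_integral_multc)
    also have "\<dots> = (\<integral>\<^sup>+y. indicator B y * (\<integral>\<^sup>+x. f (g x + y) \<partial>lborel) \<partial>lborel)"
    proof (rule nn_integral_cong)
      fix y
      have "(\<integral>\<^sup>+x. f (g x + y) \<partial>lborel) = (\<integral>\<^sup>+x. f (g (x + h y)) \<partial>lborel)"
        using assms(1) by (simp add: linear_add hg)
      also have "\<dots> = (\<integral>\<^sup>+x. f (g x) \<partial>lborel)"
        by (rule nn_integral_lborel_translate) (rule fg)
      finally show "indicator B y * (\<integral>\<^sup>+x. f (g x) \<partial>lborel) = indicator B y * (\<integral>\<^sup>+x. f (g x + y) \<partial>lborel)"
        by simp
    qed
    also have "\<dots> = (\<integral>\<^sup>+y. (\<integral>\<^sup>+x. indicator B y * f (g x + y) \<partial>lborel) \<partial>lborel)"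
      by (subst nn_integral_cmult) auto
    also have "\<dots> = (\<integral>\<^sup>+x. (\<integral>\<^sup>+y. indicator B y * f (g x + y) \<partial>lborel) \<partial>lborel)"
      by (rule lborel_pair.Fubini') measurable
    also have "\<dots> = (\<integral>\<^sup>+x. (\<integral>\<^sup>+y. indicator B (y - g x) * f y \<partial>lborel) \<partial>lborel)"
    proof (rule nn_integral_cong)
      fix x
      show "(\<integral>\<^sup>+y. indicator B y * f (g x + y) \<partial>lborel) = (\<integral>\<^sup>+y. indicator B (y - g x) * f y \<partial>lborel)"
        by (subst nn_integral_lborel_translate[of "\<lambda>y. indicator B (y - g x) * f y" "g x", symmetric])
           (auto simp: add.commute)
    qed
    also have "\<dots> = (\<integral>\<^sup>+y. (\<integral>\<^sup>+x. indicator B (y - g x) * f y \<partial>lborel) \<partial>lborel)"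
      by (rule lborel_pair.Fubini') measurable
    also have "\<dots> = (\<integral>\<^sup>+y. K * f y \<partial>lborel)"
    proof (rule nn_integral_cong)
      fix y
      have "(\<integral>\<^sup>+x. indicator B (y - g x) * f y \<partial>lborel) = (\<integral>\<^sup>+x. indicator B (y - g x) \<partial>lborel) * f y"
        by (rule nn_integral_multc) measurable
      \<comment> \<open>As \<open>g (h y) = y\<close>, this shift turns \<open>y - g x\<close> into
        \<open>- g x\<close>; the ball is symmetric, so \<open>y\<close> disappears.\<close>
      also have "(\<integral>\<^sup>+x. indicator B (y - g x) \<partial>lborel) = (\<integral>\<^sup>+x. indicator B (y - g (x + h y)) \<partial>lborel)"
        by (rule nn_integral_lborel_translate[symmetric]) measurable
      also have "\<dots> = (\<integral>\<^sup>+x. indicator (g -` B) x \<partial>lborel)"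
        using assms(1) by (intro nn_integral_cong) (auto simp: linear_add hg B_def indicator_def)
      also have "\<dots> = K" unfolding K_def
        using opn by (intro nn_integral_indicator) auto
      finally show "(\<integral>\<^sup>+x. indicator B (y - g x) * f y \<partial>lborel) = K * f y" .
    qed
    also have "\<dots> = K * (\<integral>\<^sup>+x. f x \<partial>lborel)"
      by (simp add: nn_integral_cmult)
    finally show ?thesis .
  qed
  define J where "J = enn2real b / enn2real K"
  have bK: "enn2real b > 0" "enn2real K > 0" 
    using bpos bfin Kpos Kfin by (auto simp: enn2real_positive_iff)
  have J: "ennreal J = b / K"
    unfolding J_def using bK bfin Kfin by (simp add: divide_ennreal[symmetric])
  have "has_modulus g J" unfolding has_modulus_def
  proof (intro conjI ballI)
    show "J > 0" using bK by (simp add: J_def)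
    fix f :: "'a \<Rightarrow> ennreal" assume "f \<in> borel_measurable borel"
    from main[OF this] have "b * (\<integral>\<^sup>+x. f (g x) \<partial>lborel) / K = K * (\<integral>\<^sup>+x. f x \<partial>lborel) / K" by simp
    also have "\<dots> = (\<integral>\<^sup>+x. f x \<partial>lborel)"
      using Kpos Kfin by (simp add: ennreal_mult_divide_eq[of K] mult.commute[of K])
    finally show "(\<integral>\<^sup>+x. f x \<partial>lborel) = ennreal J * (\<integral>\<^sup>+x. f (g x) \<partial>lborel)"
      unfolding J by (simp add: ennreal_divide_times ennreal_times_divide mult.commute)
  qed
  then show ?thesis by blast
qed

lemma has_modulus_integral:
  assumes "has_modulus g J" "f \<in> borel_measurable borel"
  shows "(\<integral>\<^sup>+x. f x \<partial>lborel) = ennreal J * (\<integral>\<^sup>+x. f (g x) \<partial>lborel)"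
  using assms by (auto simp: has_modulus_def)

lemma has_modulus_pos: "has_modulus g J \<Longrightarrow> J > 0"
  by (auto simp: has_modulus_def)

lemma has_modulus_id: "has_modulus (\<lambda>x. x) 1"
  by (auto simp: has_modulus_def)

lemma has_modulus_compose:
  assumes "has_modulus g J" "has_modulus h J'" and [measurable]: "g \<in> borel_measurable borel"
  shows "has_modulus (\<lambda>x. g (h x)) (J * J')"
  unfolding has_modulus_def
proof (intro conjI ballI)
  have pos: "J > 0" "J' > 0" using assms(1,2) by (auto dest: has_modulus_pos)
  then show "J * J' > 0" by simp
  fix f :: "'a \<Rightarrow> ennreal" assume f[measurable]: "f \<in> borel_measurable borel"
  have "(\<integral>\<^sup>+x. f x \<partial>lborel) = ennreal J * (\<integral>\<^sup>+x. f (g x) \<partial>lborel)"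
    by (rule has_modulus_integral[OF assms(1) f])
  also have "(\<integral>\<^sup>+x. f (g x) \<partial>lborel) = ennreal J' * (\<integral>\<^sup>+x. f (g (h x)) \<partial>lborel)"
    by (rule has_modulus_integral[OF assms(2)]) measurable
  finally show "(\<integral>\<^sup>+x. f x \<partial>lborel) = ennreal (J * J') * (\<integral>\<^sup>+x. f (g (h x)) \<partial>lborel)"
    using pos by (simp add: ennreal_mult mult.assoc)
qed

lemma has_modulus_unique:
  fixes g :: "'a::euclidean_space \<Rightarrow> 'a"
  assumes "has_modulus g J" "has_modulus g J'"
  shows "J = J'"
proof -
  let ?f = "indicator (ball (0::'a) 1) :: 'a \<Rightarrow> ennreal"
  let ?A = "\<integral>\<^sup>+x. ?f x \<partial>lborel" and ?I = "\<integral>\<^sup>+x. ?f (g x) \<partial>lborel"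
  have f: "?f \<in> borel_measurable borel" by (intro borel_measurable_indicator) simp
  have e: "?A = ennreal J * ?I" "?A = ennreal J' * ?I"
    using has_modulus_integral[OF assms(1) f] has_modulus_integral[OF assms(2) f] by auto
  have A: "?A = emeasure lborel (ball (0::'a) 1)" by simp
  have "?A > 0" unfolding A by (rule emeasure_lborel_open_pos) auto
  moreover have "?A < \<infinity>" unfolding A using emeasure_bounded_finite[of "ball (0::'a) 1"] by auto
  ultimately have I: "?I \<noteq> 0" "?I \<noteq> \<infinity>"
    using e(1) has_modulus_pos[OF assms(1)] by (auto simp: ennreal_mult_eq_top_iff)
  have "ennreal J * ?I = ennreal J' * ?I" using e by simp
  then have "ennreal J * ?I / ?I = ennreal J' * ?I / ?I" by simp
  then have "ennreal J = ennreal J'"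
    using I by (simp only: ennreal_mult_divide_eq infinity_ennreal_def not_False_eq_True)
  then show ?thesis
    using assms[THEN has_modulus_pos] by simp
qed

text \<open>The unit ball is its own preimage and has positive finite measure, so testing the factor
  on its indicator leaves only 1.\<close>

lemma has_modulus_isometry:
  fixes g :: "'a::euclidean_space \<Rightarrow> 'a"
  assumes "linear g" "\<And>x. norm (g x) = norm x"
  shows "has_modulus g 1"
proof -
  have "inj g" using assms by (metis linear_injective_0 norm_eq_zero)
  then have "bij g" using assms(1) linear_inj_imp_surj by (auto simp: bij_def)
  then obtain J where J: "has_modulus g J" using linear_has_modulus assms(1) by blast
  let ?f = "indicator (ball (0::'a) 1) :: 'a \<Rightarrow> ennreal"
  let ?A = "\<integral>\<^sup>+x. ?f x \<partial>lborel"
  have f: "?f \<in> borel_measurable borel" by (intro borel_measurable_indicator) simp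
  have "?A = ennreal J * (\<integral>\<^sup>+x. ?f (g x) \<partial>lborel)" using has_modulus_integral[OF J f] .
  also have "(\<integral>\<^sup>+x. ?f (g x) \<partial>lborel) = ?A"
    using assms(2) by (intro nn_integral_cong) (auto simp: indicator_def)
  finally have e: "ennreal 1 * ?A = ennreal J * ?A" by simp
  have A: "?A = emeasure lborel (ball (0::'a) 1)" by simp
  have "?A > 0" unfolding A by (rule emeasure_lborel_open_pos) auto
  moreover have "?A < \<infinity>" unfolding A using emeasure_bounded_finite[of "ball (0::'a) 1"] by auto
  ultimately have "?A \<noteq> 0" "?A \<noteq> top" by auto
  moreover have "ennreal 1 * ?A / ?A = ennreal J * ?A / ?A" using e by simp
  ultimately have "ennreal 1 = ennreal J"
    by (simp only: ennreal_mult_divide_eq not_False_eq_True)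
  then have "J = 1" using has_modulus_pos[OF J] ennreal_inj[of 1 J] by simp
  then show ?thesis using J by simp
qed

lemma has_modulus_scaleR:
  fixes s :: real
  assumes "s > 0"
  shows "has_modulus (\<lambda>x::'a::euclidean_space. s *\<^sub>R x) (s ^ DIM('a))"
  unfolding has_modulus_def
proof (intro conjI ballI)
  show "0 < s ^ DIM('a)" using assms by simp
  fix f :: "'a \<Rightarrow> ennreal" assume f[measurable]: "f \<in> borel_measurable borel"
  have "(\<integral>\<^sup>+x. f x \<partial>lborel) = (\<integral>\<^sup>+x. f x \<partial>(density (distr lborel borel (\<lambda>x. 0 + s *\<^sub>R x)) (\<lambda>_. \<bar>s\<bar>^DIM('a))))"
    using assms by (subst lborel_affine[of s "0::'a"]) auto
  also have "\<dots> = ennreal (s ^ DIM('a)) * (\<integral>\<^sup>+x. f (s *\<^sub>R x) \<partial>lborel)"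
    using assms by (simp add: nn_integral_density nn_integral_distr nn_integral_cmult)
  finally show "(\<integral>\<^sup>+x. f x \<partial>lborel) = ennreal (s ^ DIM('a)) * (\<integral>\<^sup>+x. f (s *\<^sub>R x) \<partial>lborel)" .
qed

text \<open>For a unit vector \<open>b\<close>, stretching by \<open>s\<close> along
  \<open>b\<close> and the identity on the orthogonal complement. These maps play the part of
  elementary matrices.\<close>

definition dilation :: "'a::euclidean_space \<Rightarrow> real \<Rightarrow> 'a \<Rightarrow> 'a" where
  "dilation b s x = x + ((s - 1) * (x \<bullet> b)) *\<^sub>R b"

lemma linear_dilation: "linear (dilation b s)"
  by (auto simp: linear_iff dilation_def algebra_simps inner_add_left)

lemma measurable_linear:
  fixes g :: "'a::euclidean_space \<Rightarrow> 'a"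
  shows "linear g \<Longrightarrow> g \<in> borel_measurable borel"
  by (simp add: borel_measurable_continuous_onI linear_continuous_on linear_linear)

text \<open>The reflection \<open>x - 2 (x \<bullet> w) / (w \<bullet> w) w\<close> with \<open>w = b - a\<close> exchanges the unit
  vectors \<open>a\<close> and \<open>b\<close>; at \<open>w = 0\<close> it is the identity.\<close>

lemma dilation_conjugate:
  fixes a b :: "'a::euclidean_space"
  assumes "norm a = 1" "norm b = 1"
  shows "\<exists>u. linear u \<and> (\<forall>x. norm (u x) = norm x) \<and> (\<forall>x. dilation b s x = u (dilation a s (u x)))"
proof -
  define w where "w = b - a"
  define u where "u x = x - (2 * (x \<bullet> w) / (w \<bullet> w)) *\<^sub>R w" for x
  have ab: "a \<bullet> a = 1" "b \<bullet> b = 1" using assms by (auto simp: dot_square_norm)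
  have lin: "linear u"
    by (simp add: linear_iff u_def inner_add_left distrib_left add_divide_distrib scaleR_add_left scaleR_diff_right)
  have c: "(2 * (x \<bullet> w) / (w \<bullet> w)) * (w \<bullet> w) = 2 * (x \<bullet> w)" for x
    by (cases "w = 0") auto
  have norm2: "u x \<bullet> u x = x \<bullet> x" for x
  proof -
    define k where "k = 2 * (x \<bullet> w) / (w \<bullet> w)"
    have k: "k * (w \<bullet> w) = 2 * (x \<bullet> w)" using c[of x] by (simp add: k_def)
    have ux: "u x = x - k *\<^sub>R w" by (simp add: u_def k_def)
    have "u x \<bullet> u x = x \<bullet> x - 2 * k * (x \<bullet> w) + k * (k * (w \<bullet> w))"
      by (simp add: ux inner_diff_left inner_diff_right inner_commute[of w x] algebra_simps)
    then show ?thesis unfolding k by (simp add: algebra_simps k)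
  qed
  have uu: "u (u x) = x" for x
  proof -
    define k where "k = 2 * (x \<bullet> w) / (w \<bullet> w)"
    have k: "k * (w \<bullet> w) = 2 * (x \<bullet> w)" using c[of x] by (simp add: k_def)
    have ux: "u x = x - k *\<^sub>R w" by (simp add: u_def k_def)
    have "u x \<bullet> w = - (x \<bullet> w)" using k by (simp add: ux inner_diff_left)
    then have "u (u x) = u x + k *\<^sub>R w" by (simp add: u_def[of "u x"] k_def)
    then show ?thesis by (simp add: ux)
  qed
  have ua: "u a = b"
  proof (cases "w = 0")
    case False
    have "w \<bullet> w = 2 - 2 * (a \<bullet> b)" "a \<bullet> w = a \<bullet> b - 1"
      using ab by (auto simp: w_def inner_diff_left inner_diff_right inner_commute)
    then have "2 * (a \<bullet> w) / (w \<bullet> w) = - 1" using False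
      by (smt (verit) divide_eq_minus_1_iff inner_eq_zero_iff)
    then show ?thesis by (simp add: u_def w_def)
  qed (simp add: u_def w_def)
  have adj: "u x \<bullet> a = x \<bullet> b" for x
  proof -
    have "u x \<bullet> y = x \<bullet> u y" for x y
      by (simp add: u_def inner_diff_left inner_diff_right inner_commute)
    then show ?thesis using ua by simp
  qed
  have "dilation b s x = u (dilation a s (u x))" for x
    using lin by (simp add: dilation_def linear_add linear_scale uu ua adj)
  then show ?thesis using lin norm2 by (metis norm_eq)
qed

text \<open>The map is the composition of the single dilations: what one of them adds is orthogonal
  to the other directions, so the later inner products do not change.\<close>

lemma has_modulus_dilations:
  fixes b :: "'k \<Rightarrow> 'a::euclidean_space"
  assumes "finite I" "\<And>i. i \<in> I \<Longrightarrow> norm (b i) = 1"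
    and "\<And>i j. i \<in> I \<Longrightarrow> j \<in> I \<Longrightarrow> i \<noteq> j \<Longrightarrow> b i \<bullet> b j = 0"
    and mod: "\<And>i. i \<in> I \<Longrightarrow> has_modulus (dilation (b i) (s i)) (J i)"
  shows "has_modulus (\<lambda>x. x + (\<Sum>i\<in>I. ((s i - 1) * (x \<bullet> b i)) *\<^sub>R b i)) (\<Prod>i\<in>I. J i)"
  using assms
proof (induction I rule: finite_induct)
  case empty
  then show ?case by (simp add: has_modulus_id)
next
  case (insert k I)
  let ?g = "\<lambda>x. x + (\<Sum>i\<in>I. ((s i - 1) * (x \<bullet> b i)) *\<^sub>R b i)"
  have lin: "linear ?g"
    by (auto simp: linear_iff inner_add_left sum.distrib scaleR_sum_right distrib_left
        scaleR_add_left scaleR_add_right mult.left_commute)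
  have "has_modulus (\<lambda>x. dilation (b k) (s k) (?g x)) (J k * prod J I)"
    using insert by (intro has_modulus_compose) (auto intro: measurable_linear linear_dilation)
  moreover have "dilation (b k) (s k) (?g x) = x + (\<Sum>i\<in>insert k I. ((s i - 1) * (x \<bullet> b i)) *\<^sub>R b i)" for x
  proof -
    have "(\<Sum>i\<in>I. ((s i - 1) * (x \<bullet> b i)) *\<^sub>R b i) \<bullet> b k = 0"
    proof -
      have "b i \<bullet> b k = 0" if "i \<in> I" for i using insert that by auto
      then show ?thesis by (simp add: inner_sum_left)
    qed
    then show ?thesis using insert by (simp add: dilation_def inner_add_left algebra_simps)
  qed
  ultimately show ?case using insert by simp
qed

text \<open>All dilations by \<open>s\<close> are conjugate under isometries and share one factor
  \<open>J\<close>. Composing them over an orthonormal basis gives multiplication by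
  \<open>s\<close>, so \<open>J ^ DIM('a) = s ^ DIM('a)\<close>.\<close>

lemma has_modulus_dilation:
  fixes b :: "'a::euclidean_space"
  assumes "norm b = 1" "s > 0"
  shows "has_modulus (dilation b s) s"
proof -
  have conj: "has_modulus (dilation b s) J" 
    if "norm b = 1" and J: "has_modulus (dilation a s) J" and "norm a = 1" for a b :: 'a and J
  proof -
    obtain u where u: "linear u" "\<forall>x. norm (u x) = norm x" "\<forall>x. dilation b s x = u (dilation a s (u x))"
      using dilation_conjugate[OF \<open>norm a = 1\<close> \<open>norm b = 1\<close>] by blast
    have "has_modulus (\<lambda>x. u (dilation a s (u x))) (1 * (J * 1))"
      using u by (intro has_modulus_compose J has_modulus_isometry measurable_linear linear_dilation) auto
    moreover have "(\<lambda>x. u (dilation a s (u x))) = dilation b s" using u by auto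
    ultimately show ?thesis by simp
  qed
  have "inj (dilation b s)"
  proof -
    have "x = 0" if "dilation b s x = 0" for x
    proof -
      have "dilation b s x \<bullet> b = s * (x \<bullet> b)" 
        using assms(1) by (simp add: dilation_def inner_add_left dot_square_norm algebra_simps)
      then have "x \<bullet> b = 0" using that assms(2) by simp
      then show ?thesis using that by (simp add: dilation_def)
    qed
    then show ?thesis using linear_injective_0 linear_dilation by blast
  qed
  then have "bij (dilation b s)" by (simp add: bij_def linear_dilation linear_inj_imp_surj)
  then obtain J where J: "has_modulus (dilation b s) J" using linear_has_modulus linear_dilation by blast
  have "has_modulus (\<lambda>x::'a. x + (\<Sum>i\<in>Basis. ((s - 1) * (x \<bullet> i)) *\<^sub>R i)) (\<Prod>i\<in>(Basis::'a set). J)"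
    by (rule has_modulus_dilations) (auto intro: conj[OF _ J assms(1)] simp: inner_Basis)
  moreover have "x + (\<Sum>i\<in>Basis. ((s - 1) * (x \<bullet> i)) *\<^sub>R i) = s *\<^sub>R x" for x :: 'a
  proof -
    have "(\<Sum>i\<in>Basis. ((s - 1) * (x \<bullet> i)) *\<^sub>R i) = (s - 1) *\<^sub>R (\<Sum>i\<in>Basis. (x \<bullet> i) *\<^sub>R i)"
      by (simp add: scaleR_sum_right)
    then show ?thesis by (simp add: euclidean_representation algebra_simps)
  qed
  ultimately have "has_modulus (\<lambda>x::'a. s *\<^sub>R x) (J ^ DIM('a))" by simp
  then have "J ^ DIM('a) = s ^ DIM('a)" using has_modulus_scaleR[OF assms(2)] has_modulus_unique by blast
  then have "J = s" using has_modulus_pos[OF J] assms(2) 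
    by (metis DIM_positive less_eq_real_def power_eq_imp_eq_base)
  then show ?thesis using J by simp
qed

lemma has_modulus_eigenbasis:
  fixes T :: "'a::euclidean_space \<Rightarrow> 'a"
  assumes B: "finite B" "\<And>b. b \<in> B \<Longrightarrow> norm b = 1" "pairwise orthogonal B" "span B = UNIV"
    and T: "linear T" "\<And>b. b \<in> B \<Longrightarrow> T b = \<mu> b *\<^sub>R b" "\<And>b. b \<in> B \<Longrightarrow> \<mu> b > 0"
  shows "has_modulus T (\<Prod>b\<in>B. \<mu> b)"
proof -
  have ex: "x = (\<Sum>b\<in>B. (x \<bullet> b) *\<^sub>R b)" for x
    using orthonormal_basis_expand[OF B(3,2) _ B(1), of x] B(4) by auto
  have "has_modulus (\<lambda>x. x + (\<Sum>b\<in>B. ((\<mu> b - 1) * (x \<bullet> b)) *\<^sub>R b)) (\<Prod>b\<in>B. \<mu> b)"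
    using B T by (intro has_modulus_dilations has_modulus_dilation) (auto simp: pairwise_def orthogonal_def)
  moreover have "x + (\<Sum>b\<in>B. ((\<mu> b - 1) * (x \<bullet> b)) *\<^sub>R b) = T x" for x
  proof -
    have "T x = (\<Sum>b\<in>B. (x \<bullet> b) *\<^sub>R T b)"
      using T(1) by (subst ex[of x]) (simp add: linear_sum linear_scale)
    also have "\<dots> = (\<Sum>b\<in>B. (x \<bullet> b) *\<^sub>R b) + (\<Sum>b\<in>B. ((\<mu> b - 1) * (x \<bullet> b)) *\<^sub>R b)"
      using T(2) by (simp add: sum.distrib[symmetric] algebra_simps)
    finally show ?thesis using ex[of x] by simp
  qed
  ultimately show ?thesis by (simp add: fun_eq_iff)
qed

section \<open>The spectral theorem in Euclidean Jordan algebras\<close>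

locale euclidean_jordan =
  fixes m :: "'a::euclidean_space \<Rightarrow> 'a \<Rightarrow> 'a" (infixl "\<bowtie>" 75) and e :: 'a
  assumes EJA: "euclidean_jordan_algebra m e"
begin

lemma bil: "bilinear m" and m_comm: "x \<bowtie> y = y \<bowtie> x"
  and jordan: "x \<bowtie> ((x \<bowtie> x) \<bowtie> y) = (x \<bowtie> x) \<bowtie> (x \<bowtie> y)"
  and unit_left [simp]: "e \<bowtie> x = x" and assoc_inner: "(x \<bowtie> y) \<bullet> z = y \<bullet> (x \<bowtie> z)"
  using EJA unfolding euclidean_jordan_algebra_def by blast+

lemma unit_right [simp]: "x \<bowtie> e = x"
  using m_comm unit_left by metis

lemmas m_zero [simp] = bilinear_lzero[OF bil] bilinear_rzero[OF bil]
lemmas m_linear = bilinear_ladd[OF bil] bilinear_radd[OF bil] bilinear_lsub[OF bil] bilinear_rsub[OF bil]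
  bilinear_lmul[OF bil] bilinear_rmul[OF bil] bilinear_lneg[OF bil] bilinear_rneg[OF bil]

lemma m_sum_left: "(\<Sum>i\<in>I. f i) \<bowtie> y = (\<Sum>i\<in>I. f i \<bowtie> y)"
  by (induction I rule: infinite_finite_induct) (auto simp: m_linear)

lemma m_sum_right: "y \<bowtie> (\<Sum>i\<in>I. f i) = (\<Sum>i\<in>I. y \<bowtie> f i)"
  by (induction I rule: infinite_finite_induct) (auto simp: m_linear)

lemma linear_m: "linear (\<lambda>z. x \<bowtie> z)"
  using bil by (simp add: bilinear_def)

lemma inner_square: "a \<bullet> (x \<bowtie> a) = x \<bullet> (a \<bowtie> a)"
  by (metis assoc_inner m_comm inner_commute)

text \<open>Polarization of the Jordan identity: the alternating sum of its values at partial sums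
  of \<open>x\<close>, \<open>y\<close>, \<open>z\<close> leaves the trilinear part, where
  commutativity makes every term occur twice.\<close>

lemma linearized:
  "x \<bowtie> ((y \<bowtie> z) \<bowtie> w) + y \<bowtie> ((z \<bowtie> x) \<bowtie> w) + z \<bowtie> ((x \<bowtie> y) \<bowtie> w)
   = (y \<bowtie> z) \<bowtie> (x \<bowtie> w) + (z \<bowtie> x) \<bowtie> (y \<bowtie> w) + (x \<bowtie> y) \<bowtie> (z \<bowtie> w)"
proof -
  define f where "f u = u \<bowtie> ((u \<bowtie> u) \<bowtie> w) - (u \<bowtie> u) \<bowtie> (u \<bowtie> w)" for u
  have f: "f u = 0" for u by (simp add: f_def jordan)
  define R where "R = x \<bowtie> ((y \<bowtie> z) \<bowtie> w) + y \<bowtie> ((z \<bowtie> x) \<bowtie> w) + z \<bowtie> ((x \<bowtie> y) \<bowtie> w)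
   - ((y \<bowtie> z) \<bowtie> (x \<bowtie> w) + (z \<bowtie> x) \<bowtie> (y \<bowtie> w) + (x \<bowtie> y) \<bowtie> (z \<bowtie> w))"
  have "f (x + y + z) - f (x + y) - f (y + z) - f (x + z) + f x + f y + f z = R + R"
    unfolding f_def R_def by (simp add: m_linear m_comm[of y x] m_comm[of z x] m_comm[of z y])
  then have "R + R = 0" by (simp add: f)
  then have "2 *\<^sub>R R = 0" by (simp add: scaleR_2)
  then show ?thesis by (simp add: R_def)
qed

text \<open>The polarized identity read as one between operators applied to \<open>z\<close>:
  multiplication by a triple product is expressed by multiplications by its factors and by products
  of two of them. Power associativity, the Peirce equation and the associativity of the trace form
  all come from it.\<close>

lemma mult_op:
  "((x \<bowtie> y) \<bowtie> w) \<bowtie> z = (x \<bowtie> y) \<bowtie> (w \<bowtie> z) + (x \<bowtie> w) \<bowtie> (y \<bowtie> z) + (y \<bowtie> w) \<bowtie> (x \<bowtie> z)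
     - x \<bowtie> (w \<bowtie> (y \<bowtie> z)) - y \<bowtie> (w \<bowtie> (x \<bowtie> z))"
  using linearized[of x y z w]
  by (simp add: m_comm[of z] m_comm[of _ w] algebra_simps) (metis m_comm add.commute add.left_commute)

text \<open>Reduces the commutator with multiplication by a square to one with \<open>y\<close> and
  \<open>y \<bowtie> x\<close>. It is meant for idempotent \<open>y\<close>, where the square is
  \<open>y\<close> again.\<close>

lemma commute_square: "x \<bowtie> ((y \<bowtie> y) \<bowtie> w) - (y \<bowtie> y) \<bowtie> (x \<bowtie> w) = 2 *\<^sub>R ((y \<bowtie> x) \<bowtie> (y \<bowtie> w) - y \<bowtie> ((y \<bowtie> x) \<bowtie> w))"
  using linearized[of x y y w] by (simp add: scaleR_2 m_comm[of x y] algebra_simps)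

section \<open>Powers and polynomials of one element\<close>

definition pw :: "'a \<Rightarrow> nat \<Rightarrow> 'a" where "pw x k = jordan_power m e x k"

lemma pw_simps [simp]: "pw x 0 = e" "pw x (Suc k) = x \<bowtie> pw x k"
  by (auto simp: pw_def)

text \<open>Both relations are proved together by strong induction: \<open>mult_op\<close> writes
  multiplication by a power through multiplications by the two preceding powers, \<open>x\<close>
  and \<open>x \<bowtie> x\<close>, which commute with \<open>x\<close> and
  \<open>x \<bowtie> x\<close> by the hypothesis and the Jordan identity.\<close>

lemma pw_commute:
  "(\<forall>z. pw x k \<bowtie> (x \<bowtie> z) = x \<bowtie> (pw x k \<bowtie> z)) \<and>
   (\<forall>z. pw x k \<bowtie> ((x \<bowtie> x) \<bowtie> z) = (x \<bowtie> x) \<bowtie> (pw x k \<bowtie> z))"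
proof (induction k rule: less_induct)
  case (less k)
  consider "k = 0" | "k = 1" | j where "k = Suc (Suc j)"
    by (metis One_nat_def old.nat.exhaust)
  then show ?case
  proof cases
    case 3
    define a where "a = pw x j"
    define b where "b = pw x (Suc j)"
    have a: "a \<bowtie> (x \<bowtie> z) = x \<bowtie> (a \<bowtie> z)" "a \<bowtie> ((x \<bowtie> x) \<bowtie> z) = (x \<bowtie> x) \<bowtie> (a \<bowtie> z)" for z
      using less[of j] 3 by (auto simp: a_def)
    have b: "b \<bowtie> (x \<bowtie> z) = x \<bowtie> (b \<bowtie> z)" "b \<bowtie> ((x \<bowtie> x) \<bowtie> z) = (x \<bowtie> x) \<bowtie> (b \<bowtie> z)" for z
      using less[of "Suc j"] 3 by (auto simp: b_def simp del: pw_simps)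
    define s where "s = x \<bowtie> x"
    note a = a[folded s_def] and b = b[folded s_def]
    have s: "s \<bowtie> (x \<bowtie> z) = x \<bowtie> (s \<bowtie> z)" for z using jordan[of x z] by (simp add: s_def)
    have k: "pw x k \<bowtie> z = 2 *\<^sub>R (b \<bowtie> (x \<bowtie> z)) + s \<bowtie> (a \<bowtie> z) - x \<bowtie> (x \<bowtie> (a \<bowtie> z)) - a \<bowtie> (x \<bowtie> (x \<bowtie> z))" for z
    proof -
      have "pw x k = (x \<bowtie> a) \<bowtie> x" "b = x \<bowtie> a" using 3 by (auto simp: a_def b_def m_comm)
      then show ?thesis using mult_op[of x a x z] by (simp add: s_def m_comm[of a x] scaleR_2 algebra_simps)
    qed
    show ?thesis unfolding k s_def[symmetric] by (simp add: a b s m_linear)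
  qed (auto simp: jordan)
qed

definition pp :: "'a \<Rightarrow> real poly \<Rightarrow> 'a" where "pp x p = jordan_poly m e p x"

lemma pp_sum: "degree p \<le> n \<Longrightarrow> pp x p = (\<Sum>k\<le>n. coeff p k *\<^sub>R pw x k)"
  unfolding pp_def jordan_poly_def pw_def[symmetric]
  by (rule sum.mono_neutral_left) (auto simp: coeff_eq_0)

lemma pp_0 [simp]: "pp x 0 = 0"
  using pp_sum[of 0 0] by simp

lemma pp_pCons [simp]: "pp x (pCons a p) = a *\<^sub>R e + x \<bowtie> pp x p"
proof -
  have "pp x (pCons a p) = (\<Sum>k\<le>Suc (degree p). coeff (pCons a p) k *\<^sub>R pw x k)"
    by (rule pp_sum) (simp add: degree_pCons_le)
  also have "\<dots> = a *\<^sub>R e + (\<Sum>k\<le>degree p. coeff p k *\<^sub>R (x \<bowtie> pw x k))"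
    by (subst sum.atMost_Suc_shift) simp
  also have "\<dots> = a *\<^sub>R e + x \<bowtie> pp x p"
    using pp_sum[of p "degree p" x] by (simp add: m_sum_right m_linear)
  finally show ?thesis .
qed

lemma pp_add: "pp x (p + q) = pp x p + pp x q"
proof -
  let ?n = "max (degree p) (degree q)"
  have "pp x (p + q) = (\<Sum>k\<le>?n. coeff (p + q) k *\<^sub>R pw x k)" "pp x p = (\<Sum>k\<le>?n. coeff p k *\<^sub>R pw x k)"
    "pp x q = (\<Sum>k\<le>?n. coeff q k *\<^sub>R pw x k)"
    by (rule pp_sum; simp add: degree_add_le)+
  then show ?thesis by (simp add: scaleR_add_left sum.distrib)
qed

lemma pp_smult: "pp x (smult a p) = a *\<^sub>R pp x p"
proof -
  have "pp x (smult a p) = (\<Sum>k\<le>degree p. coeff (smult a p) k *\<^sub>R pw x k)" "pp x p = (\<Sum>k\<le>degree p. coeff p k *\<^sub>R pw x k)"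
    by (rule pp_sum; simp add: degree_smult_le)+
  then show ?thesis by (simp add: scaleR_sum_right)
qed

lemma pp_commute: "pp x p \<bowtie> (x \<bowtie> z) = x \<bowtie> (pp x p \<bowtie> z)"
proof -
  have "pw x k \<bowtie> (x \<bowtie> z) = x \<bowtie> (pw x k \<bowtie> z)" for k using pw_commute by blast
  then show ?thesis
    by (simp add: pp_sum[OF order_refl] m_sum_left m_sum_right m_linear)
qed

text \<open>Power associativity in the form in which it is used: evaluation at \<open>x\<close> is
  multiplicative although the product is not associative. \<open>pp_commute\<close> supplies the
  reassociation.\<close>

lemma pp_mult: "pp x (p * q) = pp x p \<bowtie> pp x q"
proof (induction p)
  case (pCons a p)
  have "pp x (pCons a p * q) = a *\<^sub>R pp x q + x \<bowtie> (pp x p \<bowtie> pp x q)"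
    by (simp add: pp_add pp_smult pCons)
  also have "x \<bowtie> (pp x p \<bowtie> pp x q) = pp x q \<bowtie> (x \<bowtie> pp x p)"
    by (simp add: pp_commute m_comm[of "pp x p"])
  finally show ?case by (simp add: m_linear m_comm)
qed simp

text \<open>There are more powers up to \<open>DIM('a)\<close> than the dimension allows to be
  independent. Coinciding powers form a separate case because \<open>dependent\<close> speaks of a
  set and forgets repetitions.\<close>

lemma annihilating_poly: "\<exists>p. p \<noteq> 0 \<and> pp x p = 0"
proof (cases "inj_on (pw x) {..DIM('a)}")
  case False
  then obtain i j where ij: "i \<noteq> j" "pw x i = pw x j" by (auto simp: inj_on_def)
  have mon: "pp x (monom 1 k) = pw x k" for k
  proof (induction k)
    case 0
    then show ?case by (simp add: monom_0)
  next
    case (Suc k)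
    then show ?case by (simp add: monom_Suc)
  qed
  have "pp x (monom 1 i + smult (-1) (monom 1 j)) = 0"
    using ij by (simp only: pp_add pp_smult mon) simp
  moreover have "coeff (monom 1 i + smult (-1) (monom 1 j) :: real poly) i = 1" using ij by simp
  then have "monom 1 i + smult (-1) (monom 1 j) \<noteq> (0::real poly)" by (metis coeff_0 zero_neq_one)
  ultimately show ?thesis by blast
next
  case True
  let ?S = "pw x ` {..DIM('a)}"
  have "card ?S = Suc DIM('a)" using True by (simp add: card_image)
  then have "dependent ?S" using independent_bound[of ?S] by fastforce
  then obtain u v where u: "(\<Sum>v\<in>?S. u v *\<^sub>R v) = 0" "v \<in> ?S" "u v \<noteq> 0"
    using dependent_finite[of ?S] by auto
  define p where "p = (\<Sum>k\<le>DIM('a). monom (u (pw x k)) k)"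
  have cp: "coeff p k = (if k \<le> DIM('a) then u (pw x k) else 0)" for k
    by (auto simp: p_def coeff_sum)
  have "degree p \<le> DIM('a)" by (rule degree_le) (simp add: cp)
  then have "pp x p = (\<Sum>k\<le>DIM('a). coeff p k *\<^sub>R pw x k)" by (rule pp_sum)
  also have "\<dots> = (\<Sum>v\<in>?S. u v *\<^sub>R v)" using True by (simp add: cp sum.reindex)
  finally have "pp x p = 0" using u by simp
  moreover obtain k where "k \<le> DIM('a)" "v = pw x k" using u by auto
  then have "coeff p k \<noteq> 0" using u by (simp add: cp)
  ultimately show ?thesis by (metis coeff_0)
qed

text \<open>A complete system of nonzero orthogonal idempotents; a Jordan frame when it has
  \<open>jordan_rank m e\<close> members. The index type is free since spectral systems are indexed
  by their eigenvalues and refinements by an option type.\<close>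

definition jsys :: "'i set \<Rightarrow> ('i \<Rightarrow> 'a) \<Rightarrow> bool" where
  "jsys I c \<longleftrightarrow> finite I \<and> (\<forall>i\<in>I. c i \<noteq> 0) \<and> (\<Sum>i\<in>I. c i) = e \<and>
     (\<forall>i\<in>I. \<forall>j\<in>I. c i \<bowtie> c j = (if i = j then c i else 0))"

text \<open>Divide by the real quadratic of a complex root. The remainder has degree at most one and
  vanishes at the root, so it is zero if the root is not real.\<close>

lemma real_quadratic_factor:
  fixes p :: "real poly"
  assumes "degree p > 0"
  shows "\<exists>a. poly p a = 0 \<or> (\<exists>b. [: a^2 + b^2, - 2 * a, 1 :] dvd p)"
proof -
  let ?P = "map_poly complex_of_real p"
  have "degree ?P = degree p" by (rule degree_map_poly) auto
  then have "\<not> (\<exists>a l. a \<noteq> 0 \<and> l = 0 \<and> ?P = pCons a l)" using assms by auto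
  then obtain w where w: "poly ?P w = 0" using fundamental_theorem_of_algebra_alt by blast
  define a where "a = Re w"
  define b where "b = Im w"
  let ?q = "[: a^2 + b^2, - 2 * a, 1 :] :: real poly"
  have evq: "poly (map_poly complex_of_real ?q) w = 0"
    by (simp add: complex_eq_iff a_def b_def map_poly_pCons power2_eq_square algebra_simps)
  define r where "r = p mod ?q"
  have dr: "r = 0 \<or> degree r < 2" using degree_mod_less[of ?q p] by (auto simp: r_def)
  have "p = ?q * (p div ?q) + r" unfolding r_def by (rule mult_div_mod_eq[symmetric])
  moreover define ev where "ev s = poly (map_poly complex_of_real s) w" for s
  have ev: "ev 0 = 0" "ev (pCons a s) = of_real a + w * ev s" for a s
    by (simp_all add: ev_def map_poly_pCons)
  have ev_add: "ev (s + t) = ev s + ev t" for s t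
    by (induction s t rule: poly_induct2) (simp_all add: ev algebra_simps)
  have ev_smult: "ev (smult a s) = of_real a * ev s" for a s
    by (induction s) (simp_all add: ev algebra_simps)
  have ev_mult: "ev (s * t) = ev s * ev t" for s t
    by (induction s) (simp_all add: ev ev_add ev_smult algebra_simps)
  have "ev p = ev ?q * ev (p div ?q) + ev r"
    unfolding ev_mult[symmetric] ev_add[symmetric] using calculation by (rule arg_cong)
  then have rw: "poly (map_poly complex_of_real r) w = 0" using w evq by (simp add: ev_def del: map_poly_pCons)
  show ?thesis
  proof (cases "b = 0")
    case True
    then have "w = complex_of_real a" by (simp add: a_def b_def complex_eq_iff)
    moreover have "poly (map_poly complex_of_real s) (complex_of_real a) = complex_of_real (poly s a)" for s
      by (induction s) (auto simp: map_poly_pCons)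
    ultimately have "complex_of_real (poly p a) = 0" using w by metis
    then show ?thesis by auto
  next
    case False
    have "r = [: coeff r 0, coeff r 1 :]" using dr
      by (intro poly_eqI) (auto simp: coeff_pCons coeff_eq_0 split: nat.splits)
    then obtain u v where uv: "r = [: u, v :]" by blast
    then have "of_real u + w * of_real v = 0" using rw by (simp add: map_poly_pCons)
    then have "v * b = 0" "u + a * v = 0" by (auto simp: complex_eq_iff a_def b_def)
    then have "r = 0" using False uv by auto
    then have "?q dvd p" unfolding r_def by (simp only: mod_eq_0_iff_dvd)
    then show ?thesis by blast
  qed
qed

lemma prod_linear_dvd:
  fixes p :: "real poly"
  assumes "finite I" "inj_on l I" "\<And>i. i \<in> I \<Longrightarrow> poly p (l i) = 0"
  shows "(\<Prod>i\<in>I. [:- l i, 1:]) dvd p"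
  using assms
proof (induction I arbitrary: p rule: finite_induct)
  case (insert k I)
  from insert.prems have "[:- l k, 1:] dvd p" by (simp add: poly_eq_0_iff_dvd)
  then obtain s where s: "p = [:- l k, 1:] * s" by (rule dvdE)
  have "(\<Prod>i\<in>I. [:- l i, 1:]) dvd s"
  proof (rule insert.IH)
    fix i assume "i \<in> I"
    then have "l i \<noteq> l k" using insert by (auto simp: inj_on_def)
    moreover have "poly p (l i) = 0" using insert \<open>i \<in> I\<close> by blast
    ultimately show "poly s (l i) = 0" by (simp add: s)
  qed (use insert in auto)
  then show ?case using insert by (simp add: s mult_dvd_mono del: mult_pCons_left)
qed simp

lemma degree_prod_linear:
  "degree (\<Prod>i\<in>I. [:- l i, 1:] :: real poly) = card I" "lead_coeff (\<Prod>i\<in>I. [:- l i, 1:] :: real poly) = 1"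
proof -
  show "lead_coeff (\<Prod>i\<in>I. [:- l i, 1:] :: real poly) = 1" by (simp add: lead_coeff_prod)
  show "degree (\<Prod>i\<in>I. [:- l i, 1:] :: real poly) = card I"
    by (subst degree_prod_eq_sum_degree) auto
qed

text \<open>Positivity of the inner product keeps an annihilating polynomial of least degree from
  having a factor \<open>(X - a)^2 + b^2\<close>, where \<open>b = 0\<close> is allowed. So its
  roots are real and simple, and Lagrange interpolation at them yields the idempotents as
  polynomials in \<open>x\<close>.\<close>

lemma spectral:
  obtains R :: "real set" and c where "jsys R c" "x = (\<Sum>l\<in>R. l *\<^sub>R c l)" 
    "\<And>l. l \<in> R \<Longrightarrow> \<exists>p. c l = pp x p"
proof -
  obtain q0 where q0: "q0 \<noteq> 0" "pp x q0 = 0" and min0: "\<And>s. s \<noteq> 0 \<Longrightarrow> pp x s = 0 \<Longrightarrow> degree q0 \<le> degree s"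
    using ex_has_least_nat[of "\<lambda>p. p \<noteq> 0 \<and> pp x p = 0" _ degree] annihilating_poly[of x] by metis
  define R where "R = {l. poly q0 l = 0}"
  have finR: "finite R" unfolding R_def using q0 by (simp add: poly_roots_finite)
  have noquad: "\<not> [: a^2 + b^2, - 2 * a, 1 :] dvd q0" for a b
  proof
    assume "[: a^2 + b^2, - 2 * a, 1 :] dvd q0"
    then obtain s where s: "q0 = [: a^2 + b^2, - 2 * a, 1 :] * s" by (rule dvdE)
    have s0: "s \<noteq> 0" using q0 s by auto
    define t where "t = [:- a, 1:] * s"
    have t0: "t \<noteq> 0" using s0 by (simp add: t_def del: mult_pCons_left)
    have dt: "degree t = degree s + 1" "degree q0 = degree s + 2" 
      using s0 by (simp_all add: t_def s degree_mult_eq del: mult_pCons_left)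
    have "[: a^2 + b^2, - 2 * a, 1 :] = [:- a, 1:] * [:- a, 1:] + [: b^2 :]"
      by (simp add: power2_eq_square)
    \<comment> \<open>The additional factor \<open>s\<close> completes two squares. Paired with
      \<open>e\<close> they become squared norms, so \<open>t\<close>, whose degree is one lower
      than that of \<open>q0\<close>, would annihilate \<open>x\<close> as well.\<close>
    then have "q0 * s = t * t + smult (b^2) (s * s)"
      unfolding s t_def by (simp add: algebra_simps del: mult_pCons_left mult_pCons_right)
         (simp add: algebra_simps)
    then have "pp x q0 \<bowtie> pp x s = pp x t \<bowtie> pp x t + b^2 *\<^sub>R (pp x s \<bowtie> pp x s)"
      by (metis pp_mult pp_add pp_smult)
    then have "0 = (pp x t \<bowtie> pp x t + b^2 *\<^sub>R (pp x s \<bowtie> pp x s)) \<bullet> e" using q0 by simp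
    also have "\<dots> = pp x t \<bullet> pp x t + b^2 * (pp x s \<bullet> pp x s)"
      by (simp add: inner_add_left assoc_inner)
    finally have "pp x t \<bullet> pp x t \<le> 0" by (smt (verit) inner_ge_zero mult_nonneg_nonneg zero_le_power2)
    then have "pp x t \<bullet> pp x t = 0" using inner_ge_zero[of "pp x t"] by linarith
    then have "pp x t = 0" by simp
    then have "degree q0 \<le> degree t" using min0 t0 by blast
    then show False using dt by simp
  qed
  define q where "q = (\<Prod>l\<in>R. [:- l, 1:])"
  have "q dvd q0" unfolding q_def by (rule prod_linear_dvd) (use finR in \<open>auto simp: R_def\<close>)
  then obtain s where s: "q0 = q * s" by (rule dvdE)
  have s0: "s \<noteq> 0" using q0 s by auto
  have ds: "degree s = 0"
  proof (rule ccontr)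
    assume "degree s \<noteq> 0"
    then obtain a where "poly s a = 0 \<or> (\<exists>b. [: a^2 + b^2, - 2 * a, 1 :] dvd s)"
      using real_quadratic_factor[of s] by auto
    then have a: "poly s a = 0" using noquad s dvd_mult by blast
    then have "a \<in> R" by (simp add: R_def s)
    then have "q = [:- a, 1:] * (\<Prod>l\<in>R - {a}. [:- l, 1:])" unfolding q_def using finR by (simp add: prod.remove)
    moreover obtain s' where "s = [:- a, 1:] * s'" using a by (auto simp: poly_eq_0_iff_dvd elim: dvdE)
    ultimately have "[:- a, 1:] * [:- a, 1:] dvd q0" unfolding s
      by (metis dvd_triv_left mult_dvd_mono)
    \<comment> \<open>A root of the cofactor is also a root of \<open>q\<close>, hence a double root
      of \<open>q0\<close>, which is the excluded factor with \<open>b = 0\<close>.\<close>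
    moreover have "[:- a, 1:] * [:- a, 1:] = [: a^2 + 0^2, - 2 * a, 1 :]" by (simp add: power2_eq_square)
    ultimately show False using noquad by metis
  qed
  have mult: "pp x p = 0" if "q dvd p" for p
  proof -
    obtain k where k: "s = [:k:]" using ds degree_eq_zeroE by blast
    then have "k \<noteq> 0" using s0 by simp
    have "q0 = smult k q" using s k by simp
    then have "pp x q = 0" using q0 \<open>k \<noteq> 0\<close> by (simp add: pp_smult)
    then show ?thesis using that by (auto simp: pp_mult elim: dvdE)
  qed
  have min: "degree q \<le> degree p" if "p \<noteq> 0" "pp x p = 0" for p
    using min0[OF that] ds s0 q0 by (simp add: s degree_mult_eq)
  \<comment> \<open>Lagrange basis polynomials; modulo \<open>q\<close> they are orthogonal
    idempotents with sum one.\<close>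
  define l0 where "l0 a = smult (1 / (\<Prod>b\<in>R - {a}. (a - b))) (\<Prod>b\<in>R - {a}. [:- b, 1:])" for a
  have ev: "poly (l0 a) b = (if a = b then 1 else 0)" if "a \<in> R" "b \<in> R" for a b
  proof (cases "a = b")
    case True
    have "(\<Prod>b\<in>R - {a}. (a - b)) \<noteq> 0" using finR by (auto simp: prod_zero_iff)
    then show ?thesis using True by (simp add: l0_def poly_prod)
  next
    case False
    then have "(\<Prod>c\<in>R - {a}. poly [:- c, 1:] b) = 0" using finR that by (intro prod_zero) auto
    then show ?thesis using False by (simp add: l0_def poly_prod)
  qed
  define c where "c a = pp x (l0 a)" for a
  have rep: "pp x p = (\<Sum>a\<in>R. poly p a *\<^sub>R c a)" for p
  proof -
    let ?t = "p + smult (-1) (\<Sum>a\<in>R. smult (poly p a) (l0 a))"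
    have psum: "pp x (\<Sum>a\<in>A. smult (poly p a) (l0 a)) = (\<Sum>a\<in>A. poly p a *\<^sub>R c a)" for A
      by (induction A rule: infinite_finite_induct) (auto simp: pp_add pp_smult c_def)
    have "q dvd ?t" unfolding q_def
    proof (rule prod_linear_dvd)
      fix b assume "b \<in> R"
      have "(\<Sum>a\<in>R. poly p a * poly (l0 a) b) = (\<Sum>a\<in>R. if a = b then poly p a else 0)"
        using \<open>b \<in> R\<close> by (intro sum.cong) (auto simp: ev)
      also have "\<dots> = poly p b" using \<open>b \<in> R\<close> finR by simp
      finally show "poly ?t b = 0" by (simp add: poly_sum)
    qed (use finR in auto)
    then have "pp x ?t = 0" by (rule mult)
    then show ?thesis by (simp only: pp_add pp_smult psum) simp
  qed
  have c_nz: "c a \<noteq> 0" if "a \<in> R" for a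
  proof
    assume "c a = 0"
    have "(\<Prod>b\<in>R - {a}. (a - b)) \<noteq> 0" using finR by (auto simp: prod_zero_iff)
    then have "l0 a \<noteq> 0" "degree (l0 a) = card (R - {a})"
      by (auto simp: l0_def degree_prod_linear prod_zero_iff finR)
    moreover have "degree q = card R" by (simp add: q_def degree_prod_linear)
    moreover have "card (R - {a}) < card R" using that finR by (intro card_Diff1_less) auto
    ultimately show False using min[of "l0 a"] \<open>c a = 0\<close> by (simp add: c_def)
  qed
  show thesis
  proof (rule that[of R c])
    show "x = (\<Sum>l\<in>R. l *\<^sub>R c l)" using rep[of "[:0, 1:]"] by simp
    show "\<exists>p. c l = pp x p" if "l \<in> R" for l by (auto simp: c_def)
    show "jsys R c" unfolding jsys_def
    proof (intro conjI ballI)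
      show "(\<Sum>i\<in>R. c i) = e" using rep[of "[:1:]"] by simp
      fix a b assume ab: "a \<in> R" "b \<in> R"
      have "c a \<bowtie> c b = (\<Sum>k\<in>R. poly (l0 a * l0 b) k *\<^sub>R c k)" by (subst rep[symmetric]) (simp add: c_def pp_mult)
      also have "\<dots> = (\<Sum>k\<in>R. if k = a then (if a = b then c a else 0) else 0)"
        using ab by (intro sum.cong) (auto simp: ev)
      also have "\<dots> = (if a = b then c a else 0)" using ab finR by simp
      finally show "c a \<bowtie> c b = (if a = b then c a else 0)" .
    qed (use finR c_nz in auto)
  qed
qed

section \<open>Calculus with systems of idempotents and the rank\<close>

lemma jsys_idem: "jsys I c \<Longrightarrow> i \<in> I \<Longrightarrow> c i \<bowtie> c i = c i"
  and jsys_orth: "jsys I c \<Longrightarrow> i \<in> I \<Longrightarrow> j \<in> I \<Longrightarrow> i \<noteq> j \<Longrightarrow> c i \<bowtie> c j = 0"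
  by (auto simp: jsys_def)

lemma jsys_mult:
  assumes "jsys I c"
  shows "(\<Sum>i\<in>I. a i *\<^sub>R c i) \<bowtie> (\<Sum>i\<in>I. b i *\<^sub>R c i) = (\<Sum>i\<in>I. (a i * b i) *\<^sub>R c i)"
proof -
  have "(\<Sum>i\<in>I. a i *\<^sub>R c i) \<bowtie> (\<Sum>i\<in>I. b i *\<^sub>R c i) = (\<Sum>j\<in>I. \<Sum>i\<in>I. (a j * b i) *\<^sub>R (c j \<bowtie> c i))"
    by (subst m_sum_left) (simp add: m_sum_right m_linear mult.commute)
  also have "\<dots> = (\<Sum>j\<in>I. \<Sum>i\<in>I. if i = j then (a j * b i) *\<^sub>R c j else 0)"
    using assms by (intro sum.cong) (auto simp: jsys_def)
  also have "\<dots> = (\<Sum>j\<in>I. (a j * b j) *\<^sub>R c j)" using assms by (simp add: jsys_def)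
  finally show ?thesis .
qed

lemma jsys_pp:
  assumes "jsys I c" 
  shows "pp (\<Sum>i\<in>I. l i *\<^sub>R c i) p = (\<Sum>i\<in>I. poly p (l i) *\<^sub>R c i)"
proof (induction p)
  case (pCons a p)
  have "a *\<^sub>R e = (\<Sum>i\<in>I. a *\<^sub>R c i)" using assms by (auto simp: jsys_def scaleR_sum_right)
  then show ?case using pCons(2)
    by (simp add: jsys_mult[OF assms] sum.distrib[symmetric] scaleR_add_left)
qed simp

lemma jsys_inner_orth: "jsys I c \<Longrightarrow> i \<in> I \<Longrightarrow> j \<in> I \<Longrightarrow> i \<noteq> j \<Longrightarrow> c i \<bullet> c j = 0"
  by (metis assoc_inner inner_zero_right jsys_idem jsys_orth)

lemma jsys_inner:
  assumes "jsys I c" "j \<in> I"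
  shows "(\<Sum>i\<in>I. a i *\<^sub>R c i) \<bullet> c j = a j * (norm (c j))\<^sup>2"
proof -
  have "(\<Sum>i\<in>I. a i *\<^sub>R c i) \<bullet> c j = (\<Sum>i\<in>I. if i = j then a j * (c j \<bullet> c j) else 0)"
    unfolding inner_sum_left using assms by (intro sum.cong) (auto simp: jsys_inner_orth)
  also have "\<dots> = a j * (norm (c j))\<^sup>2" using assms by (simp add: jsys_def power2_norm_eq_inner)
  finally show ?thesis .
qed

lemma jsys_sum_eq_0:
  assumes "jsys I c" "(\<Sum>i\<in>I. a i *\<^sub>R c i) = 0" "j \<in> I"
  shows "a j = 0"
  using jsys_inner[OF assms(1,3), of a] assms by (auto simp: jsys_def)

text \<open>A polynomial acts on the coefficients one by one and the idempotents are independent, so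
  annihilating \<open>x\<close> amounts to vanishing at every \<open>l i\<close>; these are
  distinct.\<close>

lemma jsys_min_poly:
  assumes "jsys I c" "inj_on l I" "x = (\<Sum>i\<in>I. l i *\<^sub>R c i)"
  shows "jordan_min_poly m e x = (\<Prod>i\<in>I. [:- l i, 1:])"
proof -
  let ?q = "\<Prod>i\<in>I. [:- l i, 1:]"
  have fin: "finite I" using assms by (simp add: jsys_def)
  have root: "?q dvd s" if "pp x s = 0" for s
  proof (rule prod_linear_dvd[OF fin assms(2)])
    fix i assume "i \<in> I"
    have "(\<Sum>i\<in>I. poly s (l i) *\<^sub>R c i) = 0" using that jsys_pp[OF assms(1)] assms(3) by simp
    then show "poly s (l i) = 0" by (rule jsys_sum_eq_0[OF assms(1) _ \<open>i \<in> I\<close>])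
  qed
  have ann: "pp x ?q = 0" unfolding assms(3) jsys_pp[OF assms(1)]
  proof (intro sum.neutral ballI)
    fix i assume "i \<in> I"
    then have "poly ?q (l i) = 0" unfolding poly_prod using fin by (intro prod_zero) auto
    then show "poly ?q (l i) *\<^sub>R c i = 0" by simp
  qed
  show ?thesis unfolding jordan_min_poly_def pp_def[symmetric]
  proof (rule the_equality)
    show "lead_coeff ?q = 1 \<and> pp x ?q = 0 \<and> (\<forall>s. s \<noteq> 0 \<and> pp x s = 0 \<longrightarrow> degree ?q \<le> degree s)"
      using ann root by (auto simp: degree_prod_linear(2) intro: dvd_imp_degree_le)
    fix q' assume q': "lead_coeff q' = 1 \<and> pp x q' = 0 \<and> (\<forall>s. s \<noteq> 0 \<and> pp x s = 0 \<longrightarrow> degree q' \<le> degree s)"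
    then have "q' \<noteq> 0" by auto
    obtain s where s: "q' = ?q * s" using root q' by (metis dvdE)
    have "?q \<noteq> 0" using degree_prod_linear(2)[of l I] by auto
    then have "degree q' \<le> degree ?q" using q' ann by blast
    moreover have "s \<noteq> 0" using s \<open>q' \<noteq> 0\<close> by auto
    ultimately have "degree s = 0" using s \<open>?q \<noteq> 0\<close> by (simp add: degree_mult_eq)
    then obtain k where k: "s = [:k:]" using degree_eq_zeroE by blast
    have "lead_coeff q' = lead_coeff ?q * lead_coeff s" unfolding s by (rule lead_coeff_mult)
    then have "k = 1" using q' k degree_prod_linear(2)[of l I] by simp
    then show "q' = ?q" using s k by simp
  qed
qed

lemma jsys_card: "jsys I c \<Longrightarrow> card I \<le> DIM('a)"
proof -
  assume s: "jsys I c"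
  have inj: "inj_on c I"
  proof (rule inj_onI)
    fix i j assume "i \<in> I" "j \<in> I" "c i = c j"
    then show "i = j" using s jsys_idem[OF s] jsys_orth[OF s] by (metis jsys_def)
  qed
  have "pairwise orthogonal (c ` I)" using jsys_inner_orth[OF s]
    by (auto simp: pairwise_def orthogonal_def)
  moreover have "0 \<notin> c ` I" using s by (auto simp: jsys_def)
  ultimately have "independent (c ` I)" by (simp add: pairwise_orthogonal_independent)
  then have "card (c ` I) \<le> DIM('a)" using independent_bound by blast
  then show ?thesis using inj by (simp add: card_image)
qed

lemma jsys_element:
  assumes "jsys I c"
  obtains x where "degree (jordan_min_poly m e x) = card I"
proof -
  have "finite I" using assms by (simp add: jsys_def)
  then obtain f n where f: "inj_on f I" "f ` I = {i. i < (n::nat)}" by (metis finite_imp_inj_to_nat_seg)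
  then have "inj_on (\<lambda>i. real (f i)) I" by (auto simp: inj_on_def)
  from jsys_min_poly[OF assms this refl] show thesis 
    using degree_prod_linear(1)[of "\<lambda>i. real (f i)" I] by (intro that[of "\<Sum>i\<in>I. real (f i) *\<^sub>R c i"]) auto
qed

lemma spectral_min_poly:
  obtains R :: "real set" and c where "jsys R c" "x = (\<Sum>l\<in>R. l *\<^sub>R c l)" 
    "jordan_min_poly m e x = (\<Prod>l\<in>R. [:- l, 1:])" "degree (jordan_min_poly m e x) = card R"
proof -
  obtain R c where "jsys R c" "x = (\<Sum>l\<in>R. l *\<^sub>R c l)" using spectral by metis
  then show thesis using jsys_min_poly[of R c "\<lambda>l. l" x] that degree_prod_linear(1)[of "\<lambda>l. l" R] by auto
qed

text \<open>Gives \<open>Max\<close> in the definition of the rank its intended value.\<close>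

lemma finite_degrees: "finite (range (\<lambda>x. degree (jordan_min_poly m e x)))"
proof (rule finite_subset)
  show "range (\<lambda>x. degree (jordan_min_poly m e x)) \<subseteq> {..DIM('a)}"
  proof (rule image_subsetI)
    fix x
    obtain R :: "real set" and c where "jsys R c" "degree (jordan_min_poly m e x) = card R"
      using spectral_min_poly[of x] by blast
    then show "degree (jordan_min_poly m e x) \<in> {..DIM('a)}" using jsys_card by auto
  qed
qed simp

lemma jsys_card_le_rank: "jsys I c \<Longrightarrow> card I \<le> jordan_rank m e"
proof -
  assume "jsys I c"
  then obtain x where x: "degree (jordan_min_poly m e x) = card I" by (rule jsys_element)
  then show ?thesis unfolding jordan_rank_def using finite_degrees by (metis Max_ge rangeI)
qed

lemma regular_exists: "\<exists>x. jordan_regular m e x"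
proof -
  have "Max (range (\<lambda>x. degree (jordan_min_poly m e x))) \<in> range (\<lambda>x. degree (jordan_min_poly m e x))"
    using finite_degrees by (intro Max_in) auto
  then obtain x where "Max (range (\<lambda>x. degree (jordan_min_poly m e x))) = degree (jordan_min_poly m e x)" by blast
  then show ?thesis unfolding jordan_regular_def jordan_rank_def by (intro exI[of _ x]) simp
qed

end

section \<open>Peirce decompositions and the symmetric cone\<close>

context euclidean_jordan
begin

text \<open>The roots of 2 t^3 - 3 t^2 + t are 0, 1/2 and 1: these are the possible eigenvalues of
  multiplication by an idempotent.\<close>

lemma peirce_cubic:
  assumes "c \<bowtie> c = c"
  shows "2 *\<^sub>R (c \<bowtie> (c \<bowtie> (c \<bowtie> z))) = 3 *\<^sub>R (c \<bowtie> (c \<bowtie> z)) - c \<bowtie> z"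
  using mult_op[of c c c z] assms
  by (simp add: scaleR_2 algebra_simps) (metis add.assoc scaleR_2 scaleR_left.add one_add_one numeral_Bit1 numeral_One scaleR_one)

text \<open>The projections onto the eigenspaces \<open>1\<close>, \<open>1/2\<close>, \<open>0\<close> of multiplication by an idempotent \<open>c\<close>.\<close>

definition E1 where "E1 c z = 2 *\<^sub>R (c \<bowtie> (c \<bowtie> z)) - c \<bowtie> z"
definition Eh where "Eh c z = 4 *\<^sub>R (c \<bowtie> z) - 4 *\<^sub>R (c \<bowtie> (c \<bowtie> z))"
definition E0 where "E0 c z = z - 3 *\<^sub>R (c \<bowtie> z) + 2 *\<^sub>R (c \<bowtie> (c \<bowtie> z))"

lemma peirce_sum: "E1 c z + Eh c z + E0 c z = z"
proof -
  have "E1 c z + Eh c z + E0 c z = (2 + 2 - 4) *\<^sub>R (c \<bowtie> (c \<bowtie> z)) + (4 - 1 - 3) *\<^sub>R (c \<bowtie> z) + z"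
    unfolding E1_def Eh_def E0_def scaleR_diff_left scaleR_add_left by simp
  then show ?thesis by simp
qed

lemma peirce_eigen:
  assumes "c \<bowtie> c = c"
  shows "c \<bowtie> E1 c z = E1 c z" "c \<bowtie> Eh c z = (1/2) *\<^sub>R Eh c z" "c \<bowtie> E0 c z = 0"
proof -
  define a where "a = c \<bowtie> z"
  define b where "b = c \<bowtie> a"
  have c3: "2 *\<^sub>R (c \<bowtie> b) = 3 *\<^sub>R b - a" using peirce_cubic[OF assms, of z] by (simp add: a_def b_def)
  then have "(2::real) *\<^sub>R (2 *\<^sub>R (c \<bowtie> b)) = 2 *\<^sub>R (3 *\<^sub>R b - a)" by simp
  then have c34: "4 *\<^sub>R (c \<bowtie> b) = 6 *\<^sub>R b - 2 *\<^sub>R a" by (simp add: scaleR_diff_right)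
  have "c \<bowtie> E1 c z = 2 *\<^sub>R (c \<bowtie> b) - b" by (simp add: E1_def m_linear a_def b_def)
  also have "\<dots> = 3 *\<^sub>R b - a - 1 *\<^sub>R b" unfolding c3 by simp
  also have "\<dots> = 2 *\<^sub>R b - a" using scaleR_left_distrib[of 1 2 b] by simp
  finally show "c \<bowtie> E1 c z = E1 c z" by (simp add: E1_def a_def b_def)
  have "c \<bowtie> Eh c z = 4 *\<^sub>R b - 4 *\<^sub>R (c \<bowtie> b)" by (simp add: Eh_def m_linear a_def b_def)
  also have "\<dots> = 4 *\<^sub>R b - (6 *\<^sub>R b - 2 *\<^sub>R a)" unfolding c34 by simp
  also have "\<dots> = 2 *\<^sub>R a + (4 - 6) *\<^sub>R b" by (simp only: scaleR_diff_left) simp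
  also have "\<dots> = (1/2) *\<^sub>R Eh c z" by (simp add: Eh_def a_def b_def scaleR_diff_right)
  finally show "c \<bowtie> Eh c z = (1/2) *\<^sub>R Eh c z" .
  have "c \<bowtie> E0 c z = a - 3 *\<^sub>R b + 2 *\<^sub>R (c \<bowtie> b)" by (simp add: E0_def m_linear a_def b_def)
  then show "c \<bowtie> E0 c z = 0" unfolding c3 by simp
qed

lemma eigen_projections:
  shows "c \<bowtie> z = z \<Longrightarrow> E1 c z = z \<and> Eh c z = 0 \<and> E0 c z = 0"
    and "c \<bowtie> z = (1/2) *\<^sub>R z \<Longrightarrow> E1 c z = 0 \<and> Eh c z = z \<and> E0 c z = 0"
    and "c \<bowtie> z = 0 \<Longrightarrow> E1 c z = 0 \<and> Eh c z = 0 \<and> E0 c z = z"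
proof -
  assume c: "c \<bowtie> z = z"
  have "2 *\<^sub>R z - z = (2 - 1) *\<^sub>R z" "z - 3 *\<^sub>R z + 2 *\<^sub>R z = (1 - 3 + 2) *\<^sub>R z"
    unfolding scaleR_diff_left scaleR_add_left by simp_all
  then show "E1 c z = z \<and> Eh c z = 0 \<and> E0 c z = 0" by (simp add: E1_def Eh_def E0_def c)
next
  assume c: "c \<bowtie> z = (1/2) *\<^sub>R z"
  have "2 *\<^sub>R z - z = (2 - 1) *\<^sub>R z" "z - (3/2) *\<^sub>R z + (1/2) *\<^sub>R z = (1 - 3/2 + 1/2) *\<^sub>R z"
    unfolding scaleR_diff_left scaleR_add_left by simp_all
  then show "E1 c z = 0 \<and> Eh c z = z \<and> E0 c z = 0" by (simp add: E1_def Eh_def E0_def c m_linear)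
next
  assume c: "c \<bowtie> z = 0"
  then show "E1 c z = 0 \<and> Eh c z = 0 \<and> E0 c z = z" by (simp add: E1_def Eh_def E0_def c)
qed

lemma linear_E: "linear (E1 c)" "linear (Eh c)" "linear (E0 c)"
  by (auto simp: linear_iff E1_def Eh_def E0_def m_linear scaleR_add_right scaleR_diff_right mult.commute)

lemma inner_E: "E1 c x \<bullet> y = x \<bullet> E1 c y" "Eh c x \<bullet> y = x \<bullet> Eh c y" "E0 c x \<bullet> y = x \<bullet> E0 c y"
proof -
  have a: "(c \<bowtie> x) \<bullet> y = x \<bullet> (c \<bowtie> y)" "(c \<bowtie> (c \<bowtie> x)) \<bullet> y = x \<bullet> (c \<bowtie> (c \<bowtie> y))" for x y
    by (simp_all add: assoc_inner)
  show "E1 c x \<bullet> y = x \<bullet> E1 c y" "Eh c x \<bullet> y = x \<bullet> Eh c y" "E0 c x \<bullet> y = x \<bullet> E0 c y"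
    by (simp_all add: E1_def Eh_def E0_def inner_diff_left inner_diff_right inner_add_left inner_add_right a)
qed

lemma inner_m: "(c \<bowtie> x) \<bullet> y = x \<bullet> (c \<bowtie> y)"
  by (rule assoc_inner)

lemma eigen_orth:
  assumes "c \<bowtie> x = a *\<^sub>R x" "c \<bowtie> y = b *\<^sub>R y" "a \<noteq> b"
  shows "x \<bullet> y = 0"
proof -
  have "a * (x \<bullet> y) = b * (x \<bullet> y)" using inner_m[of c x y] assms by simp
  then show ?thesis using assms by simp
qed

lemma E_E:
  assumes "c \<bowtie> c = c"
  shows "E1 c (E1 c z) = E1 c z" "E1 c (Eh c z) = 0" "E1 c (E0 c z) = 0"
    "Eh c (E1 c z) = 0" "Eh c (Eh c z) = Eh c z" "Eh c (E0 c z) = 0"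
    "E0 c (E1 c z) = 0" "E0 c (Eh c z) = 0" "E0 c (E0 c z) = E0 c z"
  using eigen_projections[of c "E1 c z"] eigen_projections[of c "Eh c z"] eigen_projections[of c "E0 c z"]
    peirce_eigen[OF assms, of z] by simp_all

lemma m_E: assumes "c \<bowtie> c = c" shows "c \<bowtie> z = E1 c z + (1/2) *\<^sub>R Eh c z"
proof -
  have "c \<bowtie> z = c \<bowtie> (E1 c z + Eh c z + E0 c z)" by (simp add: peirce_sum)
  then show ?thesis by (simp add: m_linear peirce_eigen[OF assms])
qed

lemma idempotent_psd:
  assumes c: "c \<bowtie> c = c"
  shows "a \<bullet> (c \<bowtie> a) \<ge> 0"
proof -
  have "a \<bullet> (c \<bowtie> a) = a \<bullet> E1 c (E1 c a) + (1/2) * (a \<bullet> Eh c (Eh c a))"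
    by (simp add: m_E[OF c] inner_add_right E_E[OF c])
  also have "\<dots> = E1 c a \<bullet> E1 c a + (1/2) * (Eh c a \<bullet> Eh c a)"
    by (simp add: inner_E)
  finally show ?thesis by simp
qed

section \<open>The closed cone of squares, its self-duality and its interior\<close>

definition Q :: "'a set" where "Q = range (\<lambda>x. x \<bowtie> x)"

definition Om :: "'a set" where "Om = jordan_cone m"

lemma Om_interior: "Om = interior Q"
  by (simp add: Om_def Q_def jordan_cone_def)

lemma jsys_square: "jsys I c \<Longrightarrow> (\<Sum>i\<in>I. a i *\<^sub>R c i) \<bowtie> (\<Sum>i\<in>I. a i *\<^sub>R c i) = (\<Sum>i\<in>I. (a i)\<^sup>2 *\<^sub>R c i)"
  by (simp add: jsys_mult power2_eq_square)

text \<open>The spectral decomposition of \<open>b\<close> makes its square a nonnegative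
  combination of idempotents \<open>c\<close>, and
  \<open>c \<bullet> (a \<bowtie> a) = a \<bullet> (c \<bowtie> a)\<close>.\<close>

lemma inner_squares_nonneg: "(b \<bowtie> b) \<bullet> (a \<bowtie> a) \<ge> 0"
proof -
  obtain R :: "real set" and c where R: "jsys R c" and b: "b = (\<Sum>l\<in>R. l *\<^sub>R c l)" using spectral by metis
  have "c l \<bullet> (a \<bowtie> a) \<ge> 0" if "l \<in> R" for l
    using idempotent_psd[OF jsys_idem[OF R that], of a] inner_square[of a "c l"] by linarith
  then show ?thesis unfolding b jsys_square[OF R] inner_sum_left
    by (intro sum_nonneg) simp
qed

lemma Q_jsys_nonneg:
  assumes "jsys I c" "\<And>i. i \<in> I \<Longrightarrow> l i \<ge> 0"
  shows "(\<Sum>i\<in>I. l i *\<^sub>R c i) \<in> Q"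
proof -
  have "(\<Sum>i\<in>I. l i *\<^sub>R c i) = (\<Sum>i\<in>I. (sqrt (l i))\<^sup>2 *\<^sub>R c i)" using assms(2) by (intro sum.cong) auto
  then show ?thesis unfolding Q_def jsys_square[OF assms(1), symmetric] by auto
qed

text \<open>For the converse, test against the spectral idempotents of \<open>x\<close>, which are
  squares: all eigenvalues are nonnegative and have square roots.\<close>

lemma Q_iff: "x \<in> Q \<longleftrightarrow> (\<forall>a. x \<bullet> (a \<bowtie> a) \<ge> 0)"
proof
  show "x \<in> Q \<Longrightarrow> \<forall>a. x \<bullet> (a \<bowtie> a) \<ge> 0" using inner_squares_nonneg by (auto simp: Q_def)
  assume a: "\<forall>a. x \<bullet> (a \<bowtie> a) \<ge> 0"
  obtain R :: "real set" and c where R: "jsys R c" and x: "x = (\<Sum>l\<in>R. l *\<^sub>R c l)" using spectral by metis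
  have "l \<ge> 0" if "l \<in> R" for l
  proof -
    have "x \<bullet> c l = l * (norm (c l))\<^sup>2" by (subst x) (rule jsys_inner[OF R that])
    moreover have "x \<bullet> c l \<ge> 0" using a[rule_format, of "c l"] jsys_idem[OF R that] by simp
    moreover have "(norm (c l))\<^sup>2 > 0" using R that by (auto simp: jsys_def)
    ultimately show ?thesis by (simp add: zero_le_mult_iff)
  qed
  then show "x \<in> Q" unfolding x by (intro Q_jsys_nonneg[OF R])
qed

lemma Q_dual: "x \<in> Q \<longleftrightarrow> (\<forall>y\<in>Q. x \<bullet> y \<ge> 0)"
  unfolding Q_iff[of x] by (auto simp: Q_def)

lemma Q_inner: "x \<in> Q \<Longrightarrow> y \<in> Q \<Longrightarrow> x \<bullet> y \<ge> 0"
  using Q_dual by blast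

lemma idempotent_in_Q: "c \<bowtie> c = c \<Longrightarrow> c \<in> Q"
  unfolding Q_def by (rule range_eqI[of _ _ c]) simp

lemma closed_Q: "closed Q"
proof -
  have "Q = (\<Inter>a. {x. 0 \<le> x \<bullet> (a \<bowtie> a)})" by (auto simp: Q_iff)
  then show ?thesis by (auto intro!: closed_INT closed_Collect_le continuous_intros)
qed

text \<open>From \<open>norm c \<le> B * norm c * norm c\<close> for a bound \<open>B\<close> of the
  product. The uniformity matters because the spectral idempotents of nearby points need not be
  close to each other.\<close>

lemma idempotent_norm: "\<exists>k>0. \<forall>c. c \<bowtie> c = c \<longrightarrow> c \<noteq> 0 \<longrightarrow> k \<le> norm c"
proof -
  obtain B where B: "B > 0" "\<And>x y. norm (x \<bowtie> y) \<le> B * norm x * norm y"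
    using bilinear_bounded_pos[OF bil] by blast
  have "1 / B \<le> norm c" if "c \<bowtie> c = c" "c \<noteq> 0" for c
  proof -
    have "norm c \<le> B * norm c * norm c" using B(2)[of c c] that by simp
    then have "1 \<le> B * norm c" using that by (simp add: mult.commute mult.left_commute)
    then show ?thesis using B by (simp add: field_simps)
  qed
  then show ?thesis using B by (intro exI[of _ "1 / B"]) auto
qed

text \<open>Let \<open>v\<close> be within \<open>\<epsilon> * k\<close> of the point and
  \<open>c\<close> one of its spectral idempotents. Then \<open>v \<bullet> c\<close> is at least
  \<open>\<epsilon> * norm c * (norm c - k)\<close>, which is nonnegative, so the eigenvalue is
  too.\<close>

lemma Q_plus_unit_interior:
  assumes "x \<in> Q" "\<epsilon> > 0"
  shows "x + \<epsilon> *\<^sub>R e \<in> Om"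
proof -
  obtain k where k: "k > 0" "\<And>c. c \<bowtie> c = c \<Longrightarrow> c \<noteq> 0 \<Longrightarrow> k \<le> norm c" using idempotent_norm by blast
  have "ball (x + \<epsilon> *\<^sub>R e) (\<epsilon> * k) \<subseteq> Q"
  proof
    fix v assume v: "v \<in> ball (x + \<epsilon> *\<^sub>R e) (\<epsilon> * k)"
    define u where "u = x + \<epsilon> *\<^sub>R e"
    obtain R :: "real set" and c where R: "jsys R c" and vr: "v = (\<Sum>l\<in>R. l *\<^sub>R c l)" using spectral by metis
    have "l \<ge> 0" if "l \<in> R" for l
    proof -
      have id: "c l \<bowtie> c l = c l" "c l \<noteq> 0" using R that by (auto simp: jsys_def)
      have e1: "e \<bullet> c l = (norm (c l))\<^sup>2" 
        using assoc_inner[of "c l" e "c l"] id by (simp add: power2_norm_eq_inner)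
      have "x \<bullet> c l \<ge> 0" using Q_dual assms(1) idempotent_in_Q[OF id(1)] by blast
      then have "u \<bullet> c l \<ge> \<epsilon> * (norm (c l))\<^sup>2" by (simp add: u_def inner_add_left e1)
      moreover have "(v - u) \<bullet> c l \<ge> - (norm (v - u) * norm (c l))"
        using Cauchy_Schwarz_ineq2[of "v - u" "c l"] by linarith
      moreover have "norm (v - u) * norm (c l) \<le> (\<epsilon> * k) * norm (c l)"
        using v by (intro mult_right_mono) (auto simp: u_def dist_norm norm_minus_commute)
      moreover have "(\<epsilon> * k) * norm (c l) \<le> (\<epsilon> * norm (c l)) * norm (c l)"
        using k id assms by (intro mult_right_mono mult_left_mono) auto
      ultimately have "v \<bullet> c l \<ge> 0" by (simp add: inner_diff_left power2_eq_square mult.assoc)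
      moreover have "v \<bullet> c l = l * (norm (c l))\<^sup>2" by (subst vr) (rule jsys_inner[OF R that])
      moreover have "(norm (c l))\<^sup>2 > 0" using id by simp
      ultimately show ?thesis by (simp add: zero_le_mult_iff)
    qed
    then show "v \<in> Q" unfolding vr by (intro Q_jsys_nonneg[OF R])
  qed
  moreover have "\<epsilon> * k > 0" using assms k by simp
  ultimately show ?thesis unfolding Om_interior by (meson centre_in_ball interior_maximal open_ball subsetD)
qed

lemma open_Om: "open Om" by (simp add: Om_interior)

lemma Om_subset_Q: "Om \<subseteq> Q" by (simp add: Om_interior interior_subset)

lemma closure_Om: "closure Om = Q"
proof
  show "closure Om \<subseteq> Q" using Om_subset_Q closed_Q by (rule closure_minimal)
  show "Q \<subseteq> closure Om"
  proof
    fix x assume x: "x \<in> Q"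
    have lim: "(\<lambda>k. x + (1 / real (Suc k)) *\<^sub>R e) \<longlonglongrightarrow> x + 0 *\<^sub>R e"
      by (intro tendsto_intros LIMSEQ_Suc[OF lim_1_over_n])
    moreover have "x + (1 / real (Suc k)) *\<^sub>R e \<in> Om" for k using Q_plus_unit_interior[OF x] by simp
    ultimately show "x \<in> closure Om" using lim unfolding closure_sequential
      by (intro exI[of _ "\<lambda>k. x + (1 / real (Suc k)) *\<^sub>R e"]) auto
  qed
qed

lemma zero_in_Q: "0 \<in> Q" unfolding Q_def by (rule range_eqI[of _ _ 0]) simp

lemma unit_in_Om: "e \<in> Om"
  using Q_plus_unit_interior[OF zero_in_Q, of 1] by simp

lemma Om_minus:
  assumes "x \<in> Om" obtains \<epsilon> where "\<epsilon> > 0" "x - \<epsilon> *\<^sub>R e \<in> Q"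
proof -
  obtain d where d: "d > 0" "ball x d \<subseteq> Om" using open_Om assms by (meson open_contains_ball)
  define \<epsilon> where "\<epsilon> = d / (2 * (norm e + 1))"
  have pos: "norm e + 1 > 0" by (smt (verit) norm_ge_zero)
  then have "\<epsilon> > 0" using d by (simp add: \<epsilon>_def)
  moreover have "\<epsilon> * norm e < d"
  proof -
    have "\<epsilon> * norm e \<le> \<epsilon> * (norm e + 1)" using \<open>\<epsilon> > 0\<close> by simp
    also have "\<dots> = d / 2" using pos unfolding \<epsilon>_def by (metis mult.commute less_irrefl nonzero_mult_divide_mult_cancel_right times_divide_eq_left)
    finally show ?thesis using d by simp
  qed
  then have "x - \<epsilon> *\<^sub>R e \<in> ball x d" using \<open>\<epsilon> > 0\<close> by (simp add: dist_norm)
  ultimately show thesis using that d Om_subset_Q by blast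
qed

lemma Om_inner_pos:
  assumes "x \<in> Om" "y \<in> Q" "y \<noteq> 0" shows "x \<bullet> y > 0"
proof -
  obtain \<epsilon> where \<epsilon>: "\<epsilon> > 0" "x - \<epsilon> *\<^sub>R e \<in> Q" using Om_minus assms by blast
  obtain b where b: "y = b \<bowtie> b" using assms by (auto simp: Q_def)
  have "b \<noteq> 0" using b assms by auto
  have "e \<bullet> y = b \<bullet> b" unfolding b using assoc_inner[of b e b] by (simp add: m_comm inner_square)
  then have "e \<bullet> y > 0" using \<open>b \<noteq> 0\<close> by simp
  moreover have "(x - \<epsilon> *\<^sub>R e) \<bullet> y \<ge> 0" using Q_dual \<epsilon> assms by blast
  ultimately show ?thesis using \<epsilon> by (simp add: inner_diff_left) (smt (verit) mult_pos_pos)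
qed

lemma Om_jsys:
  assumes "jsys I c" shows "(\<Sum>i\<in>I. l i *\<^sub>R c i) \<in> Om \<longleftrightarrow> (\<forall>i\<in>I. l i > 0)"
proof
  assume x: "(\<Sum>i\<in>I. l i *\<^sub>R c i) \<in> Om"
  show "\<forall>i\<in>I. l i > 0"
  proof
    fix i assume i: "i \<in> I"
    then have "c i \<noteq> 0" using assms by (simp add: jsys_def)
    then have "(\<Sum>i\<in>I. l i *\<^sub>R c i) \<bullet> c i > 0"
      using Om_inner_pos[OF x] idempotent_in_Q jsys_idem[OF assms i] by blast
    then show "l i > 0" unfolding jsys_inner[OF assms i] by (simp add: zero_less_mult_iff)
  qed
next
  assume l: "\<forall>i\<in>I. l i > 0"
  have fin: "finite I" using assms by (simp add: jsys_def)
  define \<epsilon> where "\<epsilon> = (if I = {} then 1 else Min (l ` I))"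
  have \<epsilon>: "\<epsilon> > 0" "\<And>i. i \<in> I \<Longrightarrow> \<epsilon> \<le> l i" using l fin by (auto simp: \<epsilon>_def)
  have "(\<Sum>i\<in>I. (l i - \<epsilon>) *\<^sub>R c i) \<in> Q" using \<epsilon> by (intro Q_jsys_nonneg[OF assms]) simp
  then have "(\<Sum>i\<in>I. (l i - \<epsilon>) *\<^sub>R c i) + \<epsilon> *\<^sub>R e \<in> Om" using \<epsilon> by (intro Q_plus_unit_interior)
  moreover have "\<epsilon> *\<^sub>R e = (\<Sum>i\<in>I. \<epsilon> *\<^sub>R c i)" using assms by (auto simp: jsys_def scaleR_sum_right)
  ultimately show "(\<Sum>i\<in>I. l i *\<^sub>R c i) \<in> Om" by (simp add: sum.distrib[symmetric] scaleR_diff_left)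
qed

text \<open>A boundary point has the eigenvalue 0, and the idempotent belonging to it supports the
  cone there.\<close>

lemma Q_not_Om:
  assumes "w \<in> Q" "w \<notin> Om" obtains \<xi> where "\<xi> \<in> Q" "\<xi> \<noteq> 0" "w \<bullet> \<xi> = 0"
proof -
  obtain R :: "real set" and c where R: "jsys R c" and w: "w = (\<Sum>l\<in>R. l *\<^sub>R c l)" using spectral by metis
  obtain l where l: "l \<in> R" "l \<le> 0" using Om_jsys[OF R, of "\<lambda>l. l"] assms(2) w by force
  have "w \<bullet> c l = l * (norm (c l))\<^sup>2" by (subst w) (rule jsys_inner[OF R l(1)])
  moreover have "w \<bullet> c l \<ge> 0" using Q_dual assms idempotent_in_Q jsys_idem[OF R l(1)] by blast
  ultimately have "w \<bullet> c l = 0" using l by (metis mult_nonpos_nonneg order_antisym zero_le_power2)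
  then show thesis using that[of "c l"] idempotent_in_Q jsys_idem[OF R l(1)] R l by (auto simp: jsys_def)
qed

lemma Om_iff: "x \<in> Om \<longleftrightarrow> (\<forall>y\<in>Q. y \<noteq> 0 \<longrightarrow> x \<bullet> y > 0)"
proof
  show "x \<in> Om \<Longrightarrow> \<forall>y\<in>Q. y \<noteq> 0 \<longrightarrow> x \<bullet> y > 0" using Om_inner_pos by blast
  assume a: "\<forall>y\<in>Q. y \<noteq> 0 \<longrightarrow> x \<bullet> y > 0"
  then have "x \<bullet> y \<ge> 0" if "y \<in> Q" for y using that by (cases "y = 0") (auto intro: less_imp_le)
  then have "x \<in> Q" using Q_dual[of x] by blast
  show "x \<in> Om"
  proof (rule ccontr)
    assume "x \<notin> Om"
    then obtain \<xi> where "\<xi> \<in> Q" "\<xi> \<noteq> 0" "x \<bullet> \<xi> = 0" using Q_not_Om \<open>x \<in> Q\<close> by blast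
    then show False using a by fastforce
  qed
qed

text \<open>The form \<open>x \<bullet> (\<xi> \<bowtie> x)\<close> is positive semidefinite. Were
  \<open>\<xi> \<bowtie> a\<close> nonzero, moving from the isotropic vector \<open>a\<close> a
  little against it would make the form negative.\<close>

lemma psd_kernel:
  assumes "\<xi> \<in> Q" "a \<bullet> (\<xi> \<bowtie> a) = 0" shows "\<xi> \<bowtie> a = 0"
proof (rule ccontr)
  assume nz: "\<xi> \<bowtie> a \<noteq> 0"
  define v where "v = \<xi> \<bowtie> a"
  define k where "k = v \<bullet> (\<xi> \<bowtie> v)"
  have psd: "x \<bullet> (\<xi> \<bowtie> x) \<ge> 0" for x using assms(1) by (simp add: inner_square Q_iff)
  have q: "2 * t * (v \<bullet> v) + t\<^sup>2 * k \<ge> 0" for t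
  proof -
    have "(a + t *\<^sub>R v) \<bullet> (\<xi> \<bowtie> (a + t *\<^sub>R v)) = a \<bullet> (\<xi> \<bowtie> a) + t * (a \<bullet> (\<xi> \<bowtie> v)) + t * (v \<bullet> (\<xi> \<bowtie> a)) + t\<^sup>2 * k"
      by (simp add: m_linear inner_add_left inner_add_right k_def power2_eq_square algebra_simps)
    moreover have "a \<bullet> (\<xi> \<bowtie> v) = v \<bullet> v" using inner_m[of \<xi> a v] by (simp add: v_def)
    ultimately show ?thesis using psd[of "a + t *\<^sub>R v"] assms(2) by (simp add: v_def)
  qed
  have vv: "v \<bullet> v > 0" using nz by (simp add: v_def)
  have k0: "k \<ge> 0" using psd by (simp add: k_def)
  \<comment> \<open>With \<open>k + 1\<close> the denominator is positive also when
    \<open>k = 0\<close>; then \<open>2 * (v \<bullet> v) + t * k = (v \<bullet> v) - t\<close> is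
    positive.\<close>
  define t where "t = - (v \<bullet> v) / (k + 1)"
  have t: "t < 0" "t * (k + 1) = - (v \<bullet> v)" using vv k0 by (auto simp: t_def field_simps)
  have "t * (2 * (v \<bullet> v) + t * k) \<ge> 0" using q[of t] by (simp add: power2_eq_square algebra_simps)
  then have "2 * (v \<bullet> v) + t * k \<le> 0" using t(1) by (simp add: zero_le_mult_iff)
  then show False using t vv by (simp add: algebra_simps)
qed

text \<open>Every multiplication operator is tangential to the boundary of the cone.\<close>

lemma orthogonal_annihilate:
  assumes "u \<in> Q" "\<xi> \<in> Q" "u \<bullet> \<xi> = 0" shows "u \<bowtie> \<xi> = 0"
proof -
  obtain R :: "real set" and c where R: "jsys R c" and u: "u = (\<Sum>l\<in>R. l *\<^sub>R c l)" using spectral by metis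
  have nonneg: "l \<ge> 0" if "l \<in> R" for l
  proof -
    have "u \<bullet> c l = l * (norm (c l))\<^sup>2" by (subst u) (rule jsys_inner[OF R that])
    moreover have "u \<bullet> c l \<ge> 0" using Q_dual assms idempotent_in_Q jsys_idem[OF R that] by blast
    moreover have "(norm (c l))\<^sup>2 > 0" using R that by (auto simp: jsys_def)
    ultimately show ?thesis by (simp add: zero_le_mult_iff)
  qed
  have nn: "l * (c l \<bullet> \<xi>) \<ge> 0" if "l \<in> R" for l
    using nonneg[OF that] Q_inner[OF idempotent_in_Q[OF jsys_idem[OF R that]] assms(2)] by simp
  have "(\<Sum>l\<in>R. l * (c l \<bullet> \<xi>)) = 0" using assms(3) by (simp add: u inner_sum_left)
  then have z: "l * (c l \<bullet> \<xi>) = 0" if "l \<in> R" for l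
    using sum_nonneg_eq_0_iff[of R "\<lambda>l. l * (c l \<bullet> \<xi>)"] nn R that by (auto simp: jsys_def)
  have "l *\<^sub>R (c l \<bowtie> \<xi>) = 0" if "l \<in> R" for l
  proof (cases "l = 0")
    case False
    then have "c l \<bullet> \<xi> = 0" using z[OF that] by simp
    then have "c l \<bullet> (\<xi> \<bowtie> c l) = 0" using inner_square[of "c l" \<xi>] jsys_idem[OF R that] inner_commute[of \<xi> "c l"] by simp
    then have "\<xi> \<bowtie> c l = 0" by (rule psd_kernel[OF assms(2)])
    then show ?thesis by (simp add: m_comm[of "c l"])
  qed simp
  then show ?thesis unfolding u m_sum_left m_linear by (intro sum.neutral) auto
qed

text \<open>The resolvent of multiplication by \<open>c\<close>, that is \<open>Res c h z - h (c \<bowtie> Res c h z) = z\<close>. Along \<open>t h\<close> with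
  \<open>0 \<le> t \<le> 1\<close> it cannot meet the boundary of the cone: a vector \<open>\<xi>\<close> of the dual cone orthogonal to it there
  would be orthogonal to \<open>z\<close> by \<open>orthogonal_annihilate\<close>.\<close>

definition Res where "Res c h z = E0 c z + (1 / (1 - h/2)) *\<^sub>R Eh c z + (1 / (1 - h)) *\<^sub>R E1 c z"

lemma Res_in_Om:
  assumes c: "c \<bowtie> c = c" and "\<bar>h\<bar> < 1" "z \<in> Om"
  shows "Res c h z \<in> Om"
proof -
  define f where "f t = Res c (t * h) z" for t :: real
  define A where "A = {t \<in> {0..1}. f t \<in> Om}"
  have th: "t * h < 1" if "t \<in> {0..1}" for t
  proof -
    have "t * h \<le> t * \<bar>h\<bar>" using that by (intro mult_left_mono) auto
    also have "\<dots> \<le> 1 * \<bar>h\<bar>" using that by (intro mult_right_mono) auto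
    finally show ?thesis using assms(2) by simp
  qed
  have cont: "continuous_on {0..1} f" unfolding f_def Res_def
    using th by (intro continuous_intros) (force simp: field_simps)+
  have Q_imp: "f t \<in> Om" if t: "t \<in> {0..1}" and ft: "f t \<in> Q" for t
  proof (rule ccontr)
    assume "f t \<notin> Om"
    then obtain \<xi> where xi: "\<xi> \<in> Q" "\<xi> \<noteq> 0" "f t \<bullet> \<xi> = 0" using Q_not_Om[OF ft] by blast
    have "f t \<bowtie> \<xi> = 0" by (rule orthogonal_annihilate[OF ft xi(1,3)])
    then have "(c \<bowtie> f t) \<bullet> \<xi> = 0" using assoc_inner[of "f t" c \<xi>] by (simp add: m_comm[of c])
    then have "(f t - (t * h) *\<^sub>R (c \<bowtie> f t)) \<bullet> \<xi> = 0" using xi by (simp add: inner_diff_left)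
    moreover have "f t - (t * h) *\<^sub>R (c \<bowtie> f t) = z"
    proof -
      define s where "s = t * h"
      have s: "s < 1" using th[OF t] by (simp add: s_def)
      have "f t - s *\<^sub>R (c \<bowtie> f t) = E0 c z + ((1 / (1 - s/2)) - s * (1 / (1 - s/2)) * (1/2)) *\<^sub>R Eh c z
          + ((1 / (1 - s)) - s * (1 / (1 - s))) *\<^sub>R E1 c z"
        unfolding f_def Res_def s_def[symmetric] 
        by (simp add: m_linear peirce_eigen[OF c] scaleR_add_right scaleR_diff_left algebra_simps)
      also have "(1 / (1 - s/2)) - s * (1 / (1 - s/2)) * (1/2) = (1 - s/2) * (1 / (1 - s/2))"
        by (simp only: left_diff_distrib) simp
      also have "\<dots> = 1" using s by simp
      also have "(1 / (1 - s)) - s * (1 / (1 - s)) = 1" using s by (simp add: field_simps)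
      finally show ?thesis using peirce_sum[of c z] by (simp add: s_def add_ac)
    qed
    ultimately show False using Om_inner_pos[OF assms(3)] xi by fastforce
  qed
  \<comment> \<open>The good parameters are open as a preimage of \<open>Om\<close> and closed as a
    preimage of \<open>Q\<close>, since along the path the two memberships agree.\<close>
  have "A = {0..1} \<inter> f -` Om" by (auto simp: A_def)
  then have "openin (top_of_set {0..1}) A"
    using continuous_openin_preimage_gen[OF cont open_Om] by simp
  moreover have "A = {0..1} \<inter> f -` Q" using Q_imp Om_subset_Q by (auto simp: A_def)
  then have "closedin (top_of_set {0..1}) A"
    using continuous_closedin_preimage[OF cont closed_Q] by simp
  moreover have "f 0 = z" using peirce_sum[of c z] by (simp add: f_def Res_def add_ac)
  then have "0 \<in> A" using assms by (simp add: A_def)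
  ultimately have "A = {0..1}"
    using connected_clopen[of "{0..1::real}"] by auto
  then have "1 \<in> A" by simp
  then show ?thesis by (simp add: A_def f_def)
qed

text \<open>The exponential of \<open>h\<close> times multiplication by \<open>c\<close>, a limit of powers of resolvents.\<close>

definition T where "T c h z = E0 c z + exp (h/2) *\<^sub>R Eh c z + exp h *\<^sub>R E1 c z"

lemma linear_T: "linear (T c h)"
proof -
  have "linear (\<lambda>z. E0 c z + exp (h/2) *\<^sub>R Eh c z + exp h *\<^sub>R E1 c z)"
    by (intro linear_compose_add linear_compose_scale_right linear_E)
  then show ?thesis by (simp add: T_def[abs_def])
qed

lemma inner_T: "T c h x \<bullet> y = x \<bullet> T c h y"
  by (simp add: T_def inner_add_left inner_add_right inner_E)

lemma T_T:
  assumes "c \<bowtie> c = c" shows "T c h (T c k z) = T c (h + k) z"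
proof -
  note l = linear_add[OF linear_E(1)] linear_add[OF linear_E(2)] linear_add[OF linear_E(3)]
    linear_scale[OF linear_E(1)] linear_scale[OF linear_E(2)] linear_scale[OF linear_E(3)]
  show ?thesis by (simp add: T_def l E_E[OF assms] exp_add add_divide_distrib)
qed

lemma T_0: "T c 0 z = z"
  using peirce_sum[of c z] by (simp add: T_def add_ac)

lemma power_limit: "(\<lambda>k. (1 / (1 - x / real (Suc k))) ^ Suc k) \<longlonglongrightarrow> exp (x::real)"
proof -
  have "(\<lambda>n. (1 + (- x) / real n) ^ n) \<longlonglongrightarrow> exp (- x)"
    by (rule tendsto_exp_limit_sequentially)
  then have "(\<lambda>k. (1 + (- x) / real (Suc k)) ^ Suc k) \<longlonglongrightarrow> exp (- x)" by (rule LIMSEQ_Suc)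
  then have "(\<lambda>k. inverse ((1 + (- x) / real (Suc k)) ^ Suc k)) \<longlonglongrightarrow> inverse (exp (- x))"
    by (intro tendsto_inverse) auto
  then show ?thesis by (simp add: exp_minus power_one_over inverse_eq_divide del: power_Suc of_nat_Suc)
qed

lemma T_Om_Q:
  assumes c: "c \<bowtie> c = c" and z: "z \<in> Om"
  shows "T c h z \<in> Q"
proof -
  note l = linear_add[OF linear_E(1)] linear_add[OF linear_E(2)] linear_add[OF linear_E(3)]
    linear_scale[OF linear_E(1)] linear_scale[OF linear_E(2)] linear_scale[OF linear_E(3)]
  have iter: "(Res c s ^^ k) z = E0 c z + ((1 / (1 - s/2)) ^ k) *\<^sub>R Eh c z + ((1 / (1 - s)) ^ k) *\<^sub>R E1 c z" for k s
  proof (induction k)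
    case 0
    then show ?case using peirce_sum[of c z] by (simp add: add_ac)
  next
    case (Suc k)
    then show ?case by (simp add: Res_def l E_E[OF c])
  qed
  have Om: "(Res c s ^^ k) z \<in> Om" if "\<bar>s\<bar> < 1" for k s
    using z by (induction k) (auto intro: Res_in_Om[OF c that])
  define f where "f k = (Res c (h / real (Suc k)) ^^ Suc k) z" for k
  have "f \<longlonglongrightarrow> T c h z"
  proof -
    have "(\<lambda>k. (1 / (1 - (h / real (Suc k)) / 2)) ^ Suc k) \<longlonglongrightarrow> exp (h/2)"
      using power_limit[of "h/2"] by (simp add: mult.commute del: power_Suc of_nat_Suc)
    then show ?thesis unfolding f_def iter T_def
      by (intro tendsto_intros power_limit) auto
  qed
  moreover have "eventually (\<lambda>k. f k \<in> Q) sequentially"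
  proof -
    have "(\<lambda>k. h / real (Suc k)) \<longlonglongrightarrow> 0"
      by (rule LIMSEQ_Suc[OF lim_const_over_n])
    then have "eventually (\<lambda>k. \<bar>h / real (Suc k)\<bar> < 1) sequentially"
      by (metis (mono_tags, lifting) eventually_mono order_tendstoD(2) tendsto_rabs_zero zero_less_one)
    then show ?thesis unfolding f_def
      by (rule eventually_mono) (use Om Om_subset_Q in blast)
  qed
  ultimately show ?thesis using closed_Q by (metis Lim_in_closed_set trivial_limit_sequentially)
qed

text \<open>The image is open and contained in \<open>Q\<close>, hence in the interior. The same for
  \<open>- h\<close>, which gives the inverse map, yields equality.\<close>

lemma T_Om:
  assumes c: "c \<bowtie> c = c"
  shows "T c h ` Om = Om"
proof -
  have sub: "T c h ` Om \<subseteq> Om" for h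
  proof -
    have "surj (T c h)" using T_T[OF c, of h "- h"] T_0 by (metis add.right_inverse surjI)
    then have "open (T c h ` Om)"
      using open_surjective_linear_image[OF open_Om linear_T] by blast
    moreover have "T c h ` Om \<subseteq> Q" using T_Om_Q[OF c] by blast
    ultimately show ?thesis unfolding Om_interior by (simp add: interior_maximal)
  qed
  have "Om = T c h ` (T c (- h) ` Om)" using T_T[OF c, of h "- h"] T_0 by (simp add: image_comp)
  also have "\<dots> \<subseteq> T c h ` Om" using sub by blast
  finally show ?thesis using sub by blast
qed

end

section \<open>Traces and cone automorphisms\<close>

definition optr :: "('a::euclidean_space \<Rightarrow> 'a) \<Rightarrow> real" where
  "optr f = (\<Sum>b\<in>Basis. b \<bullet> f b)"

lemma optr_comm:
  fixes f g :: "'a::euclidean_space \<Rightarrow> 'a"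
  assumes "linear f" "linear g"
  shows "optr (\<lambda>z. f (g z)) = optr (\<lambda>z. g (f z))"
proof -
  have ex: "optr (\<lambda>z. f (g z)) = (\<Sum>b\<in>Basis. \<Sum>k\<in>Basis. (g b \<bullet> k) * (b \<bullet> f k))"
    if "linear f" for f g :: "'a \<Rightarrow> 'a"
    unfolding optr_def
  proof (rule sum.cong[OF refl])
    fix b :: 'a
    have "f (g b) = f (\<Sum>k\<in>Basis. (g b \<bullet> k) *\<^sub>R k)" by (simp add: euclidean_representation)
    also have "\<dots> = (\<Sum>k\<in>Basis. (g b \<bullet> k) *\<^sub>R f k)" using that by (simp add: linear_sum linear_scale)
    finally show "b \<bullet> f (g b) = (\<Sum>k\<in>Basis. (g b \<bullet> k) * (b \<bullet> f k))" by (simp add: inner_sum_right)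
  qed
  have "optr (\<lambda>z. f (g z)) = (\<Sum>k\<in>Basis. \<Sum>b\<in>Basis. (g b \<bullet> k) * (b \<bullet> f k))"
    unfolding ex[OF assms(1)] by (rule sum.swap)
  also have "\<dots> = optr (\<lambda>z. g (f z))" unfolding ex[OF assms(2)]
    by (intro sum.cong refl) (simp add: inner_commute mult.commute)
  finally show ?thesis .
qed

lemma optr_add: "optr (\<lambda>z. f z + g z) = optr f + optr g"
  and optr_diff: "optr (\<lambda>z. f z - g z) = optr f - optr g"
  and optr_scale: "optr (\<lambda>z. a *\<^sub>R f z) = a * optr f"
  by (auto simp: optr_def inner_add_right inner_diff_right sum.distrib sum_subtractf sum_distrib_left)

lemma optr_orthonormal:
  fixes f :: "'a::euclidean_space \<Rightarrow> 'a"
  assumes B: "finite B" "\<And>b. b \<in> B \<Longrightarrow> norm b = 1" "pairwise orthogonal B" "span B = UNIV"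
    and sym: "\<And>x y. f x \<bullet> y = x \<bullet> f y"
  shows "(\<Sum>b\<in>B. b \<bullet> f b) = optr f"
proof -
  have "(\<Sum>b\<in>B. b \<bullet> f b) = (\<Sum>b\<in>B. \<Sum>k\<in>Basis. (b \<bullet> k) * (f k \<bullet> b))"
  proof (rule sum.cong[OF refl])
    fix b :: 'a
    have "b \<bullet> f b = (\<Sum>k\<in>Basis. (b \<bullet> k) * (f b \<bullet> k))" by (rule euclidean_inner)
    moreover have "f b \<bullet> k = f k \<bullet> b" for k using sym[of b k] by (simp only: inner_commute)
    ultimately show "b \<bullet> f b = (\<Sum>k\<in>Basis. (b \<bullet> k) * (f k \<bullet> b))" by simp
  qed
  also have "\<dots> = (\<Sum>k\<in>Basis. \<Sum>b\<in>B. (b \<bullet> k) * (f k \<bullet> b))" by (rule sum.swap)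
  also have "\<dots> = optr f" unfolding optr_def
  proof (rule sum.cong[OF refl])
    fix k :: 'a
    have "f k = (\<Sum>b\<in>B. (f k \<bullet> b) *\<^sub>R b)"
      using orthonormal_basis_expand[OF B(3,2) _ B(1), of "f k"] B(4) by auto
    then have "k \<bullet> f k = k \<bullet> (\<Sum>b\<in>B. (f k \<bullet> b) *\<^sub>R b)" by simp
    then show "(\<Sum>b\<in>B. (b \<bullet> k) * (f k \<bullet> b)) = k \<bullet> f k"
      by (simp add: inner_sum_right inner_commute[of k] mult.commute)
  qed
  finally show ?thesis .
qed

context euclidean_jordan
begin

text \<open>The trace of the multiplication operator, not of the Jordan algebra. It determines the
  moduli of the exponentials, so its values on a frame decide whether a modulus is a power of the
  determinant.\<close>

definition tr :: "'a \<Rightarrow> real" where "tr x = optr (\<lambda>z. x \<bowtie> z)"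

lemma tr_scale: "tr (a *\<^sub>R x) = a * tr x"
  unfolding tr_def m_linear by (rule optr_scale)

lemma tr_sum: "tr (\<Sum>i\<in>I. f i) = (\<Sum>i\<in>I. tr (f i))"
  unfolding tr_def optr_def by (simp add: m_sum_left inner_sum_right) (rule sum.swap)

lemma tr_unit: "tr e = DIM('a)"
  by (simp add: tr_def optr_def)

text \<open>In the expansion by \<open>mult_op\<close>, exchanging \<open>x\<close> and
  \<open>w\<close> merely permutes the five terms, up to cyclic rotations inside the trace.\<close>

lemma tr_assoc: "tr ((x \<bowtie> y) \<bowtie> w) = tr ((w \<bowtie> y) \<bowtie> x)"
proof -
  let ?t = "\<lambda>f. optr f"
  have e: "tr ((x \<bowtie> y) \<bowtie> w) = ?t (\<lambda>z. (x \<bowtie> y) \<bowtie> (w \<bowtie> z)) + ?t (\<lambda>z. (x \<bowtie> w) \<bowtie> (y \<bowtie> z))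
     + ?t (\<lambda>z. (y \<bowtie> w) \<bowtie> (x \<bowtie> z)) - ?t (\<lambda>z. x \<bowtie> (w \<bowtie> (y \<bowtie> z))) - ?t (\<lambda>z. y \<bowtie> (w \<bowtie> (x \<bowtie> z)))" for x y w
    unfolding tr_def mult_op by (simp only: optr_add optr_diff)
  have lin2: "linear (\<lambda>z. a \<bowtie> (b \<bowtie> z))" for a b
    using linear_compose[OF linear_m[of b] linear_m[of a]] by (simp add: o_def)
  have cyc: "?t (\<lambda>z. a \<bowtie> (b \<bowtie> (c \<bowtie> z))) = ?t (\<lambda>z. c \<bowtie> (a \<bowtie> (b \<bowtie> z)))" for a b c
    using optr_comm[OF lin2[of a b] linear_m[of c]] by simp
  have comb: "a = b" if "a = p + q + r - s - t" "b = p' + q' + r' - s' - t'" "p' = r" "q' = q" "r' = p" "s' = t" "t' = s"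
    for a b p q r s t p' q' r' s' t' :: real using that by simp
  show ?thesis
    by (rule comb[OF e[of x y w] e[of w y x]])
       (simp_all only: m_comm[of w y] m_comm[of w x] m_comm[of y x] cyc[of y w x] cyc[of x y w] cyc[of x w y])
qed

text \<open>Orthonormal bases of the three eigenspaces of multiplication by \<open>c\<close> form an
  eigenbasis of \<open>T c h\<close>. The exponents of its eigenvalues sum to \<open>h\<close> times
  the trace.\<close>

lemma has_modulus_T:
  assumes c: "c \<bowtie> c = c"
  shows "has_modulus (T c h) (exp (h * tr c))"
proof -
  let ?V = "\<lambda>a. {z. c \<bowtie> z = a *\<^sub>R z}"
  have sub: "subspace (?V a)" for a
    by (auto simp: subspace_def m_linear algebra_simps)
  have "\<exists>B. B \<subseteq> ?V a \<and> pairwise orthogonal B \<and> (\<forall>x\<in>B. norm x = 1) \<and> finite B \<and> span B = ?V a" for a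
    using orthonormal_basis_subspace[OF sub[of a]] independent_imp_finite by metis
  then obtain B where B: "\<And>a. B a \<subseteq> ?V a" "\<And>a. pairwise orthogonal (B a)" "\<And>a x. x \<in> B a \<Longrightarrow> norm x = 1"
    "\<And>a. finite (B a)" "\<And>a. span (B a) = ?V a" by metis
  define D where "D = B 1 \<union> B (1/2) \<union> B 0"
  have fin: "finite D" using B by (simp add: D_def)
  have nrm: "norm b = 1" if "b \<in> D" for b using that B(3) by (auto simp: D_def)
  have ev: "\<exists>a\<in>{1, 1/2, 0}. b \<in> B a" if "b \<in> D" for b using that by (auto simp: D_def)
  have orth: "pairwise orthogonal D"
  proof (rule pairwiseI)
    fix x y assume xy: "x \<in> D" "y \<in> D" "x \<noteq> y"
    obtain a b where ab: "x \<in> B a" "y \<in> B b" using ev xy by blast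
    show "orthogonal x y"
    proof (cases "a = b")
      case True
      then have "x \<in> B a" "y \<in> B a" using ab by auto
      then show ?thesis using B(2)[of a] xy(3) unfolding pairwise_def by blast
    next
      case False
      moreover have "c \<bowtie> x = a *\<^sub>R x" "c \<bowtie> y = b *\<^sub>R y" using ab B(1) by blast+
      ultimately show ?thesis using eigen_orth[of c x a y b] by (simp add: orthogonal_def)
    qed
  qed
  have "z \<in> span D" for z
  proof -
    have "E1 c z \<in> span (B 1)" "Eh c z \<in> span (B (1/2))" "E0 c z \<in> span (B 0)"
      unfolding B(5) using peirce_eigen[OF c] by auto
    then have "E1 c z \<in> span D" "Eh c z \<in> span D" "E0 c z \<in> span D"
      using span_mono[of "B 1" D] span_mono[of "B (1/2)" D] span_mono[of "B 0" D] by (auto simp: D_def)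
    then have "E1 c z + Eh c z + E0 c z \<in> span D" by (intro span_add)
    then show ?thesis by (simp add: peirce_sum)
  qed
  then have span: "span D = UNIV" by auto
  have Tb: "T c h b = exp (h * (b \<bullet> (c \<bowtie> b))) *\<^sub>R b" if bD: "b \<in> D" for b
  proof -
    obtain a where a: "a \<in> {1, 1/2, 0}" "b \<in> B a" using ev[OF bD] by blast
    then have cb: "c \<bowtie> b = a *\<^sub>R b" using B(1) by auto
    moreover have "b \<bullet> b = 1" using nrm[OF bD] by (simp add: dot_square_norm)
    ultimately have "b \<bullet> (c \<bowtie> b) = a" by simp
    then show ?thesis using a cb eigen_projections[of c b] by (auto simp: T_def)
  qed
  have "has_modulus (T c h) (\<Prod>b\<in>D. exp (h * (b \<bullet> (c \<bowtie> b))))"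
    by (rule has_modulus_eigenbasis[OF fin nrm orth span linear_T Tb]) auto
  also have "(\<Prod>b\<in>D. exp (h * (b \<bullet> (c \<bowtie> b)))) = exp (\<Sum>b\<in>D. h * (b \<bullet> (c \<bowtie> b)))"
    using fin by (simp add: exp_sum)
  also have "(\<Sum>b\<in>D. h * (b \<bullet> (c \<bowtie> b))) = h * tr c"
    using optr_orthonormal[OF fin nrm orth span inner_m] by (simp add: tr_def sum_distrib_left[symmetric])
  finally show ?thesis .
qed

text \<open>The adjoint is carried along because the Laplace transform over the cone is moved by it;
  demanding the same modulus for both keeps this closed under composition without any theory of
  determinants.\<close>

definition cone_aut :: "real \<Rightarrow> ('a \<Rightarrow> 'a) \<Rightarrow> bool" where
  "cone_aut J g \<longleftrightarrow> linear g \<and> g ` Om = Om \<and> has_modulus g J \<and>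
     (\<exists>g'. linear g' \<and> g' ` Om = Om \<and> has_modulus g' J \<and> (\<forall>x y. g x \<bullet> y = x \<bullet> g' y))"

text \<open>The operators commuting with every multiplication. The automorphisms constructed below
  commute with them and hence restrict to the factors of a decomposable algebra.\<close>

definition central :: "('a \<Rightarrow> 'a) \<Rightarrow> bool" where
  "central f \<longleftrightarrow> linear f \<and> (\<forall>d z. f (d \<bowtie> z) = d \<bowtie> f z)"

lemma cone_aut_T: "c \<bowtie> c = c \<Longrightarrow> cone_aut (exp (h * tr c)) (T c h)"
  unfolding cone_aut_def by (intro conjI exI[of _ "T c h"] allI linear_T T_Om has_modulus_T inner_T)

lemma cone_aut_compose: 
  assumes "cone_aut J g" "cone_aut J' h" shows "cone_aut (J * J') (\<lambda>x. g (h x))"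
proof -
  obtain g' h' where gh: "linear g'" "g' ` Om = Om" "has_modulus g' J" "\<And>x y. g x \<bullet> y = x \<bullet> g' y"
    "linear h'" "h' ` Om = Om" "has_modulus h' J'" "\<And>x y. h x \<bullet> y = x \<bullet> h' y" using assms by (auto simp: cone_aut_def)
  have g: "linear g" "g ` Om = Om" "has_modulus g J" and h: "linear h" "h ` Om = Om" "has_modulus h J'"
    using assms by (auto simp: cone_aut_def)
  have "linear (\<lambda>x. g (h x))" "linear (\<lambda>x. h' (g' x))"
    using linear_compose[OF h(1) g(1)] linear_compose[OF gh(1) gh(5)] by (auto simp: o_def)
  moreover have "(\<lambda>x. g (h x)) ` Om = Om" "(\<lambda>x. h' (g' x)) ` Om = Om"
    using g(2) h(2) gh(2,6) by (metis image_image)+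
  moreover have "has_modulus (\<lambda>x. g (h x)) (J * J')"
    by (rule has_modulus_compose[OF g(3) h(3) measurable_linear[OF g(1)]])
  moreover have "has_modulus (\<lambda>x. h' (g' x)) (J * J')"
    using has_modulus_compose[OF gh(7) gh(3) measurable_linear[OF gh(5)]] by (simp add: mult.commute)
  moreover have "g (h x) \<bullet> y = x \<bullet> h' (g' y)" for x y by (simp add: gh)
  ultimately show ?thesis unfolding cone_aut_def by (intro conjI exI[of _ "\<lambda>x. h' (g' x)"] allI)
qed

lemma cone_aut_id: "cone_aut 1 (\<lambda>x. x)"
  unfolding cone_aut_def by (auto intro!: exI[of _ "\<lambda>x. x"] simp: linear_ident has_modulus_id)

lemma central_T: "central f \<Longrightarrow> f (T c h z) = T c h (f z)"
  unfolding central_def by (simp add: T_def E1_def Eh_def E0_def linear_add linear_diff linear_scale)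

lemma T_unit: assumes "c \<bowtie> c = c" shows "T c h e = e + (exp h - 1) *\<^sub>R c"
proof -
  have "2 *\<^sub>R c - c = (2 - 1) *\<^sub>R c" "e - 3 *\<^sub>R c + 2 *\<^sub>R c = e + (2 - 3) *\<^sub>R c"
    unfolding scaleR_diff_left by simp_all
  then show ?thesis using assms by (simp add: T_def E1_def Eh_def E0_def algebra_simps)
qed

text \<open>The exponential at \<open>c k\<close> fixes the other members of the system, so
  composing the exponentials sets the coefficients of \<open>e\<close> one at a time; after a subset
  \<open>K\<close> the coefficients outside it are still 1.\<close>

lemma spectral_aut:
  assumes "jsys I c" "\<And>i. i \<in> I \<Longrightarrow> l i > 0"
  shows "\<exists>g. cone_aut (exp (\<Sum>i\<in>I. ln (l i) * tr (c i))) g \<and> g e = (\<Sum>i\<in>I. l i *\<^sub>R c i) \<and>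
    (\<forall>f z. central f \<longrightarrow> f (g z) = g (f z))"
proof -
  have "finite I" using assms by (simp add: jsys_def)
  have "\<exists>g. cone_aut (exp (\<Sum>i\<in>K. ln (l i) * tr (c i))) g \<and> g e = e + (\<Sum>i\<in>K. (l i - 1) *\<^sub>R c i) \<and> (\<forall>f z. central f \<longrightarrow> f (g z) = g (f z))" if "finite K" "K \<subseteq> I" for K
    using that
  proof (induction K rule: finite_induct)
    case empty
    show ?case by (intro exI[of _ "\<lambda>x. x"]) (simp add: cone_aut_id)
  next
    case (insert k K)
    then obtain g where g: "cone_aut (exp (\<Sum>i\<in>K. ln (l i) * tr (c i))) g" "g e = e + (\<Sum>i\<in>K. (l i - 1) *\<^sub>R c i)"
       "\<And>f z. central f \<Longrightarrow> f (g z) = g (f z)" by auto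
    have k: "c k \<bowtie> c k = c k" "l k > 0" using insert assms by (auto simp: jsys_def)
    let ?T = "T (c k) (ln (l k))"
    have Ti: "?T (c i) = c i" if "i \<in> K" for i
    proof -
      have "c k \<bowtie> c i = 0" using jsys_orth[OF assms(1)] that insert by auto
      then show ?thesis using eigen_projections(3) by (simp add: T_def)
    qed
    have "?T (g e) = ?T e + (\<Sum>i\<in>K. (l i - 1) *\<^sub>R ?T (c i))"
      by (simp add: g(2) linear_add[OF linear_T] linear_sum[OF linear_T] linear_scale[OF linear_T])
    also have "\<dots> = e + (\<Sum>i\<in>insert k K. (l i - 1) *\<^sub>R c i)"
      using insert k by (simp add: Ti T_unit add_ac)
    finally have "?T (g e) = e + (\<Sum>i\<in>insert k K. (l i - 1) *\<^sub>R c i)" .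
    moreover have "cone_aut (exp (ln (l k) * tr (c k)) * exp (\<Sum>i\<in>K. ln (l i) * tr (c i))) (\<lambda>x. ?T (g x))"
      by (rule cone_aut_compose[OF cone_aut_T[OF k(1)] g(1)])
    then have "cone_aut (exp (\<Sum>i\<in>insert k K. ln (l i) * tr (c i))) (\<lambda>x. ?T (g x))"
      using insert by (simp add: exp_add)
    moreover have "f (?T (g z)) = ?T (g (f z))" if "central f" for f z
      using central_T[OF that] g(3)[OF that] by simp
    ultimately show ?case by (intro exI[of _ "\<lambda>x. ?T (g x)"]) auto
  qed
  from this[OF \<open>finite I\<close> order_refl] show ?thesis
  proof -
    have "e + (\<Sum>i\<in>I. (l i - 1) *\<^sub>R c i) = (\<Sum>i\<in>I. l i *\<^sub>R c i)"
      using assms(1) by (auto simp: jsys_def scaleR_diff_left sum_subtractf)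
    then show "\<exists>g. cone_aut (exp (\<Sum>i\<in>I. ln (l i) * tr (c i))) g \<and> g e = e + (\<Sum>i\<in>I. (l i - 1) *\<^sub>R c i) \<and> (\<forall>f z. central f \<longrightarrow> f (g z) = g (f z)) \<Longrightarrow> ?thesis" by simp
  qed
qed

lemma Om_transitive:
  assumes "y \<in> Om"
  shows "\<exists>g J. cone_aut J g \<and> g e = y \<and> (\<forall>f z. central f \<longrightarrow> f (g z) = g (f z))"
proof -
  obtain R :: "real set" and c where R: "jsys R c" and y: "y = (\<Sum>l\<in>R. l *\<^sub>R c l)" using spectral by metis
  then have "\<And>l. l \<in> R \<Longrightarrow> l > 0" using Om_jsys[OF R, of "\<lambda>l. l"] assms by auto
  from spectral_aut[OF R, of "\<lambda>l. l", OF this] show ?thesis using y by auto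
qed

text \<open>By \<open>commute_square\<close> with the idempotent \<open>c\<close>, the commutator
  equals twice itself if \<open>c \<bowtie> a = a\<close>, and 0 if
  \<open>c \<bowtie> a = 0\<close>.\<close>

lemma idempotent_commute:
  assumes c: "c \<bowtie> c = c" and a: "c \<bowtie> a = a \<or> c \<bowtie> a = 0"
  shows "a \<bowtie> (c \<bowtie> w) = c \<bowtie> (a \<bowtie> w)"
  using a
proof
  assume "c \<bowtie> a = a"
  then have "a \<bowtie> (c \<bowtie> w) - c \<bowtie> (a \<bowtie> w) = 2 *\<^sub>R (a \<bowtie> (c \<bowtie> w) - c \<bowtie> (a \<bowtie> w))"
    using commute_square[of a c w] c by simp
  then show ?thesis by (simp add: scaleR_2)
next
  assume "c \<bowtie> a = 0"
  then show ?thesis using commute_square[of a c w] c by simp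
qed

text \<open>Spectral idempotents of \<open>z\<close> for nonzero eigenvalues lie in the same
  eigenspace. If \<open>z\<close> were not a multiple of \<open>c i\<close>, one of them would split
  \<open>c i\<close> into two orthogonal idempotents, and the refined system would exceed the
  rank.\<close>

lemma jsys_primitive:
  assumes sys: "jsys I c" "card I = jordan_rank m e" and i: "i \<in> I" and z: "c i \<bowtie> z = z"
  shows "\<exists>a. z = a *\<^sub>R c i"
proof (rule ccontr)
  assume nz: "\<nexists>a. z = a *\<^sub>R c i"
  note ci = jsys_idem[OF sys(1) i]
  obtain R :: "real set" and d where R: "jsys R d" and zr: "z = (\<Sum>l\<in>R. l *\<^sub>R d l)"
    and dp: "\<And>l. l \<in> R \<Longrightarrow> \<exists>p. d l = pp z p" using spectral[of z] by blast
  have comm: "z \<bowtie> (c i \<bowtie> w) = c i \<bowtie> (z \<bowtie> w)" for w using idempotent_commute[OF ci] z by blast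
  have zc: "z \<bowtie> c i = z" using z m_comm[of z "c i"] by simp
  \<comment> \<open>A polynomial in \<open>z\<close> may contain a multiple of \<open>e\<close>,
    which can lie outside the eigenspace; multiplying once more by \<open>z\<close> brings it
    back.\<close>
  have zp: "c i \<bowtie> (z \<bowtie> pp z p) = z \<bowtie> pp z p" for p
  proof (induction p)
    case (pCons a p)
    have "c i \<bowtie> (z \<bowtie> pp z (pCons a p)) = z \<bowtie> (a *\<^sub>R c i + c i \<bowtie> (z \<bowtie> pp z p))"
      by (simp add: comm[symmetric] m_linear z zc)
    also have "\<dots> = z \<bowtie> pp z (pCons a p)" using pCons(2) zc by (simp add: m_linear)
    finally show ?case .
  qed simp
  have zd: "z \<bowtie> d l = l *\<^sub>R d l" if "l \<in> R" for l
  proof -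
    have "z \<bowtie> d l = (\<Sum>k\<in>R. if k = l then l *\<^sub>R d l else 0)" unfolding zr m_sum_left m_linear
      using R that by (intro sum.cong) (auto simp: jsys_def)
    then show ?thesis using R that by (simp add: jsys_def)
  qed
  have dV: "c i \<bowtie> d l = d l" if l: "l \<in> R" "l \<noteq> 0" for l
  proof -
    obtain p where "d l = pp z p" using dp[OF l(1)] by blast
    then have "c i \<bowtie> (z \<bowtie> d l) = z \<bowtie> d l" using zp by simp
    then have "l *\<^sub>R (c i \<bowtie> d l) = l *\<^sub>R d l" unfolding zd[OF that(1)] m_linear .
    then show ?thesis using that by simp
  qed
  have "\<exists>l\<in>R. l \<noteq> 0 \<and> d l \<noteq> c i"
  proof (rule ccontr)
    assume "\<not> ?thesis"
    then have all: "d l = c i" if "l \<in> R" "l \<noteq> 0" for l using that by blast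
    have "z = (\<Sum>l\<in>R. l *\<^sub>R c i)" by (subst zr, rule sum.cong) (auto simp: all)
    then have "z = (\<Sum>R) *\<^sub>R c i" by (simp add: scaleR_sum_left)
    then show False using nz by blast
  qed
  then obtain l where l: "l \<in> R" "l \<noteq> 0" "d l \<noteq> c i" by blast
  define d1 where "d1 = d l"
  define d2 where "d2 = c i - d1"
  have d1: "d1 \<bowtie> d1 = d1" "d1 \<noteq> 0" "c i \<bowtie> d1 = d1" using R l dV by (auto simp: d1_def jsys_def)
  have dc: "d1 \<bowtie> c i = d1" using d1(3) m_comm[of d1 "c i"] by simp
  have d2: "d2 \<bowtie> d2 = d2" "d2 \<noteq> 0" "d1 \<bowtie> d2 = 0" "c i \<bowtie> d2 = d2"
    using l by (simp_all add: d2_def d1_def[symmetric] m_linear d1 dc ci)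
  have orth: "c j \<bowtie> x = 0" if "j \<in> I" "j \<noteq> i" "c i \<bowtie> x = x" for j x
  proof -
    have cc: "c i \<bowtie> c j = 0" using jsys_orth[OF sys(1) i that(1)] that by simp
    have "c j \<bowtie> x = c j \<bowtie> (c i \<bowtie> x)" using that by simp
    also have "\<dots> = c i \<bowtie> (c j \<bowtie> x)" using idempotent_commute[OF ci, of "c j"] cc by blast
    also have "\<dots> = c i \<bowtie> (x \<bowtie> c j)" by (simp add: m_comm)
    also have "\<dots> = x \<bowtie> (c i \<bowtie> c j)" using idempotent_commute[OF ci, of x "c j"] that by simp
    finally show ?thesis by (simp add: cc)
  qed
  \<comment> \<open>\<open>None\<close> indexes the additional idempotent, and \<open>Some i\<close>
    keeps the other half of \<open>c i\<close>.\<close>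
  define c' where "c' k = (case k of None \<Rightarrow> d2 | Some j \<Rightarrow> if j = i then d1 else c j)" for k
  have fin: "finite I" using sys by (simp add: jsys_def)
  have "jsys (insert None (Some ` I)) c'" unfolding jsys_def
  proof (intro conjI ballI)
    show "finite (insert None (Some ` I))" using fin by simp
    show "c' k \<noteq> 0" if "k \<in> insert None (Some ` I)" for k
      using that d1 d2 sys by (auto simp: c'_def jsys_def split: if_splits)
    have "(\<Sum>k\<in>insert None (Some ` I). c' k) = d2 + (\<Sum>j\<in>I. c' (Some j))"
      using fin by (simp add: sum.reindex c'_def)
    also have "(\<Sum>j\<in>I. c' (Some j)) = d1 + (\<Sum>j\<in>I - {i}. c j)"
      using fin i by (subst sum.remove[of _ i]) (auto simp: c'_def)
    also have "d2 + (d1 + (\<Sum>j\<in>I - {i}. c j)) = (\<Sum>j\<in>I. c j)"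
      using fin i by (subst (2) sum.remove[of _ i]) (auto simp: d1_def d2_def)
    finally show "(\<Sum>k\<in>insert None (Some ` I). c' k) = e" using sys by (simp add: jsys_def)
    have o: "c j \<bowtie> d1 = 0" "d1 \<bowtie> c j = 0" "c j \<bowtie> d2 = 0" "d2 \<bowtie> c j = 0" if "j \<in> I" "j \<noteq> i" for j
      using orth[OF that d1(3)] orth[OF that d2(4)] m_comm[of _ "c j"] by simp_all
    have cc: "c j \<bowtie> c k = (if j = k then c j else 0)" if "j \<in> I" "k \<in> I" for j k
      using sys(1) that by (simp add: jsys_def)
    have d21: "d2 \<bowtie> d1 = 0" using d2(3) m_comm[of d1 d2] by simp
    fix k k' assume "k \<in> insert None (Some ` I)" "k' \<in> insert None (Some ` I)"
    then show "c' k \<bowtie> c' k' = (if k = k' then c' k else 0)"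
      by (cases k; cases k') (auto simp: c'_def d1(1) d2(1,3) d21 o cc)
  qed
  then have "card (insert None (Some ` I)) \<le> jordan_rank m e" by (rule jsys_card_le_rank)
  then show False using sys fin by (simp add: card_image)
qed

text \<open>The square of a vector in the half space has no component in the half space. Thus
  \<open>c \<bowtie> (v \<bowtie> v)\<close> is in the eigenspace 1, where primitivity makes it a
  multiple of \<open>c\<close>.\<close>

lemma peirce_half_square:
  assumes "c \<bowtie> c = c" "c \<bowtie> v = (1/2) *\<^sub>R v"
  shows "c \<bowtie> (c \<bowtie> (v \<bowtie> v)) = c \<bowtie> (v \<bowtie> v)"
proof -
  have "c \<bowtie> ((v \<bowtie> v) \<bowtie> c) - (v \<bowtie> v) \<bowtie> (c \<bowtie> c) = 0"
    using commute_square[of c v c] assms by (simp add: m_comm[of v c] m_linear)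
  then show ?thesis using assms by (simp add: m_comm[of "v \<bowtie> v" c])
qed

text \<open>A nonzero \<open>v\<close> in the joint half spaces of two primitive idempotents has
  \<open>v\<^sup>2 = a (c\<^sub>i + c\<^sub>j)\<close>, and an associative trace form cannot tell the two apart.\<close>

lemma connected_trace_eq:
  assumes sys: "jsys I c" "card I = jordan_rank m e" and ij: "i \<in> I" "j \<in> I" "i \<noteq> j"
    and v: "v \<noteq> 0" "c i \<bowtie> v = (1/2) *\<^sub>R v" "c j \<bowtie> v = (1/2) *\<^sub>R v"
  shows "tr (c i) = tr (c j)"
proof -
  have fin: "finite I" using sys by (simp add: jsys_def)
  have sum_e: "(\<Sum>k\<in>I. c k \<bowtie> x) = x" for x
    using sys by (simp add: jsys_def m_sum_left[symmetric])
  define u where "u = v \<bowtie> v"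
  \<comment> \<open>The members \<open>i\<close> and \<open>j\<close> already account for all of
    \<open>v \<bullet> v\<close>; the other terms are nonnegative, so each of them vanishes, and
    then so does the product with \<open>v\<close>.\<close>
  have "(\<Sum>k\<in>I. v \<bullet> (c k \<bowtie> v)) = v \<bullet> v" using sum_e[of v] by (simp add: inner_sum_right[symmetric])
  moreover have "(\<Sum>k\<in>I. v \<bullet> (c k \<bowtie> v)) = v \<bullet> (c i \<bowtie> v) + (v \<bullet> (c j \<bowtie> v) + (\<Sum>k\<in>I - {i} - {j}. v \<bullet> (c k \<bowtie> v)))"
    using fin ij by (subst sum.remove[of _ i], simp, simp, subst sum.remove[of _ j]) auto
  ultimately have "(\<Sum>k\<in>I - {i} - {j}. v \<bullet> (c k \<bowtie> v)) = 0" using v by simp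
  then have zero: "v \<bullet> (c k \<bowtie> v) = 0" if "k \<in> I - {i} - {j}" for k
    using sum_nonneg_eq_0_iff[of "I - {i} - {j}" "\<lambda>k. v \<bullet> (c k \<bowtie> v)"] fin that
      idempotent_psd[OF jsys_idem[OF sys(1)]] by auto
  have ck: "c k \<bowtie> v = 0" if "k \<in> I - {i} - {j}" for k
    using psd_kernel[OF idempotent_in_Q zero[OF that]] jsys_idem[OF sys(1)] that by auto
  have cu: "c k \<bowtie> u = 0" if "k \<in> I - {i} - {j}" for k
    using idempotent_commute[of "c k" v v] ck[OF that] jsys_idem[OF sys(1)] that by (auto simp: u_def)
  obtain a where a: "c i \<bowtie> u = a *\<^sub>R c i"
    using jsys_primitive[OF sys ij(1) peirce_half_square[OF jsys_idem[OF sys(1) ij(1)] v(2)]] by (auto simp: u_def)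
  obtain b where b: "c j \<bowtie> u = b *\<^sub>R c j"
    using jsys_primitive[OF sys ij(2) peirce_half_square[OF jsys_idem[OF sys(1) ij(2)] v(3)]] by (auto simp: u_def)
  have "(\<Sum>k\<in>I. c k \<bowtie> u) = c i \<bowtie> u + (c j \<bowtie> u + (\<Sum>k\<in>I - {i} - {j}. c k \<bowtie> u))"
    using fin ij by (subst sum.remove[of _ i], simp, simp, subst sum.remove[of _ j]) auto
  then have u: "u = a *\<^sub>R c i + b *\<^sub>R c j" using sum_e[of u] cu a b by simp
  have idem: "c i \<bowtie> c i = c i" "c j \<bowtie> c j = c j" "c i \<bowtie> c j = 0" "c j \<bowtie> c i = 0"
    using jsys_idem[OF sys(1)] jsys_orth[OF sys(1)] ij by auto
  have n: "c i \<bullet> c i > 0" "c i \<bullet> c j = 0" using sys ij jsys_inner_orth[OF sys(1)] by (auto simp: jsys_def)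
  have vv: "v \<bullet> v > 0" using v by simp
  have "a * (c i \<bullet> c i) = (1/2) * (v \<bullet> v)"
  proof -
    have "u \<bullet> c i = (1/2) * (v \<bullet> v)" unfolding u_def using v by (simp add: assoc_inner m_comm[of v "c i"])
    then show ?thesis unfolding u using n by (simp add: inner_add_left inner_commute[of "c j"])
  qed
  then have a0: "a \<noteq> 0" using vv by auto
  \<comment> \<open>By the Jordan identity \<open>u \<bowtie> u\<close> is
    \<open>(a + b) / 2\<close> times \<open>u\<close>. Comparing the coefficients at
    \<open>c i\<close>, with \<open>a\<close> nonzero, gives \<open>a = b\<close>.\<close>
  have "v \<bowtie> u = ((a + b) / 2) *\<^sub>R v"
    unfolding u using v by (simp add: m_linear m_comm[of v] add_divide_distrib scaleR_add_left)
  then have "v \<bowtie> (u \<bowtie> v) = ((a + b) / 2) *\<^sub>R u" by (simp add: m_comm[of u v] m_linear u_def[symmetric])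
  then have "u \<bowtie> u = ((a + b) / 2) *\<^sub>R u"
    using jordan[of v v] unfolding u_def[symmetric] by simp
  then have "(u \<bowtie> u) \<bullet> c i = ((a + b) / 2) * (u \<bullet> c i)" by simp
  moreover have "(u \<bowtie> u) \<bullet> c i = a * a * (c i \<bullet> c i)" "u \<bullet> c i = a * (c i \<bullet> c i)"
    unfolding u using n idem by (simp_all add: m_linear inner_add_left inner_commute[of "c j"])
  ultimately have "a = b" using a0 n by simp
  have t: "a * tr (c k) = (1/2) * tr u" if "k = i \<or> k = j" for k
  proof -
    have "tr ((c k \<bowtie> v) \<bowtie> v) = tr ((v \<bowtie> v) \<bowtie> c k)" by (rule tr_assoc)
    moreover have "(c k \<bowtie> v) \<bowtie> v = (1/2) *\<^sub>R u" using that v by (auto simp: u_def m_linear)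
    moreover have "(v \<bowtie> v) \<bowtie> c k = a *\<^sub>R c k" using that a b \<open>a = b\<close> by (auto simp: u_def[symmetric] m_comm[of u])
    ultimately show ?thesis by (simp add: tr_scale)
  qed
  have "a * tr (c i) = a * tr (c j)" using t[OF disjI1[OF refl]] t[OF disjI2[OF refl]] by linarith
  then show ?thesis using a0 by simp
qed

end

section \<open>Irreducibility and the determinant\<close>

context euclidean_jordan
begin

text \<open>Here multiplication by \<open>c\<close> is a central projection, and
  \<open>e - c\<close> belongs to the complementary factor. A vector of the first factor is positive
  exactly when adding the unit of the second gives a point of \<open>Om\<close>; this transfers
  openness and self-duality. Homogeneity is transferred by automorphisms that commute with central
  maps.\<close>

lemma factor_symmetric:
  assumes idem: "\<And>z. c \<bowtie> (c \<bowtie> z) = c \<bowtie> z" and cen: "central (\<lambda>z. c \<bowtie> z)"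
  shows "symmetric_cone_in (range (\<lambda>z. c \<bowtie> z)) ((\<lambda>z. c \<bowtie> z) ` Om)"
    and "u \<in> Om \<Longrightarrow> v \<in> Om \<Longrightarrow> c \<bowtie> u + (v - c \<bowtie> v) \<in> Om"
proof -
  define p where "p z = c \<bowtie> z" for z
  define S where "S = range p"
  have lin: "linear p" unfolding p_def by (rule linear_m)
  have pp: "p (p z) = p z" for z by (simp add: p_def idem)
  have pm: "p (x \<bowtie> y) = x \<bowtie> p y" for x y using cen by (simp add: central_def p_def)
  have sq: "p (b \<bowtie> b) = p b \<bowtie> p b" for b
    by (metis pm pp m_comm)
  have pin: "p x \<bullet> y = x \<bullet> p y" for x y by (simp add: p_def assoc_inner)
  have sq': "b \<bowtie> b - p (b \<bowtie> b) = (b - p b) \<bowtie> (b - p b)" for b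
    using pm[of b b] by (simp add: m_linear sq m_comm[of "p b" b])
  have combine: "p u + (v - p v) \<in> Om" if uv: "u \<in> Om" "v \<in> Om" for u v
    unfolding Om_iff
  proof (intro ballI impI)
    fix y assume y: "y \<in> Q" "y \<noteq> 0"
    obtain b where b: "y = b \<bowtie> b" using y by (auto simp: Q_def)
    have q: "p y \<in> Q" "y - p y \<in> Q" unfolding b sq' by (auto simp: sq Q_def)
    have "(p u + (v - p v)) \<bullet> y = u \<bullet> p y + v \<bullet> (y - p y)"
      by (simp add: inner_add_left inner_diff_left inner_diff_right pin)
    moreover have "u \<bullet> p y \<ge> 0" "v \<bullet> (y - p y) \<ge> 0" using q uv Om_subset_Q Q_inner by blast+
    moreover have "u \<bullet> p y > 0 \<or> v \<bullet> (y - p y) > 0"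
    proof (cases "p y = 0")
      case True
      then show ?thesis using Om_inner_pos[OF uv(2) q(2)] y by simp
    next
      case False
      then show ?thesis using Om_inner_pos[OF uv(1) q(1)] by simp
    qed
    ultimately show "(p u + (v - p v)) \<bullet> y > 0" by linarith
  qed
  then show "u \<in> Om \<Longrightarrow> v \<in> Om \<Longrightarrow> c \<bowtie> u + (v - c \<bowtie> v) \<in> Om" by (simp add: p_def)
  have subS: "subspace S" unfolding S_def using lin by (simp add: linear_subspace_image)
  have pS: "p z = z" if "z \<in> S" for z using that pp by (auto simp: S_def)
  \<comment> \<open>Describing the projected cone as a slice of \<open>Om\<close> through the unit
    of the other factor makes its relative openness a preimage statement.\<close>
  have pOm: "p ` Om = {x \<in> S. x + (e - p e) \<in> Om}"
  proof (intro equalityI subsetI)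
    fix x assume "x \<in> p ` Om"
    then show "x \<in> {x \<in> S. x + (e - p e) \<in> Om}" using combine unit_in_Om by (auto simp: S_def)
  next
    fix x assume "x \<in> {x \<in> S. x + (e - p e) \<in> Om}"
    moreover have "p (x + (e - p e)) = p x" using lin by (simp add: linear_add linear_diff pp)
    ultimately show "x \<in> p ` Om" using pS by (metis (mono_tags, lifting) image_eqI mem_Collect_eq)
  qed
  have convOm: "convex Om"
    unfolding convex_alt
  proof (intro ballI allI impI)
    fix x y :: 'a and u :: real assume xy: "x \<in> Om" "y \<in> Om" and u: "0 \<le> u \<and> u \<le> 1"
    show "(1 - u) *\<^sub>R x + u *\<^sub>R y \<in> Om" unfolding Om_iff
    proof (intro ballI impI)
      fix z assume "z \<in> Q" "z \<noteq> 0"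
      then have "x \<bullet> z > 0" "y \<bullet> z > 0" using xy Om_inner_pos by auto
      then show "((1 - u) *\<^sub>R x + u *\<^sub>R y) \<bullet> z > 0" using u
        by (cases "u = 0") (auto simp: inner_add_left intro!: add_nonneg_pos)
    qed
  qed
  have cl: "closure (p ` Om) \<subseteq> Q \<inter> S"
  proof (rule closure_minimal)
    show "closed (Q \<inter> S)" using closed_Q closed_subspace[OF subS] by (rule closed_Int)
    show "p ` Om \<subseteq> Q \<inter> S"
    proof
      fix x assume "x \<in> p ` Om"
      then obtain u where u: "x = p u" "u \<in> Om" by blast
      then obtain b where "u = b \<bowtie> b" using Om_subset_Q by (auto simp: Q_def)
      then have "x = p b \<bowtie> p b" using u sq by simp
      moreover have "x \<in> S" unfolding u(1) S_def by (rule rangeI)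
      ultimately show "x \<in> Q \<inter> S" by (auto simp: Q_def)
    qed
  qed
  have pQ: "p y \<in> closure (p ` Om)" if "y \<in> Q" for y
    using closure_bounded_linear_image_subset[of p Om] lin that closure_Om by (auto simp: linear_linear)
  have "symmetric_cone_in S (p ` Om)" unfolding symmetric_cone_in_def
  proof (intro conjI)
    show "p ` Om \<subseteq> S" by (auto simp: S_def)
    show "p ` Om \<noteq> {}" using unit_in_Om by auto
    show "openin (top_of_set S) (p ` Om)"
    proof -
      have "{x \<in> S. x + (e - p e) \<in> Om} = S \<inter> (\<lambda>x. x + (e - p e)) -` Om" by auto
      moreover have "openin (top_of_set S) (S \<inter> (\<lambda>x. x + (e - p e)) -` Om)"
        by (rule continuous_openin_preimage_gen[OF _ open_Om]) (intro continuous_intros)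
      ultimately show ?thesis unfolding pOm by simp
    qed
    show "convex (p ` Om)" using convOm lin by (rule convex_linear_image[rotated])
    show "\<forall>k>0. \<forall>x\<in>p ` Om. k *\<^sub>R x \<in> p ` Om"
    proof (intro allI impI ballI)
      fix k :: real and x assume k: "k > 0" "x \<in> p ` Om"
      then obtain u where u: "x = p u" "u \<in> Om" by blast
      then have "k *\<^sub>R u \<in> Om" using k by (simp add: Om_iff)
      then show "k *\<^sub>R x \<in> p ` Om" using u lin by (metis image_eqI linear_scale)
    qed
    show "p ` Om = {y \<in> S. \<forall>x\<in>closure (p ` Om) - {0}. x \<bullet> y > 0}"
    proof (intro equalityI subsetI)
      fix y assume "y \<in> p ` Om"
      then obtain u where u: "y = p u" "u \<in> Om" by blast
      have "x \<bullet> y > 0" if "x \<in> closure (p ` Om) - {0}" for x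
      proof -
        have x: "x \<in> Q" "p x = x" "x \<noteq> 0" using that cl pS by auto
        have "x \<bullet> y = x \<bullet> u" using pin[of x u] x u by simp
        then show ?thesis using Om_inner_pos[OF u(2) x(1,3)] by (simp add: inner_commute)
      qed
      then show "y \<in> {y \<in> S. \<forall>x\<in>closure (p ` Om) - {0}. x \<bullet> y > 0}" using u by (auto simp: S_def)
    next
      fix y assume y: "y \<in> {y \<in> S. \<forall>x\<in>closure (p ` Om) - {0}. x \<bullet> y > 0}"
      have "y + (e - p e) \<in> Om" unfolding Om_iff
      proof (intro ballI impI)
        fix z assume z: "z \<in> Q" "z \<noteq> 0"
        obtain b where b: "z = b \<bowtie> b" using z by (auto simp: Q_def)
        have pz: "y \<bullet> z = y \<bullet> p z" using pin[of y z] pS[of y] y by simp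
        have ez: "(e - p e) \<bullet> z = (b - p b) \<bullet> (b - p b)"
        proof -
          have "(e - p e) \<bullet> z = e \<bullet> (z - p z)" by (simp add: inner_diff_left inner_diff_right pin)
          also have "\<dots> = (b - p b) \<bullet> (b - p b)" unfolding b sq' using inner_square[of "b - p b" e] by simp
          finally show ?thesis .
        qed
        show "(y + (e - p e)) \<bullet> z > 0"
        proof (cases "p z = 0")
          case True
          then have "b - p b \<noteq> 0" using sq'[of b] b z by auto
          then show ?thesis using True by (simp add: inner_add_left pz ez)
        next
          case False
          then have "p z \<bullet> y > 0" using y pQ[OF z(1)] by auto
          then have "y \<bullet> p z > 0" by (simp only: inner_commute)
          then show ?thesis unfolding inner_add_left pz ez by (intro add_pos_nonneg) auto
        qed
      qed
      then show "y \<in> p ` Om" using y pOm by auto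
    qed
    show "\<forall>x\<in>p ` Om. \<forall>y\<in>p ` Om. \<exists>g. linear g \<and> g ` S = S \<and> g ` p ` Om = p ` Om \<and> g x = y"
    proof (intro ballI)
      fix x y assume "x \<in> p ` Om" "y \<in> p ` Om"
      then obtain u v where uv: "x = p u" "u \<in> Om" "y = p v" "v \<in> Om" by blast
      have "central p" using cen by (simp add: p_def[abs_def])
      \<comment> \<open>Bijective because the range is a subspace containing an open set. For two
        such maps, sending \<open>e\<close> to \<open>u\<close> and to \<open>v\<close>, the second
        after the inverse of the first restricts to the factor and takes \<open>x\<close> to
        \<open>y\<close>.\<close>
      have fact: "\<exists>g. linear g \<and> bij g \<and> g ` Om = Om \<and> g e = w \<and> (\<forall>z. p (g z) = g (p z))" if w: "w \<in> Om" for w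
      proof -
        obtain g J where g: "cone_aut J g" "g e = w" "\<And>f z. central f \<Longrightarrow> f (g z) = g (f z)"
          using Om_transitive[OF w] by blast
        have lg: "linear g" "g ` Om = Om" using g by (auto simp: cone_aut_def)
        have "surj g"
        proof -
          have "Om \<subseteq> range g" using lg by blast
          moreover have "span Om = UNIV" using affine_hull_open[OF open_Om] affine_hull_subset_span[of Om] unit_in_Om by auto
          moreover have "subspace (range g)" using lg(1) by (simp add: linear_subspace_image)
          ultimately show ?thesis by (metis span_minimal top.extremum_uniqueI)
        qed
        then have "bij g" using lg(1) linear_surj_imp_inj[of g] by (simp add: bij_def linear_surjective_imp_injective)
        then show ?thesis using g lg \<open>central p\<close> by blast
      qed
      obtain g where g: "linear g" "bij g" "g ` Om = Om" "g e = u" "\<And>z. p (g z) = g (p z)" using fact[OF uv(2)] by blast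
      obtain h where h: "linear h" "bij h" "h ` Om = Om" "h e = v" "\<And>z. p (h z) = h (p z)" using fact[OF uv(4)] by blast
      define k where "k = inv g"
      have k: "linear k" "\<And>z. k (g z) = z" "\<And>z. g (k z) = z"
        using g(1,2) by (auto simp: k_def bij_is_inj bij_is_surj surj_f_inv_f inj_linear_imp_inv_linear)
      have pk: "p (k z) = k (p z)" for z using k(2)[of "p (k z)"] g(5)[of "k z"] k(3) by simp
      have kOm: "k ` Om = Om" using g(3) k(2) by (metis (no_types, lifting) image_image image_ident image_cong)
      let ?f = "\<lambda>z. h (k z)"
      have f: "linear ?f" using linear_compose[OF k(1) h(1)] by (simp add: o_def)
      have pf: "p (?f z) = ?f (p z)" for z by (simp add: h(5) pk)
      have "?f ` p ` A = p ` (?f ` A)" for A by (simp add: image_image pf)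
      moreover have "?f ` Om = Om" using h(3) kOm by (metis image_image)
      moreover have "range ?f = UNIV"
      proof -
        have "surj k" using k(2) by (metis surjI)
        then show ?thesis using h(2) by (metis bij_is_surj image_image)
      qed
      moreover have "?f x = y" using k(2) g(4) uv h(4) g(5)[of e] h(5)[of e] by metis
      ultimately show "\<exists>g. linear g \<and> g ` S = S \<and> g ` p ` Om = p ` Om \<and> g x = y"
        using f unfolding S_def by (intro exI[of _ ?f]) auto
    qed
  qed (rule subS)
  then show "symmetric_cone_in (range (\<lambda>z. c \<bowtie> z)) ((\<lambda>z. c \<bowtie> z) ` Om)"
    by (simp add: S_def p_def[abs_def])
qed

text \<open>Without a half space, multiplication by \<open>c\<close> is a projection that commutes
  with all multiplications. Then \<open>c\<close> and \<open>e - c\<close> cut the algebra into two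
  ideals and the cone into the sum of two symmetric cones.\<close>

lemma irreducible_half:
  assumes irr: "irreducible_symmetric_cone Om" and c: "c \<bowtie> c = c" "c \<noteq> 0" "c \<noteq> e"
  shows "\<exists>v. v \<noteq> 0 \<and> c \<bowtie> v = (1/2) *\<^sub>R v"
proof (rule ccontr)
  assume no: "\<not> ?thesis"
  then have Eh: "Eh c z = 0" for z using peirce_eigen[OF c(1)] by blast
  have cz: "c \<bowtie> z = E1 c z" for z using m_E[OF c(1), of z] Eh by simp
  have idem: "c \<bowtie> (c \<bowtie> z) = c \<bowtie> z" for z unfolding cz[of z] by (rule peirce_eigen(1)[OF c(1)])
  have comm: "c \<bowtie> (d \<bowtie> z) = d \<bowtie> (c \<bowtie> z)" for d z
  proof -
    have 1: "(c \<bowtie> d) \<bowtie> (c \<bowtie> z) = c \<bowtie> ((c \<bowtie> d) \<bowtie> z)" by (rule idempotent_commute[OF c(1)]) (simp add: idem)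
    have 2: "(d - c \<bowtie> d) \<bowtie> (c \<bowtie> z) = c \<bowtie> ((d - c \<bowtie> d) \<bowtie> z)" by (rule idempotent_commute[OF c(1)]) (simp add: idem m_linear)
    \<comment> \<open>Both summands are eigenvectors, for 1 and for 0, where commuting with
      \<open>c\<close> is already known.\<close>
    have "d = c \<bowtie> d + (d - c \<bowtie> d)" by simp
    then have "d \<bowtie> (c \<bowtie> z) = (c \<bowtie> d) \<bowtie> (c \<bowtie> z) + (d - c \<bowtie> d) \<bowtie> (c \<bowtie> z)" by (metis m_linear(1))
    also have "\<dots> = c \<bowtie> ((c \<bowtie> d) \<bowtie> z + (d - c \<bowtie> d) \<bowtie> z)" unfolding 1 2 by (simp add: m_linear)
    also have "\<dots> = c \<bowtie> (d \<bowtie> z)" by (simp add: m_linear)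
    finally show ?thesis by simp
  qed
  have cen: "central (\<lambda>z. c \<bowtie> z)" unfolding central_def using linear_m comm by blast
  define c' where "c' = e - c"
  have c'z: "c' \<bowtie> z = z - c \<bowtie> z" for z by (simp add: c'_def m_linear)
  have idem': "c' \<bowtie> (c' \<bowtie> z) = c' \<bowtie> z" for z by (simp add: c'z m_linear idem)
  have cen': "central (\<lambda>z. c' \<bowtie> z)" unfolding central_def by (intro conjI linear_m) (simp add: c'z m_linear comm)
  note F = factor_symmetric[OF idem cen] and F' = factor_symmetric[OF idem' cen']
  let ?S1 = "range (\<lambda>z. c \<bowtie> z)" and ?S2 = "range (\<lambda>z. c' \<bowtie> z)"
  have "c \<in> ?S1" "c' \<in> ?S2" using c idem'[of e] by (auto intro: range_eqI[of _ _ c] range_eqI[of _ _ c'] simp: c'_def m_linear)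
  moreover have "c' \<noteq> 0" using c by (simp add: c'_def)
  ultimately have "?S1 \<noteq> {0}" "?S2 \<noteq> {0}" using c(2) by blast+
  moreover have "?S1 \<inter> ?S2 = {0}"
  proof -
    have "z = 0" if "z \<in> ?S1" "z \<in> ?S2" for z
    proof -
      have "c \<bowtie> z = z" using that(1) idem by auto
      moreover have "c \<bowtie> z = 0" using that(2) by (auto simp: c'z m_linear idem)
      ultimately show ?thesis by simp
    qed
    moreover have "0 \<in> ?S1" "0 \<in> ?S2" by (auto intro: range_eqI[of _ _ 0])
    ultimately show ?thesis by blast
  qed
  moreover have "{x + y | x y. x \<in> ?S1 \<and> y \<in> ?S2} = UNIV"
  proof -
    have "z = c \<bowtie> z + c' \<bowtie> z" for z by (simp add: c'z)
    then show ?thesis by blast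
  qed
  moreover have "Om = {x + y | x y. x \<in> (\<lambda>z. c \<bowtie> z) ` Om \<and> y \<in> (\<lambda>z. c' \<bowtie> z) ` Om}"
  proof (intro equalityI subsetI)
    fix x assume "x \<in> Om"
    moreover have "x = c \<bowtie> x + c' \<bowtie> x" by (simp add: c'z)
    ultimately show "x \<in> {x + y | x y. x \<in> (\<lambda>z. c \<bowtie> z) ` Om \<and> y \<in> (\<lambda>z. c' \<bowtie> z) ` Om}" by blast
  next
    fix x assume "x \<in> {x + y | x y. x \<in> (\<lambda>z. c \<bowtie> z) ` Om \<and> y \<in> (\<lambda>z. c' \<bowtie> z) ` Om}"
    then show "x \<in> Om" using F(2) by (auto simp: c'z)
  qed
  ultimately show False using irr F(1) F'(1) unfolding irreducible_symmetric_cone_def by blast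
qed

lemma unit_nonzero: "e \<noteq> 0"
proof
  assume "e = 0"
  then have "x = 0" for x :: 'a using unit_left[of x] by simp
  then show False using nonempty_Basis nonzero_Basis by blast
qed

text \<open>Let \<open>C\<close> be the sum of the frame members with the trace of
  \<open>c i\<close>. If some member were left over, a half vector of \<open>C\<close> would have a
  component in the joint half space of a member inside and one outside, and their traces would
  agree. So all traces are equal, and they sum to the trace of the identity.\<close>

lemma primitive_trace:
  assumes irr: "irreducible_symmetric_cone Om"
    and sys: "jsys I c" "card I = jordan_rank m e" and i: "i \<in> I"
  shows "tr (c i) = real DIM('a) / real (jordan_rank m e)"
proof -
  have fin: "finite I" using sys by (simp add: jsys_def)
  define A where "A = {k \<in> I. tr (c k) = tr (c i)}"
  have A: "A \<subseteq> I" "finite A" "i \<in> A" using i fin by (auto simp: A_def)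
  define C where "C = (\<Sum>k\<in>A. c k)"
  have "A = I"
  proof (rule ccontr)
    assume "A \<noteq> I"
    then obtain j where j: "j \<in> I" "j \<notin> A" using A by blast
    have Cr: "C = (\<Sum>k\<in>I. (if k \<in> A then 1 else 0) *\<^sub>R c k)"
      unfolding C_def using fin A by (simp add: sum.inter_restrict[symmetric] if_distrib[of "\<lambda>x. x *\<^sub>R _"] Int_absorb1 cong: if_cong)
    have CC: "C \<bowtie> C = C" unfolding Cr jsys_mult[OF sys(1)] by (intro sum.cong) auto
    have Ci: "C \<bullet> c i = (norm (c i))\<^sup>2" using jsys_inner[OF sys(1) i] A unfolding Cr by simp
    have Cj: "C \<bullet> c j = 0" using jsys_inner[OF sys(1) j(1)] j unfolding Cr by simp
    have "C \<noteq> 0" using Ci i sys by (auto simp: jsys_def)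
    moreover have "C \<noteq> e"
    proof
      assume "C = e"
      then have "c j \<bullet> c j = 0" using Cj assoc_inner[of "c j" e "c j"] jsys_idem[OF sys(1) j(1)] by simp
      then show False using sys j by (auto simp: jsys_def)
    qed
    ultimately obtain w where w: "w \<noteq> 0" "C \<bowtie> w = (1/2) *\<^sub>R w"
      using irreducible_half[OF irr CC] by blast
    have rest: "(\<Sum>k\<in>I - A. c k \<bowtie> w) = (1/2) *\<^sub>R w"
    proof -
      have "(\<Sum>k\<in>I. c k \<bowtie> w) = w" using sys by (simp add: jsys_def m_sum_left[symmetric])
      then have "(\<Sum>k\<in>I - A. c k \<bowtie> w) = w - C \<bowtie> w" using fin A by (simp add: sum_diff C_def m_sum_left)
      also have "\<dots> = (1 - 1/2) *\<^sub>R w" unfolding w scaleR_diff_left by simp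
      finally show ?thesis by simp
    qed
    \<comment> \<open>Both \<open>C\<close> and \<open>e - C\<close> act on \<open>w\<close> as one
      half, so the double sum is a quarter of \<open>w\<close> and has a nonzero term.\<close>
    have "(\<Sum>k\<in>A. \<Sum>l\<in>I - A. c k \<bowtie> (c l \<bowtie> w)) = C \<bowtie> ((1/2) *\<^sub>R w)"
      unfolding rest[symmetric] C_def by (simp add: m_sum_left m_sum_right) (rule sum.swap)
    also have "\<dots> = (1/4) *\<^sub>R w" by (simp add: m_linear w)
    finally have "(\<Sum>k\<in>A. \<Sum>l\<in>I - A. c k \<bowtie> (c l \<bowtie> w)) \<noteq> 0" using w by simp
    then obtain k l where kl: "k \<in> A" "l \<in> I - A" "c k \<bowtie> (c l \<bowtie> w) \<noteq> 0"
      by (metis (no_types, lifting) sum.neutral)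
    define v where "v = c k \<bowtie> (c l \<bowtie> w)"
    have kI: "k \<in> I" "l \<in> I" "k \<noteq> l" using kl A by auto
    \<comment> \<open>In \<open>mult_op\<close> for \<open>c k\<close>, \<open>c l\<close>,
      \<open>c k\<close> the products of distinct members vanish; as the two multiplications
      commute, \<open>c k \<bowtie> (c l \<bowtie> w)\<close> equals twice its own product with
      \<open>c k\<close>.\<close>
    have half: "c k \<bowtie> (c k \<bowtie> (c l \<bowtie> w)) = (1/2) *\<^sub>R (c k \<bowtie> (c l \<bowtie> w))"
      if "k \<in> I" "l \<in> I" "k \<noteq> l" for k l
    proof -
      have z: "c k \<bowtie> c l = 0" "c l \<bowtie> c k = 0" "c k \<bowtie> c k = c k" using jsys_orth[OF sys(1)] jsys_idem[OF sys(1)] that by auto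
      have cm: "c l \<bowtie> (c k \<bowtie> x) = c k \<bowtie> (c l \<bowtie> x)" for x using idempotent_commute[OF z(3), of "c l"] z by blast
      have "0 = c k \<bowtie> (c l \<bowtie> w) - c k \<bowtie> (c k \<bowtie> (c l \<bowtie> w)) - c l \<bowtie> (c k \<bowtie> (c k \<bowtie> w))"
        using mult_op[of "c k" "c l" "c k" w] by (simp add: z)
      then have "c k \<bowtie> (c l \<bowtie> w) = 2 *\<^sub>R (c k \<bowtie> (c k \<bowtie> (c l \<bowtie> w)))" by (simp add: cm scaleR_2 algebra_simps)
      then show ?thesis by (metis scaleR_half_double scaleR_2 divide_real_def mult_1 scaleR_scaleR nonzero_eq_divide_eq scaleR_one zero_neq_numeral)
    qed
    have "c l \<bowtie> v = c l \<bowtie> (c l \<bowtie> (c k \<bowtie> w))" 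
      unfolding v_def using idempotent_commute[OF jsys_idem[OF sys(1) kI(1)], of "c l" w] jsys_orth[OF sys(1) kI(1,2,3)] by simp
    also have "\<dots> = (1/2) *\<^sub>R (c l \<bowtie> (c k \<bowtie> w))" by (rule half) (use kI in auto)
    also have "c l \<bowtie> (c k \<bowtie> w) = v" 
      unfolding v_def using idempotent_commute[OF jsys_idem[OF sys(1) kI(1)], of "c l" w] jsys_orth[OF sys(1) kI(1,2,3)] by simp
    finally have "tr (c k) = tr (c l)"
      using half[OF kI] kl by (intro connected_trace_eq[OF sys kI, of v]) (auto simp: v_def)
    then show False using kl by (auto simp: A_def)
  qed
  then have "tr (c k) = tr (c i)" if "k \<in> I" for k using that by (auto simp: A_def)
  then have "(\<Sum>k\<in>I. tr (c k)) = card I * tr (c i)" by simp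
  moreover have "(\<Sum>k\<in>I. tr (c k)) = DIM('a)"
    using tr_sum[of c I] sys(1) tr_unit by (simp add: jsys_def)
  moreover have "card I > 0" using i fin by (auto simp: card_gt_0_iff)
  ultimately show ?thesis using sys(2) by (simp add: field_simps)
qed

section \<open>The determinant at regular elements, and their density\<close>

lemma rank_pos: "jordan_rank m e > 0"
proof -
  obtain x where x: "jordan_regular m e x" using regular_exists by blast
  obtain R :: "real set" and c where R: "jsys R c" "degree (jordan_min_poly m e x) = card R"
    using spectral_min_poly[of x] by metis
  have "R \<noteq> {}" using R(1) unit_nonzero by (auto simp: jsys_def)
  then show ?thesis using R x by (auto simp: jordan_regular_def jsys_def card_gt_0_iff)
qed

text \<open>The spectral system of a regular element is a whole frame, and \<Delta> is the product
  of the eigenvalues. Since all traces are equal, the exponent of the modulus is their common value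
  times the sum of the logarithms, that is times \<open>ln (\<Delta> x)\<close>.\<close>

lemma regular_det:
  assumes irr: "irreducible_symmetric_cone Om" and det: "is_jordan_det m e \<Delta>"
    and x: "jordan_regular m e x" "x \<in> Om"
  shows "\<Delta> x > 0 \<and> (\<exists>g. cone_aut (\<Delta> x powr (real DIM('a) / real (jordan_rank m e))) g \<and> g e = x)"
proof -
  obtain R :: "real set" and c where R: "jsys R c" and xr: "x = (\<Sum>l\<in>R. l *\<^sub>R c l)" 
    and mp: "jordan_min_poly m e x = (\<Prod>l\<in>R. [:- l, 1:])" and deg: "degree (jordan_min_poly m e x) = card R"
    using spectral_min_poly[of x] by blast
  have card: "card R = jordan_rank m e" using deg x(1) by (simp add: jordan_regular_def)
  have pos: "\<And>l. l \<in> R \<Longrightarrow> l > 0" using Om_jsys[OF R, of "\<lambda>l. l"] x xr by auto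
  have fin: "finite R" using R by (simp add: jsys_def)
  have "\<Delta> x = (- 1) ^ card R * coeff (\<Prod>l\<in>R. [:- l, 1:]) 0"
    using det x(1) card mp by (simp add: is_jordan_det_def)
  also have "coeff (\<Prod>l\<in>R. [:- l, 1:]) 0 = (\<Prod>l\<in>R. - l)"
    by (simp add: poly_0_coeff_0[symmetric] poly_prod)
  also have "\<dots> = (- 1) ^ card R * (\<Prod>l\<in>R. l)" by (simp add: prod_uminus)
  finally have D: "\<Delta> x = (\<Prod>l\<in>R. l)" by (simp add: mult.assoc[symmetric] power_mult_distrib[symmetric])
  have Dpos: "\<Delta> x > 0" unfolding D using pos by (intro prod_pos) auto
  let ?q = "real DIM('a) / real (jordan_rank m e)"
  have "(\<Sum>l\<in>R. ln l * tr (c l)) = (\<Sum>l\<in>R. ln l) * ?q"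
    unfolding sum_distrib_right by (intro sum.cong) (auto simp: primitive_trace[OF irr R card])
  also have "(\<Sum>l\<in>R. ln l) = ln (\<Delta> x)" unfolding D by (subst ln_prod) (use pos fin in auto)
  finally have "exp (\<Sum>l\<in>R. ln l * tr (c l)) = \<Delta> x powr ?q" using Dpos by (simp add: powr_def mult.commute)
  moreover obtain g where "cone_aut (exp (\<Sum>l\<in>R. ln l * tr (c l))) g" "g e = (\<Sum>l\<in>R. l *\<^sub>R c l)"
    using spectral_aut[OF R, of "\<lambda>l. l", OF pos] by blast
  ultimately show ?thesis using Dpos xr by auto
qed

text \<open>Density of the regular elements needs that independent polynomial curves stay independent off a
  finite set of parameters. Eliminating one curve at a time avoids determinants.\<close>

definition poly_curve :: "(real \<Rightarrow> 'a) \<Rightarrow> bool" where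
  "poly_curve f \<longleftrightarrow> (\<forall>u. \<exists>P. \<forall>t. f t \<bullet> u = poly P t)"

text \<open>Independence of an indexed family, so that coinciding vectors count as
  dependent.\<close>

definition indep_family :: "(nat \<Rightarrow> 'a) \<Rightarrow> nat \<Rightarrow> bool" where
  "indep_family f r \<longleftrightarrow> (\<forall>a. (\<Sum>k<r. a k *\<^sub>R f k) = 0 \<longrightarrow> (\<forall>k<r. a k = 0))"

lemma finite_dependent:
  assumes "\<And>k. k < r \<Longrightarrow> poly_curve (f k)" "indep_family (\<lambda>k. f k t0) r"
  shows "finite {t. \<not> indep_family (\<lambda>k. f k t) r}"
  using assms
proof (induction r arbitrary: f)
  case 0
  then show ?case by (simp add: indep_family_def)
next
  case (Suc r)
  \<comment> \<open>Pairing with the value of the first curve at \<open>t0\<close> gives a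
    functional that does not vanish on it there.\<close>
  define u where "u = f 0 t0"
  define L where "L v = v \<bullet> u" for v :: 'a
  have u0: "u \<noteq> 0"
  proof
    assume "u = 0"
    then have "(\<Sum>k<Suc r. (if k = 0 then 1 else 0) *\<^sub>R f k t0) = 0"
      by (subst sum.lessThan_Suc_shift) (simp add: u_def)
    then show False
      using Suc.prems(2)[unfolded indep_family_def, rule_format, of "\<lambda>k. if k = 0 then 1 else 0" 0] by simp
  qed
  \<comment> \<open>Elimination by cross multiplication: no division, so the new curves remain
    polynomial, and the functional \<open>L\<close> vanishes on them.\<close>
  define g where "g k t = L (f 0 t) *\<^sub>R f (Suc k) t - L (f (Suc k) t) *\<^sub>R f 0 t" for k t
  have elim: "indep_family (\<lambda>k. f k t) (Suc r)" if L: "L (f 0 t) \<noteq> 0" and ind: "indep_family (\<lambda>k. g k t) r" for t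
    unfolding indep_family_def
  proof (intro allI impI)
    fix a k assume a: "(\<Sum>k<Suc r. a k *\<^sub>R f k t) = 0" and k: "k < Suc r"
    have a': "a 0 *\<^sub>R f 0 t + (\<Sum>k<r. a (Suc k) *\<^sub>R f (Suc k) t) = 0"
      using a by (subst (asm) sum.lessThan_Suc_shift) simp
    then have La: "a 0 * L (f 0 t) + (\<Sum>k<r. a (Suc k) * L (f (Suc k) t)) = 0"
      using arg_cong[OF a', of L] unfolding L_def inner_add_left inner_sum_left inner_scaleR_left by simp
    have "(\<Sum>k<r. a (Suc k) *\<^sub>R g k t) = L (f 0 t) *\<^sub>R (\<Sum>k<r. a (Suc k) *\<^sub>R f (Suc k) t) - (\<Sum>k<r. a (Suc k) * L (f (Suc k) t)) *\<^sub>R f 0 t"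
      by (simp add: g_def scaleR_diff_right sum_subtractf scaleR_sum_right scaleR_sum_left mult.commute)
    also have "(\<Sum>k<r. a (Suc k) *\<^sub>R f (Suc k) t) = - (a 0 *\<^sub>R f 0 t)" using a' by (simp add: eq_neg_iff_add_eq_0 add.commute)
    also have "(\<Sum>k<r. a (Suc k) * L (f (Suc k) t)) = - (a 0 * L (f 0 t))" using La by linarith
    finally have "(\<Sum>k<r. a (Suc k) *\<^sub>R g k t) = 0" by (simp add: mult.commute)
    then have aS: "\<forall>k<r. a (Suc k) = 0" using ind[unfolded indep_family_def] by (auto dest: spec[of _ "\<lambda>k. a (Suc k)"])
    then have "a 0 * L (f 0 t) = 0" using La by simp
    then have "a 0 = 0" using L by simp
    then show "a k = 0" using aS k by (cases k) auto
  qed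
  have Lt0: "L (f 0 t0) \<noteq> 0" using u0 by (simp add: L_def u_def)
  have "indep_family (\<lambda>k. g k t0) r"
    unfolding indep_family_def
  proof (intro allI impI)
    fix a k assume a: "(\<Sum>k<r. a k *\<^sub>R g k t0) = 0" and k: "k < r"
    define b where "b j = (case j of 0 \<Rightarrow> - (\<Sum>k<r. a k * L (f (Suc k) t0)) | Suc k \<Rightarrow> L (f 0 t0) * a k)" for j
    have "(\<Sum>k<Suc r. b k *\<^sub>R f k t0) = (\<Sum>k<r. a k *\<^sub>R g k t0)"
      by (subst sum.lessThan_Suc_shift)
         (simp add: b_def g_def scaleR_diff_right sum_subtractf scaleR_sum_left mult.commute)
    then have "b (Suc k) = 0" using Suc.prems(2) a k unfolding indep_family_def by (metis Suc_less_eq)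
    then show "a k = 0" using Lt0 by (simp add: b_def)
  qed
  moreover have "poly_curve (g k)" if kr: "k < r" for k
    unfolding poly_curve_def
  proof
    fix w
    obtain P1 where P1: "\<And>t. L (f 0 t) = poly P1 t" using Suc.prems(1)[of 0] by (auto simp: poly_curve_def L_def)
    obtain P2 where P2: "\<And>t. L (f (Suc k) t) = poly P2 t" using Suc.prems(1)[of "Suc k"] kr by (auto simp: poly_curve_def L_def)
    obtain P3 where P3: "\<And>t. f 0 t \<bullet> w = poly P3 t" using Suc.prems(1)[of 0] by (auto simp: poly_curve_def)
    obtain P4 where P4: "\<And>t. f (Suc k) t \<bullet> w = poly P4 t" using Suc.prems(1)[of "Suc k"] kr by (auto simp: poly_curve_def)
    show "\<exists>P. \<forall>t. g k t \<bullet> w = poly P t"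
      by (rule exI[of _ "P1 * P4 - P2 * P3"]) (simp add: g_def inner_diff_left P1 P2 P3 P4)
  qed
  ultimately have fin: "finite {t. \<not> indep_family (\<lambda>k. g k t) r}" using Suc.IH[of g] by blast
  obtain P where P: "\<And>t. L (f 0 t) = poly P t" using Suc.prems(1)[of 0] by (auto simp: poly_curve_def L_def)
  have "P \<noteq> 0" using Lt0 P by auto
  then have "finite {t. L (f 0 t) = 0}" unfolding P by (rule poly_roots_finite)
  then show ?case by (rule finite_subset[rotated, OF finite_UnI[OF fin]]) (use elim in blast)
qed

text \<open>Turns regularity into a condition on powers that can be tested along polynomial curves.
  A relation among the first powers of a regular element is a polynomial with more roots than its
  degree; if the element is not regular, its minimal polynomial is a relation with leading
  coefficient 1.\<close>

lemma regular_indep: "jordan_regular m e x \<longleftrightarrow> indep_family (pw x) (jordan_rank m e)"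
proof -
  let ?r = "jordan_rank m e"
  obtain R :: "real set" and c where R: "jsys R c" "x = (\<Sum>l\<in>R. l *\<^sub>R c l)" 
    and mp: "jordan_min_poly m e x = (\<Prod>l\<in>R. [:- l, 1:])" and deg: "degree (jordan_min_poly m e x) = card R"
    using spectral_min_poly[of x] by blast
  have card: "card R \<le> ?r" using jsys_card_le_rank[OF R(1)] .
  have fin: "finite R" using R by (simp add: jsys_def)
  show ?thesis
  proof
    assume "jordan_regular m e x"
    then have c: "card R = ?r" using deg by (simp add: jordan_regular_def)
    show "indep_family (pw x) ?r" unfolding indep_family_def
    proof (intro allI impI)
      fix a k assume a: "(\<Sum>k<?r. a k *\<^sub>R pw x k) = 0" and k: "k < ?r"
      define p where "p = (\<Sum>k<?r. monom (a k) k)"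
      have cp: "coeff p j = (if j < ?r then a j else 0)" for j by (auto simp: p_def coeff_sum)
      have dp: "degree p < ?r" using rank_pos by (intro degree_lessI) (auto simp: cp)
      have "pp x p = (\<Sum>k\<le>?r - 1. coeff p k *\<^sub>R pw x k)" using dp by (intro pp_sum) simp
      also have "{..?r - 1} = {..<?r}" using rank_pos by auto
      finally have "pp x p = 0" using a by (simp add: cp)
      then have "(\<Sum>l\<in>R. poly p l *\<^sub>R c l) = 0" using jsys_pp[OF R(1), of "\<lambda>l. l" p] R(2) by simp
      then have root: "poly p l = 0" if "l \<in> R" for l using jsys_sum_eq_0[OF R(1) _ that] by blast
      have "p = 0"
      proof (rule ccontr)
        assume "p \<noteq> 0"
        then have "card R \<le> card {l. poly p l = 0}" using root poly_roots_finite by (intro card_mono) auto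
        also have "\<dots> \<le> degree p" using \<open>p \<noteq> 0\<close> by (rule card_poly_roots_bound)
        finally show False using dp c by simp
      qed
      then show "a k = 0" using cp[of k] k by simp
    qed
  next
    assume ind: "indep_family (pw x) ?r"
    show "jordan_regular m e x"
    proof (rule ccontr)
      assume "\<not> jordan_regular m e x"
      then have lt: "card R < ?r" using card deg by (simp add: jordan_regular_def)
      let ?q = "\<Prod>l\<in>R. [:- l, 1:]"
      have "pp x ?q = (\<Sum>l\<in>R. poly ?q l *\<^sub>R c l)" using jsys_pp[OF R(1), of "\<lambda>l. l" ?q] R(2) by simp
      also have "\<dots> = 0" unfolding poly_prod using fin by (intro sum.neutral) (auto simp: prod_zero_iff)
      finally have "pp x ?q = 0" .
      moreover have "pp x ?q = (\<Sum>k\<le>?r - 1. coeff ?q k *\<^sub>R pw x k)"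
        using lt by (intro pp_sum) (simp add: degree_prod_linear)
      moreover have "{..?r - 1} = {..<?r}" using rank_pos by auto
      ultimately have "(\<Sum>k<?r. coeff ?q k *\<^sub>R pw x k) = 0" by simp
      then have "coeff ?q (card R) = 0" using ind lt unfolding indep_family_def by blast
      moreover have "coeff ?q (card R) = 1" using degree_prod_linear[of "\<lambda>l. l" R] by simp
      ultimately show False by simp
    qed
  qed
qed

text \<open>On the line from \<open>y\<close> to a regular element the powers are polynomial curves,
  independent at parameter 1 and so at all but finitely many parameters. Those close to 0 give
  regular points in the open cone.\<close>

lemma regular_dense:
  assumes "y \<in> Om"
  shows "\<exists>f. (\<forall>n. f n \<in> Om \<and> jordan_regular m e (f n)) \<and> f \<longlonglongrightarrow> y"
proof -
  obtain x where x: "jordan_regular m e x" using regular_exists by blast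
  define z where "z t = y + t *\<^sub>R (x - y)" for t
  have pc: "poly_curve (\<lambda>t. pw (z t) k)" for k
  proof (induction k)
    case 0
    show ?case unfolding poly_curve_def
    proof
      fix u show "\<exists>P. \<forall>t. pw (z t) 0 \<bullet> u = poly P t" by (intro exI[of _ "[: e \<bullet> u :]"]) simp
    qed
  next
    case (Suc k)
    show ?case unfolding poly_curve_def
    proof
      fix u
      obtain P1 where P1: "\<And>t. pw (z t) k \<bullet> (y \<bowtie> u) = poly P1 t" using Suc by (auto simp: poly_curve_def)
      obtain P2 where P2: "\<And>t. pw (z t) k \<bullet> ((x - y) \<bowtie> u) = poly P2 t" using Suc unfolding poly_curve_def by metis
      have "pw (z t) (Suc k) \<bullet> u = poly P1 t + t * poly P2 t" for t
        by (simp add: z_def assoc_inner P1[symmetric] P2[symmetric]) (simp add: z_def m_linear inner_add_right inner_diff_right algebra_simps)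
      then show "\<exists>P. \<forall>t. pw (z t) (Suc k) \<bullet> u = poly P t"
        by (intro exI[of _ "P1 + [:0, 1:] * P2"]) simp
    qed
  qed
  have "z 1 = x" by (simp add: z_def)
  then have ind: "indep_family (\<lambda>k. pw (z 1) k) (jordan_rank m e)" using x regular_indep by simp
  have fin: "finite {t. \<not> indep_family (\<lambda>k. pw (z t) k) (jordan_rank m e)}" (is "finite ?N")
    by (rule finite_dependent[of _ "\<lambda>k t. pw (z t) k", OF pc ind])
  then have "eventually (\<lambda>t. t \<notin> ?N) (at 0)"
    using islimpt_finite[OF fin, of 0] unfolding islimpt_iff_eventually by (simp add: not_frequently eventually_mono) 
  moreover have "((\<lambda>t. z t) \<longlongrightarrow> y) (at 0)" unfolding z_def by (rule tendsto_eq_intros refl | simp)+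
  then have "eventually (\<lambda>t. z t \<in> Om) (at 0)" using open_Om assms by (rule topological_tendstoD)
  ultimately have ev: "eventually (\<lambda>t. z t \<in> Om \<and> jordan_regular m e (z t)) (at 0)"
    by eventually_elim (simp add: regular_indep)
  then obtain d where d: "d > 0" "\<And>t. t \<noteq> 0 \<Longrightarrow> \<bar>t\<bar> < d \<Longrightarrow> z t \<in> Om \<and> jordan_regular m e (z t)"
    unfolding eventually_at by (auto simp: dist_real_def)
  define s where "s n = d / real (Suc (Suc n))" for n
  have s: "s n \<noteq> 0" "\<bar>s n\<bar> < d" for n using d(1) by (auto simp: s_def field_simps add_pos_nonneg)
  have "s \<longlonglongrightarrow> 0" unfolding s_def by (intro LIMSEQ_Suc lim_const_over_n)
  then have "(\<lambda>n. z (s n)) \<longlonglongrightarrow> y" unfolding z_def by (auto intro!: tendsto_eq_intros)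
  then show ?thesis using d(2)[OF s] by (intro exI[of _ "\<lambda>n. z (s n)"]) auto
qed

end

section \<open>Fourier transforms\<close>

lemma lborel_integral_prod:
  fixes f :: "'a::euclidean_space \<Rightarrow> real \<Rightarrow> complex"
  assumes "\<And>b. b \<in> Basis \<Longrightarrow> integrable lborel (f b)"
  shows "integrable lborel (\<lambda>x::'a. \<Prod>b\<in>Basis. f b (x \<bullet> b))"
    and "(LINT x|lborel. (\<Prod>b\<in>Basis. f b (x \<bullet> b))) = (\<Prod>b\<in>Basis. LINT t|lborel. f b t)"
proof -
  interpret product_sigma_finite "\<lambda>_::'a. lborel :: real measure" by standard
  have [measurable]: "f b \<in> borel_measurable borel" if "b \<in> Basis" for b using assms[OF that] by simp
  have m: "(\<lambda>x::'a. \<Prod>b\<in>Basis. f b (x \<bullet> b)) \<in> borel_measurable borel"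
    by (intro borel_measurable_prod) measurable
  have c: "(\<Sum>b\<in>Basis. x b *\<^sub>R b) \<bullet> k = x k" if "k \<in> Basis" for k :: 'a and x
    using that by (rule inner_sum_left_Basis)
  have e: "(\<Prod>b\<in>Basis. f b ((\<Sum>b\<in>Basis. x b *\<^sub>R b) \<bullet> b)) = (\<Prod>b\<in>Basis. f b (x b))" for x
    by (intro prod.cong refl) (simp add: c)
  have g: "(\<lambda>x. \<Sum>b\<in>Basis. x b *\<^sub>R b :: 'a) \<in> measurable (Pi\<^sub>M Basis (\<lambda>_. lborel)) borel" by measurable
  show "integrable lborel (\<lambda>x::'a. \<Prod>b\<in>Basis. f b (x \<bullet> b))"
    unfolding lborel_eq[where 'a='a] by (subst integrable_distr_eq[OF g]) (use m in \<open>auto simp: e intro: product_integrable_prod assms\<close>)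
  show "(LINT x|lborel. (\<Prod>b\<in>Basis. f b ((x::'a) \<bullet> b))) = (\<Prod>b\<in>Basis. LINT t|lborel. f b t)"
    unfolding lborel_eq[where 'a='a] by (subst integral_distr[OF g]) (use m in \<open>auto simp: e intro: product_integral_prod assms\<close>)
qed

lemma cis_sum: "finite I \<Longrightarrow> cis (\<Sum>i\<in>I. f i) = (\<Prod>i\<in>I. cis (f i))"
  by (induction I rule: finite_induct) (auto simp: cis_mult[symmetric])

text \<open>The characteristic function of the standard normal distribution, rescaled by
  \<open>sqrt \<epsilon>\<close>.\<close>

lemma gauss_1d:
  fixes \<epsilon> t :: real
  assumes "\<epsilon> > 0"
  shows "integrable lborel (\<lambda>s. complex_of_real (exp (- \<epsilon> * s\<^sup>2 / 2)) * cis (t * s))"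
    and "(LINT s|lborel. complex_of_real (exp (- \<epsilon> * s\<^sup>2 / 2)) * cis (t * s)) = complex_of_real (sqrt (2 * pi / \<epsilon>) * exp (- t\<^sup>2 / (2 * \<epsilon>)))"
proof -
  define k where "k = sqrt \<epsilon>"
  have k: "k > 0" "k\<^sup>2 = \<epsilon>" using assms by (auto simp: k_def)
  let ?F = "\<lambda>u. std_normal_density u *\<^sub>R iexp ((t / k) * u)"
  have "integrable std_normal_distribution (\<lambda>u. iexp ((t / k) * u))"
    using prob_space.integrable_iexp[OF prob_space_normal_density[of 1 0], of "\<lambda>u. complex_of_real ((t / k) * u)"] by simp
  then have int: "integrable lborel ?F"
    by (subst (asm) integrable_density) (auto simp: normal_density_nonneg)
  have "char std_normal_distribution (t / k) = (LINT u|lborel. ?F u)"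
    unfolding char_def by (subst integral_density) (auto simp: normal_density_nonneg)
  then have "(LINT u|lborel. ?F u) = complex_of_real (exp (- ((t / k)\<^sup>2) / 2))"
    unfolding char_std_normal_distribution by (rule sym)
  also have "- ((t / k)\<^sup>2) / 2 = - (t\<^sup>2) / (2 * \<epsilon>)" using k by (simp add: power_divide)
  finally have val: "(LINT u|lborel. ?F u) = complex_of_real (exp (- (t\<^sup>2) / (2 * \<epsilon>)))" .
  have eq: "complex_of_real (exp (- \<epsilon> * s\<^sup>2 / 2)) * cis (t * s) = sqrt (2 * pi) *\<^sub>R ?F (0 + k * s)" for s
    using k by (simp add: std_normal_density_def scaleR_conv_of_real cis_conv_exp power_mult_distrib)
  show "integrable lborel (\<lambda>s. complex_of_real (exp (- \<epsilon> * s\<^sup>2 / 2)) * cis (t * s))"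
    unfolding eq using lborel_integrable_real_affine[OF int, of k 0] k by (intro integrable_scaleR_right) auto
  have "(LINT u|lborel. ?F u) = \<bar>k\<bar> *\<^sub>R (LINT s|lborel. ?F (0 + k * s))"
    by (rule lborel_integral_real_affine) (use k in auto)
  then have "(LINT s|lborel. ?F (0 + k * s)) = (1 / k) *\<^sub>R complex_of_real (exp (- (t\<^sup>2) / (2 * \<epsilon>)))"
    using val k by (simp add: scaleR_conv_of_real field_simps)
  moreover have "sqrt (2 * pi) / k = sqrt (2 * pi / \<epsilon>)" by (simp add: k_def real_sqrt_divide)
  ultimately show "(LINT s|lborel. complex_of_real (exp (- \<epsilon> * s\<^sup>2 / 2)) * cis (t * s)) = complex_of_real (sqrt (2 * pi / \<epsilon>) * exp (- t\<^sup>2 / (2 * \<epsilon>)))"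
    unfolding eq by (simp add: scaleR_conv_of_real) (metis of_real_divide of_real_mult times_divide_eq_left)
qed

definition gauss :: "real \<Rightarrow> 'a::euclidean_space \<Rightarrow> real" where
  "gauss \<epsilon> x = exp (- \<epsilon> * (norm x)\<^sup>2 / 2)"

text \<open>The Fourier transform of \<open>gauss \<epsilon>\<close> in the normalization without
  constants. Its mass is \<open>(2 * pi) ^ DIM('a)\<close> for every \<epsilon>, the origin of the
  constants in Plancherel's inequality and in the inversion formula.\<close>

definition gauss_hat :: "real \<Rightarrow> 'a::euclidean_space \<Rightarrow> real" where
  "gauss_hat \<epsilon> x = sqrt (2 * pi / \<epsilon>) ^ DIM('a) * exp (- (norm x)\<^sup>2 / (2 * \<epsilon>))"

lemma gauss_fourier:
  fixes x :: "'a::euclidean_space"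
  assumes "\<epsilon> > 0"
  shows "integrable lborel (\<lambda>\<xi>::'a. complex_of_real (gauss \<epsilon> \<xi>) * cis (x \<bullet> \<xi>))"
    and "(LINT \<xi>|lborel. complex_of_real (gauss \<epsilon> \<xi>) * cis (x \<bullet> \<xi>)) = complex_of_real (gauss_hat \<epsilon> x)"
proof -
  have n: "(norm y)\<^sup>2 = (\<Sum>b\<in>Basis. (y \<bullet> b)\<^sup>2)" for y :: 'a
    unfolding power2_norm_eq_inner by (subst euclidean_inner) (simp add: power2_eq_square)
  have eq: "complex_of_real (gauss \<epsilon> \<xi>) * cis (x \<bullet> \<xi>) =
     (\<Prod>b\<in>Basis. complex_of_real (exp (- \<epsilon> * (\<xi> \<bullet> b)\<^sup>2 / 2)) * cis ((x \<bullet> b) * (\<xi> \<bullet> b)))" for \<xi> :: 'a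
  proof -
    have "gauss \<epsilon> \<xi> = (\<Prod>b\<in>Basis. exp (- \<epsilon> * (\<xi> \<bullet> b)\<^sup>2 / 2))"
      by (simp add: gauss_def n exp_sum[symmetric] sum_distrib_left sum_negf sum_divide_distrib)
    moreover have "cis (x \<bullet> \<xi>) = (\<Prod>b\<in>Basis. cis ((x \<bullet> b) * (\<xi> \<bullet> b)))"
      by (simp add: euclidean_inner[of x \<xi>] cis_sum)
    ultimately show ?thesis by (simp add: prod.distrib)
  qed
  show "integrable lborel (\<lambda>\<xi>::'a. complex_of_real (gauss \<epsilon> \<xi>) * cis (x \<bullet> \<xi>))"
    unfolding eq by (rule lborel_integral_prod) (rule gauss_1d[OF assms])
  have "(LINT \<xi>|lborel. complex_of_real (gauss \<epsilon> \<xi>) * cis (x \<bullet> \<xi>)) = 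
     (\<Prod>b\<in>(Basis::'a set). complex_of_real (sqrt (2 * pi / \<epsilon>) * exp (- (x \<bullet> b)\<^sup>2 / (2 * \<epsilon>))))"
    unfolding eq by (rule trans[OF lborel_integral_prod(2)[OF gauss_1d(1)[OF assms]] prod.cong[OF refl gauss_1d(2)[OF assms]]])
  also have "\<dots> = complex_of_real (gauss_hat \<epsilon> x)"
    by (simp add: gauss_hat_def n prod.distrib exp_sum[symmetric] sum_negf sum_divide_distrib flip: of_real_prod of_real_power)
  finally show "(LINT \<xi>|lborel. complex_of_real (gauss \<epsilon> \<xi>) * cis (x \<bullet> \<xi>)) = complex_of_real (gauss_hat \<epsilon> x)" .
qed

lemma gauss_measurable [measurable]: "gauss \<epsilon> \<in> borel_measurable borel" "gauss_hat \<epsilon> \<in> borel_measurable borel"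
  unfolding gauss_def[abs_def] gauss_hat_def[abs_def] by measurable

lemma gauss_nonneg: "gauss \<epsilon> x \<ge> 0" "\<epsilon> > 0 \<Longrightarrow> gauss_hat \<epsilon> x \<ge> 0"
  by (auto simp: gauss_def gauss_hat_def)

lemma gauss_integrable:
  assumes "\<epsilon> > 0"
  shows "integrable lborel (gauss \<epsilon> :: 'a::euclidean_space \<Rightarrow> real)"
    and "(LINT x|lborel. gauss \<epsilon> (x::'a)) = sqrt (2 * pi / \<epsilon>) ^ DIM('a)"
proof -
  have i: "integrable lborel (\<lambda>\<xi>::'a. complex_of_real (gauss \<epsilon> \<xi>))" 
    "(LINT \<xi>|lborel. complex_of_real (gauss \<epsilon> (\<xi>::'a))) = complex_of_real (gauss_hat \<epsilon> (0::'a))"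
    using gauss_fourier[OF assms, of "0::'a"] by auto
  then show "integrable lborel (gauss \<epsilon> :: 'a \<Rightarrow> real)"
    by (simp add: complex_of_real_integrable_eq)
  show "(LINT x|lborel. gauss \<epsilon> (x::'a)) = sqrt (2 * pi / \<epsilon>) ^ DIM('a)"
    using i(2) by (simp add: gauss_hat_def del: of_real_power) 
qed

lemma nn_integral_gauss_hat:
  assumes "\<epsilon> > 0"
  shows "(\<integral>\<^sup>+x. ennreal (gauss_hat \<epsilon> (x::'a::euclidean_space)) \<partial>lborel) = ennreal ((2 * pi) ^ DIM('a))"
proof -
  have "gauss_hat \<epsilon> x = sqrt (2 * pi / \<epsilon>) ^ DIM('a) * gauss (1 / \<epsilon>) x" for x :: 'a
    by (simp add: gauss_hat_def gauss_def field_simps)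
  then have "(\<integral>\<^sup>+x. ennreal (gauss_hat \<epsilon> (x::'a)) \<partial>lborel) = (\<integral>\<^sup>+x. ennreal (sqrt (2 * pi / \<epsilon>) ^ DIM('a) * gauss (1 / \<epsilon>) (x::'a)) \<partial>lborel)"
    by simp
  also have "\<dots> = ennreal (LINT x|lborel. sqrt (2 * pi / \<epsilon>) ^ DIM('a) * gauss (1 / \<epsilon>) (x::'a))"
    using assms gauss_integrable(1)[of "1 / \<epsilon>"] by (intro nn_integral_eq_integral) (auto simp: gauss_nonneg)
  also have "(LINT x|lborel. sqrt (2 * pi / \<epsilon>) ^ DIM('a) * gauss (1 / \<epsilon>) (x::'a)) = (2 * pi) ^ DIM('a)"
  proof -
    have "sqrt (2 * pi / \<epsilon>) * sqrt (2 * pi / (1 / \<epsilon>)) = sqrt ((2 * pi)\<^sup>2)"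
      using assms by (subst real_sqrt_mult[symmetric]) (simp add: power2_eq_square)
    then have "sqrt (2 * pi / \<epsilon>) * sqrt (2 * pi / (1 / \<epsilon>)) = 2 * pi" unfolding real_sqrt_abs by simp
    moreover have "1 / \<epsilon> > 0" using assms by simp
    ultimately show ?thesis
      using gauss_integrable(2)[of "1 / \<epsilon>", where 'a='a] power_mult_distrib[of "sqrt (2 * pi / \<epsilon>)" "sqrt (2 * pi / (1 / \<epsilon>))" "DIM('a)"]
      by (subst integral_mult_right_zero) simp
  qed
  finally show ?thesis .
qed

section \<open>Plancherel's inequality and Fourier inversion\<close>

definition ft :: "('a::euclidean_space \<Rightarrow> complex) \<Rightarrow> 'a \<Rightarrow> complex" where
  "ft h \<xi> = (LINT x|lborel. h x * cis (- (x \<bullet> \<xi>)))"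

lemma cis_measurable [measurable]: "f \<in> borel_measurable M \<Longrightarrow> (\<lambda>x. cis (f x)) \<in> borel_measurable M"
  unfolding cis_conv_exp by measurable

lemma integrable_mult_cis:
  assumes "integrable lborel h" and [measurable]: "f \<in> borel_measurable borel"
  shows "integrable lborel (\<lambda>x::'a::euclidean_space. h x * cis (f x))"
proof -
  have [measurable]: "h \<in> borel_measurable borel" using assms(1) by simp
  have "(\<lambda>x. cis (f x)) \<in> borel_measurable borel" by measurable
  then show ?thesis
    by (intro Bochner_Integration.integrable_bound[OF assms(1)]) (auto simp: norm_mult)
qed

lemma ft_measurable [measurable]:
  assumes [measurable]: "h \<in> borel_measurable borel"
  shows "ft h \<in> borel_measurable borel"
  unfolding ft_def[abs_def] by measurable

lemma ft_bound: "norm (ft h \<xi>) \<le> (LINT x|lborel. norm (h x))"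
  unfolding ft_def using integral_norm_bound[of lborel "\<lambda>x. h x * cis (- (x \<bullet> \<xi>))"] by (simp add: norm_mult)

lemma integrable_pair_mult:
  fixes f :: "'a::euclidean_space \<Rightarrow> complex" and g :: "'b::euclidean_space \<Rightarrow> complex"
  assumes "integrable lborel f" "integrable lborel g"
  shows "integrable (lborel \<Otimes>\<^sub>M lborel) (\<lambda>(x, y). f x * g y)"
proof -
  have [measurable]: "f \<in> borel_measurable borel" "g \<in> borel_measurable borel" using assms by simp_all
  show ?thesis
  proof (rule lborel_pair.Fubini_integrable)
    show "(\<lambda>(x, y). f x * g y) \<in> borel_measurable (lborel \<Otimes>\<^sub>M lborel)" by measurable
    show "integrable lborel (\<lambda>x. LINT y|lborel. norm (case (x, y) of (x, y) \<Rightarrow> f x * g y))"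
      using assms by (simp add: norm_mult)
    show "AE x in lborel. integrable lborel (\<lambda>y. case (x, y) of (x, y) \<Rightarrow> f x * g y)"
      using assms by simp
  qed
qed

text \<open>The Gaussian makes the triple integral absolutely convergent, and integrating over \<xi>
  leaves the kernel \<open>gauss_hat \<epsilon> (y - x)\<close>. Its mass in either variable does
  not depend on \<epsilon>, so bounding the product of two values of \<open>h\<close> by half the
  sum of their squares suffices.\<close>

lemma plancherel_gauss:
  fixes h :: "'a::euclidean_space \<Rightarrow> complex"
  assumes h: "integrable lborel h" and "\<epsilon> > 0"
  shows "(\<integral>\<^sup>+\<xi>. ennreal ((norm (ft h \<xi>))\<^sup>2 * gauss \<epsilon> \<xi>) \<partial>lborel) \<le> ennreal ((2 * pi) ^ DIM('a)) * (\<integral>\<^sup>+x. ennreal ((norm (h x))\<^sup>2) \<partial>lborel)"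
proof -
  have hm[measurable]: "h \<in> borel_measurable borel" using h by simp
  have hc: "integrable lborel (\<lambda>y. cnj (h y))" using h by simp
  define H where "H = (\<lambda>(x, y). h x * cnj (h y))"
  have Hi: "integrable (lborel :: ('a \<times> 'a) measure) H" 
    unfolding H_def lborel_prod[symmetric] by (rule integrable_pair_mult[OF h hc])
  have Hm[measurable]: "H \<in> borel_measurable (borel \<Otimes>\<^sub>M borel)" unfolding borel_prod using Hi by simp
  have sq: "complex_of_real ((norm (ft h \<xi>))\<^sup>2) = (LINT p|lborel. H p * cis ((snd p - fst p) \<bullet> \<xi>))" for \<xi>
  proof -
    have cd: "cis ((b - a) \<bullet> \<xi>) = cis (- (a \<bullet> \<xi>)) * cis (b \<bullet> \<xi>)" for a b
      by (simp add: cis_mult inner_diff_left)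
    have i1: "integrable lborel (\<lambda>x. h x * cis (- (x \<bullet> \<xi>)))" by (rule integrable_mult_cis[OF h]) measurable
    have i2: "integrable lborel (\<lambda>y. cnj (h y) * cis (y \<bullet> \<xi>))" by (rule integrable_mult_cis[OF hc]) measurable
    have "cnj (ft h \<xi>) = (LINT y|lborel. cnj (h y * cis (- (y \<bullet> \<xi>))))"
      unfolding ft_def by (rule Bochner_Integration.integral_cnj[symmetric])
    then have "complex_of_real ((norm (ft h \<xi>))\<^sup>2) = ft h \<xi> * (LINT y|lborel. cnj (h y) * cis (y \<bullet> \<xi>))"
      by (subst complex_norm_square) (simp add: cis_cnj)
    also have "\<dots> = (LINT x|lborel. LINT y|lborel. (h x * cis (- (x \<bullet> \<xi>))) * (cnj (h y) * cis (y \<bullet> \<xi>)))"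
      unfolding ft_def by simp
    also have "\<dots> = (LINT p|(lborel \<Otimes>\<^sub>M lborel). (case p of (x, y) \<Rightarrow> (h x * cis (- (x \<bullet> \<xi>))) * (cnj (h y) * cis (y \<bullet> \<xi>))))"
      using lborel_pair.integral_fst'[OF integrable_pair_mult[OF i1 i2]] by simp
    also have "\<dots> = (LINT p|lborel. H p * cis ((snd p - fst p) \<bullet> \<xi>))"
      unfolding lborel_prod by (intro Bochner_Integration.integral_cong) (auto simp: H_def cd)
    finally show ?thesis .
  qed
  let ?G = "\<lambda>(\<xi>, p). (H p * cis ((snd p - fst p) \<bullet> \<xi>)) * complex_of_real (gauss \<epsilon> \<xi>)"
  have Gm: "?G \<in> borel_measurable (borel :: ('a \<times> 'a \<times> 'a) measure)"
    unfolding borel_prod[symmetric] by measurable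
  have gi: "integrable lborel (\<lambda>\<xi>::'a. complex_of_real (gauss \<epsilon> \<xi>))"
    using gauss_integrable(1)[OF assms(2), where 'a='a] by (simp only: complex_of_real_integrable_eq)
  have Gi: "integrable (lborel \<Otimes>\<^sub>M lborel) ?G"
    using Gm by (intro Bochner_Integration.integrable_bound[OF integrable_pair_mult[OF gi Hi]])
       (auto simp: norm_mult lborel_prod)
  have nn: "(norm (ft h \<xi>))\<^sup>2 * gauss \<epsilon> \<xi> \<ge> 0" for \<xi> by (simp add: gauss_nonneg)
  have Li: "integrable lborel (\<lambda>\<xi>. (norm (ft h \<xi>))\<^sup>2 * gauss \<epsilon> \<xi>)"
  proof (rule Bochner_Integration.integrable_bound)
    show "integrable lborel (\<lambda>\<xi>::'a. (LINT x|lborel. norm (h x))\<^sup>2 * gauss \<epsilon> \<xi>)" using gauss_integrable(1)[OF assms(2), where 'a='a] by simp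
    show "AE \<xi> in lborel. norm ((norm (ft h \<xi>))\<^sup>2 * gauss \<epsilon> \<xi>) \<le> norm ((LINT x|lborel. norm (h x))\<^sup>2 * gauss \<epsilon> \<xi>)"
      using ft_bound[of h] by (intro AE_I2) (auto simp: gauss_nonneg norm_mult intro!: mult_right_mono power_mono)
  qed simp
  have "complex_of_real (LINT \<xi>|lborel. (norm (ft h \<xi>))\<^sup>2 * gauss \<epsilon> \<xi>) = (LINT \<xi>|lborel. complex_of_real ((norm (ft h \<xi>))\<^sup>2) * complex_of_real (gauss \<epsilon> \<xi>))"
    by (subst of_real_mult[symmetric], rule integral_complex_of_real[symmetric])
  also have "\<dots> = (LINT \<xi>|lborel. LINT p|lborel. ?G (\<xi>, p))"
    unfolding sq by simp
  also have "\<dots> = (LINT p|lborel. LINT \<xi>|lborel. ?G (\<xi>, p))"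
    using lborel_pair.Fubini_integral[of "\<lambda>\<xi> p. ?G (\<xi>, p)"] Gi by (simp add: split_beta')
  also have "\<dots> = (LINT p|lborel. H p * complex_of_real (gauss_hat \<epsilon> (snd p - fst p)))"
  proof (rule Bochner_Integration.integral_cong[OF refl])
    fix p :: "'a \<times> 'a"
    have "(LINT \<xi>|lborel. ?G (\<xi>, p)) = (LINT \<xi>|lborel. H p * (complex_of_real (gauss \<epsilon> \<xi>) * cis ((snd p - fst p) \<bullet> \<xi>)))"
      by (simp add: mult_ac)
    also have "\<dots> = H p * complex_of_real (gauss_hat \<epsilon> (snd p - fst p))"
      by (subst integral_mult_right_zero) (simp add: gauss_fourier[OF assms(2)])
    finally show "(LINT \<xi>|lborel. ?G (\<xi>, p)) = H p * complex_of_real (gauss_hat \<epsilon> (snd p - fst p))" .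
  qed
  finally have main: "(LINT \<xi>|lborel. (norm (ft h \<xi>))\<^sup>2 * gauss \<epsilon> \<xi>) = norm (LINT p|lborel. H p * complex_of_real (gauss_hat \<epsilon> (snd p - fst p)))"
    using nn by (metis (mono_tags, lifting) Bochner_Integration.integral_nonneg abs_of_nonneg norm_of_real)
  have m1: "(\<lambda>p. ennreal ((norm (h (fst p)))\<^sup>2 / 2) * ennreal (gauss_hat \<epsilon> (snd p - fst p))) \<in> borel_measurable (lborel \<Otimes>\<^sub>M lborel)"
    by measurable
  have m2: "(\<lambda>p. ennreal ((norm (h (snd p)))\<^sup>2 / 2) * ennreal (gauss_hat \<epsilon> (snd p - fst p))) \<in> borel_measurable (lborel \<Otimes>\<^sub>M lborel)"
    by measurable
  have "(\<integral>\<^sup>+\<xi>. ennreal ((norm (ft h \<xi>))\<^sup>2 * gauss \<epsilon> \<xi>) \<partial>lborel) = ennreal (LINT \<xi>|lborel. (norm (ft h \<xi>))\<^sup>2 * gauss \<epsilon> \<xi>)"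
    by (rule nn_integral_eq_integral[OF Li]) (simp add: nn)
  also have "\<dots> \<le> (\<integral>\<^sup>+p. ennreal (norm (H p * complex_of_real (gauss_hat \<epsilon> (snd p - fst p)))) \<partial>lborel)"
  \<comment> \<open>A function that is not integrable has integral 0, for which the bound holds
    too.\<close>
  proof (cases "integrable lborel (\<lambda>p. H p * complex_of_real (gauss_hat \<epsilon> (snd p - fst p)))")
    case True
    then show ?thesis unfolding main by (rule integral_norm_bound_ennreal)
  next
    case False
    then show ?thesis unfolding main by (simp add: not_integrable_integral_eq)
  qed
  also have "\<dots> = (\<integral>\<^sup>+p. ennreal (norm (h (fst p)) * norm (h (snd p)) * gauss_hat \<epsilon> (snd p - fst p)) \<partial>lborel)"
    using assms(2) by (intro nn_integral_cong) (auto simp: H_def norm_mult gauss_nonneg)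
  also have "\<dots> \<le> (\<integral>\<^sup>+p. ennreal ((norm (h (fst p)))\<^sup>2 / 2) * ennreal (gauss_hat \<epsilon> (snd p - fst p)) + ennreal ((norm (h (snd p)))\<^sup>2 / 2) * ennreal (gauss_hat \<epsilon> (snd p - fst p)) \<partial>lborel)"
  proof (rule nn_integral_mono)
    fix p :: "'a \<times> 'a"
    let ?a = "norm (h (fst p))" and ?b = "norm (h (snd p))" and ?g = "gauss_hat \<epsilon> (snd p - fst p)"
    have "?a * ?b \<le> ?a\<^sup>2 / 2 + ?b\<^sup>2 / 2" using sum_squares_bound[of ?a ?b] by simp
    then have "?a * ?b * ?g \<le> (?a\<^sup>2 / 2 + ?b\<^sup>2 / 2) * ?g" using assms(2) by (intro mult_right_mono gauss_nonneg)
    then show "ennreal (?a * ?b * ?g) \<le> ennreal (?a\<^sup>2 / 2) * ennreal ?g + ennreal (?b\<^sup>2 / 2) * ennreal ?g"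
      using gauss_nonneg(2)[OF assms(2), of "snd p - fst p"]
      by (simp add: ennreal_mult[symmetric] ennreal_plus[symmetric] distrib_right ennreal_leI del: ennreal_plus)
  qed
  also have "\<dots> = (\<integral>\<^sup>+p. ennreal ((norm (h (fst p)))\<^sup>2 / 2) * ennreal (gauss_hat \<epsilon> (snd p - fst p)) \<partial>lborel)
     + (\<integral>\<^sup>+p. ennreal ((norm (h (snd p)))\<^sup>2 / 2) * ennreal (gauss_hat \<epsilon> (snd p - fst p)) \<partial>lborel)"
    unfolding lborel_prod[symmetric] by (rule nn_integral_add) measurable
  also have "(\<integral>\<^sup>+p. ennreal ((norm (h (fst p)))\<^sup>2 / 2) * ennreal (gauss_hat \<epsilon> (snd p - fst p)) \<partial>lborel) 
    = (\<integral>\<^sup>+x. (\<integral>\<^sup>+y. ennreal ((norm (h x))\<^sup>2 / 2) * ennreal (gauss_hat \<epsilon> (y - x)) \<partial>lborel) \<partial>lborel)"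
    unfolding lborel_prod[symmetric] by (subst lborel.nn_integral_fst[symmetric, OF m1]) simp
  also have "\<dots> = (\<integral>\<^sup>+x. ennreal ((norm (h x))\<^sup>2 / 2) * ennreal ((2 * pi) ^ DIM('a)) \<partial>lborel)"
  proof (rule nn_integral_cong)
    fix x :: 'a
    have "(\<integral>\<^sup>+y. ennreal (gauss_hat \<epsilon> (y - x)) \<partial>lborel) = (\<integral>\<^sup>+y. ennreal (gauss_hat \<epsilon> (y - x)) \<partial>distr lborel borel ((+) x))"
      by (simp add: lborel_distr_plus)
    also have "\<dots> = ennreal ((2 * pi) ^ DIM('a))"
      by (subst nn_integral_distr) (simp_all add: nn_integral_gauss_hat[OF assms(2)])
    finally show "(\<integral>\<^sup>+y. ennreal ((norm (h x))\<^sup>2 / 2) * ennreal (gauss_hat \<epsilon> (y - x)) \<partial>lborel) = ennreal ((norm (h x))\<^sup>2 / 2) * ennreal ((2 * pi) ^ DIM('a))"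
      by (simp add: nn_integral_cmult)
  qed
  also have "(\<integral>\<^sup>+p. ennreal ((norm (h (snd p)))\<^sup>2 / 2) * ennreal (gauss_hat \<epsilon> (snd p - fst p)) \<partial>lborel) 
    = (\<integral>\<^sup>+y. (\<integral>\<^sup>+x. ennreal ((norm (h y))\<^sup>2 / 2) * ennreal (gauss_hat \<epsilon> (y - x)) \<partial>lborel) \<partial>lborel)"
    unfolding lborel_prod[symmetric] by (subst lborel_pair.nn_integral_snd[symmetric, OF m2]) simp
  also have "\<dots> = (\<integral>\<^sup>+x. ennreal ((norm (h x))\<^sup>2 / 2) * ennreal ((2 * pi) ^ DIM('a)) \<partial>lborel)"
  proof (rule nn_integral_cong)
    fix y :: 'a
    have "(\<integral>\<^sup>+x. ennreal (gauss_hat \<epsilon> (y - x)) \<partial>lborel) = (\<integral>\<^sup>+x. ennreal (gauss_hat \<epsilon> (x - y)) \<partial>lborel)"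
      by (simp add: gauss_hat_def norm_minus_commute)
    also have "\<dots> = (\<integral>\<^sup>+x. ennreal (gauss_hat \<epsilon> (x - y)) \<partial>distr lborel borel ((+) y))"
      by (simp add: lborel_distr_plus)
    also have "\<dots> = ennreal ((2 * pi) ^ DIM('a))"
      by (subst nn_integral_distr) (simp_all add: nn_integral_gauss_hat[OF assms(2)])
    finally show "(\<integral>\<^sup>+x. ennreal ((norm (h y))\<^sup>2 / 2) * ennreal (gauss_hat \<epsilon> (y - x)) \<partial>lborel) = ennreal ((norm (h y))\<^sup>2 / 2) * ennreal ((2 * pi) ^ DIM('a))"
      by (simp add: nn_integral_cmult)
  qed
  also have "(\<integral>\<^sup>+x. ennreal ((norm (h x))\<^sup>2 / 2) * ennreal ((2 * pi) ^ DIM('a)) \<partial>lborel) + (\<integral>\<^sup>+x. ennreal ((norm (h x))\<^sup>2 / 2) * ennreal ((2 * pi) ^ DIM('a)) \<partial>lborel)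
     = (\<integral>\<^sup>+x. ennreal ((2 * pi) ^ DIM('a)) * ennreal ((norm (h x))\<^sup>2) \<partial>lborel)"
    by (subst nn_integral_add[symmetric]) (auto intro!: nn_integral_cong simp: ennreal_mult[symmetric] ennreal_plus[symmetric] simp del: ennreal_plus)
  also have "\<dots> = ennreal ((2 * pi) ^ DIM('a)) * (\<integral>\<^sup>+x. ennreal ((norm (h x))\<^sup>2) \<partial>lborel)"
    by (rule nn_integral_cmult) measurable
  finally show ?thesis .
qed

text \<open>The parameter is a square so that its root, the width of the kernel in the inversion
  formula, is \<open>1 / real (Suc k)\<close>.\<close>

lemma tendsto_gauss: "(\<lambda>k. gauss (1 / (real (Suc k))\<^sup>2) x) \<longlonglongrightarrow> 1"
proof -
  have "(\<lambda>k. 1 / (real (Suc k))\<^sup>2) \<longlonglongrightarrow> 0" by real_asymp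
  then have "(\<lambda>k. exp (- (1 / (real (Suc k))\<^sup>2) * (norm x)\<^sup>2 / 2)) \<longlonglongrightarrow> exp (- 0 * (norm x)\<^sup>2 / 2)"
    by (intro tendsto_intros) auto
  then show ?thesis by (simp add: gauss_def)
qed

lemma plancherel_le:
  fixes h :: "'a::euclidean_space \<Rightarrow> complex"
  assumes h: "integrable lborel h"
  shows "(\<integral>\<^sup>+\<xi>. ennreal ((norm (ft h \<xi>))\<^sup>2) \<partial>lborel) \<le> ennreal ((2 * pi) ^ DIM('a)) * (\<integral>\<^sup>+x. ennreal ((norm (h x))\<^sup>2) \<partial>lborel)"
proof -
  have [measurable]: "h \<in> borel_measurable borel" using h by simp
  let ?f = "\<lambda>k \<xi>. ennreal ((norm (ft h \<xi>))\<^sup>2 * gauss (1 / (real (Suc k))\<^sup>2) \<xi>)"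
  have "(\<lambda>k. ?f k \<xi>) \<longlonglongrightarrow> ennreal ((norm (ft h \<xi>))\<^sup>2 * 1)" for \<xi>
    by (intro tendsto_ennrealI tendsto_mult tendsto_const tendsto_gauss)
  then have "liminf (\<lambda>k. ?f k \<xi>) = ennreal ((norm (ft h \<xi>))\<^sup>2 * 1)" for \<xi>
    by (rule lim_imp_Liminf[OF sequentially_bot])
  then have "(\<integral>\<^sup>+\<xi>. ennreal ((norm (ft h \<xi>))\<^sup>2) \<partial>lborel) = (\<integral>\<^sup>+\<xi>. liminf (\<lambda>k. ?f k \<xi>) \<partial>lborel)"
    by simp
  also have "\<dots> \<le> liminf (\<lambda>k. \<integral>\<^sup>+\<xi>. ?f k \<xi> \<partial>lborel)"
    by (rule nn_integral_liminf) measurable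
  also have "\<dots> \<le> ennreal ((2 * pi) ^ DIM('a)) * (\<integral>\<^sup>+x. ennreal ((norm (h x))\<^sup>2) \<partial>lborel)"
    by (rule order_trans[OF Liminf_le_Limsup[OF sequentially_bot] Limsup_bounded])
       (rule always_eventually, rule allI, rule plancherel_gauss[OF h], simp)
  finally show ?thesis .
qed

lemma lborel_integral_affine:
  fixes f :: "'a::euclidean_space \<Rightarrow> complex"
  assumes [measurable]: "f \<in> borel_measurable borel" and c: "c \<noteq> 0"
  shows "(LINT x|lborel. f x) = (LINT x|lborel. \<bar>c\<bar> ^ DIM('a) *\<^sub>R f (t + c *\<^sub>R x))"
proof -
  have "(LINT x|lborel. f x) = (LINT x|density (distr lborel borel (\<lambda>x. t + c *\<^sub>R x)) (\<lambda>_. \<bar>c\<bar> ^ DIM('a)). f x)"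
    by (subst lborel_affine[OF c, of t]) simp
  also have "\<dots> = (LINT x|lborel. \<bar>c\<bar> ^ DIM('a) *\<^sub>R f (t + c *\<^sub>R x))"
    by (subst integral_density) (auto simp: integral_distr)
  finally show ?thesis .
qed

text \<open>Gaussian summation: with the Gaussian inserted, Fubini's theorem gives a smoothing of
  \<open>h\<close> around \<open>x\<close>. Both sides converge by dominated convergence, one
  because \<open>ft h\<close> is integrable, the other because \<open>h\<close> is bounded and
  continuous at \<open>x\<close>.\<close>

lemma fourier_inversion:
  fixes h :: "'a::euclidean_space \<Rightarrow> complex"
  assumes h: "integrable lborel h" and bnd: "\<And>x. norm (h x) \<le> M" and cont: "isCont h x" and fi: "integrable lborel (ft h)"
  shows "(LINT \<xi>|lborel. ft h \<xi> * cis (x \<bullet> \<xi>)) = complex_of_real ((2 * pi) ^ DIM('a)) * h x"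
proof -
  have hm[measurable]: "h \<in> borel_measurable borel" using h by simp
  define \<epsilon> where "\<epsilon> k = 1 / (real (Suc k))\<^sup>2" for k
  have \<epsilon>: "\<epsilon> k > 0" for k by (simp add: \<epsilon>_def)
  have eq: "(LINT \<xi>|lborel. (ft h \<xi> * cis (x \<bullet> \<xi>)) * complex_of_real (gauss (\<epsilon> k) \<xi>))
     = (LINT u|lborel. complex_of_real (sqrt (2 * pi) ^ DIM('a) * exp (- (norm u)\<^sup>2 / 2)) * h (x + (- (1 / real (Suc k))) *\<^sub>R u))" for k
  proof -
    let ?G = "\<lambda>(\<xi>, y). (h y * cis ((x - y) \<bullet> \<xi>)) * complex_of_real (gauss (\<epsilon> k) \<xi>)"
    have gi: "integrable lborel (\<lambda>\<xi>::'a. complex_of_real (gauss (\<epsilon> k) \<xi>))"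
      using gauss_integrable(1)[OF \<epsilon>[of k]] by (simp only: complex_of_real_integrable_eq)
    have Gm: "?G \<in> borel_measurable (borel :: ('a \<times> 'a) measure)"
      unfolding borel_prod[symmetric] by measurable
    have Gi: "integrable (lborel \<Otimes>\<^sub>M lborel) ?G"
      using Gm by (intro Bochner_Integration.integrable_bound[OF integrable_pair_mult[OF gi h]])
        (auto simp: norm_mult lborel_prod)
    have "(LINT \<xi>|lborel. (ft h \<xi> * cis (x \<bullet> \<xi>)) * complex_of_real (gauss (\<epsilon> k) \<xi>)) = (LINT \<xi>|lborel. LINT y|lborel. ?G (\<xi>, y))"
    proof (rule Bochner_Integration.integral_cong[OF refl])
      fix \<xi>
      have "ft h \<xi> * cis (x \<bullet> \<xi>) = (LINT y|lborel. (h y * cis (- (y \<bullet> \<xi>))) * cis (x \<bullet> \<xi>))"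
        unfolding ft_def by simp
      also have "\<dots> = (LINT y|lborel. h y * cis ((x - y) \<bullet> \<xi>))"
        by (simp add: mult.assoc cis_mult inner_diff_left)
      finally show "(ft h \<xi> * cis (x \<bullet> \<xi>)) * complex_of_real (gauss (\<epsilon> k) \<xi>) = (LINT y|lborel. ?G (\<xi>, y))" by simp
    qed
    also have "\<dots> = (LINT y|lborel. LINT \<xi>|lborel. ?G (\<xi>, y))"
      using lborel_pair.Fubini_integral[of "\<lambda>\<xi> p. ?G (\<xi>, p)"] Gi by (simp add: split_beta')
    also have "\<dots> = (LINT y|lborel. h y * complex_of_real (gauss_hat (\<epsilon> k) (x - y)))"
    proof (rule Bochner_Integration.integral_cong[OF refl])
      fix y
      have "(LINT \<xi>|lborel. ?G (\<xi>, y)) = (LINT \<xi>|lborel. h y * (complex_of_real (gauss (\<epsilon> k) \<xi>) * cis ((x - y) \<bullet> \<xi>)))"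
        by (simp add: mult_ac)
      then show "(LINT \<xi>|lborel. ?G (\<xi>, y)) = h y * complex_of_real (gauss_hat (\<epsilon> k) (x - y))"
        by (simp add: integral_mult_right_zero gauss_fourier(2)[OF \<epsilon>] del: of_real_mult)
    qed
    \<comment> \<open>The substitution \<open>y = x - u / (k + 1)\<close> turns the kernels into one
      fixed Gaussian.\<close>
    also have "\<dots> = (LINT u|lborel. \<bar>- (1 / real (Suc k))\<bar> ^ DIM('a) *\<^sub>R (h (x + (- (1 / real (Suc k))) *\<^sub>R u) * complex_of_real (gauss_hat (\<epsilon> k) (x - (x + (- (1 / real (Suc k))) *\<^sub>R u)))))"
    proof (rule lborel_integral_affine)
      show "(\<lambda>y. h y * complex_of_real (gauss_hat (\<epsilon> k) (x - y))) \<in> borel_measurable borel" by measurable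
    qed simp
    also have "\<dots> = (LINT u|lborel. complex_of_real (sqrt (2 * pi) ^ DIM('a) * exp (- (norm u)\<^sup>2 / 2)) * h (x + (- (1 / real (Suc k))) *\<^sub>R u))"
    proof (rule Bochner_Integration.integral_cong[OF refl])
      fix u :: 'a
      define s where "s = real (Suc k)"
      have s: "s > 0" by (simp add: s_def)
      have "(1 / s) ^ DIM('a) * gauss_hat (\<epsilon> k) ((1 / s) *\<^sub>R u) = sqrt (2 * pi) ^ DIM('a) * exp (- (norm u)\<^sup>2 / 2)"
      proof -
        have "sqrt (2 * pi / \<epsilon> k) = sqrt (2 * pi) * s" unfolding \<epsilon>_def s_def by (simp add: real_sqrt_mult)
        moreover have "(norm ((1 / s) *\<^sub>R u))\<^sup>2 / (2 * \<epsilon> k) = (norm u)\<^sup>2 / 2" using s unfolding \<epsilon>_def s_def[symmetric]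
          by (simp add: power_divide)
        ultimately show ?thesis using s unfolding gauss_hat_def by (simp add: power_mult_distrib power_divide)
      qed
      then show "\<bar>- (1 / real (Suc k))\<bar> ^ DIM('a) *\<^sub>R (h (x + (- (1 / real (Suc k))) *\<^sub>R u) * complex_of_real (gauss_hat (\<epsilon> k) (x - (x + (- (1 / real (Suc k))) *\<^sub>R u))))
        = complex_of_real (sqrt (2 * pi) ^ DIM('a) * exp (- (norm u)\<^sup>2 / 2)) * h (x + (- (1 / real (Suc k))) *\<^sub>R u)"
        using s unfolding s_def[symmetric] by (simp add: scaleR_conv_of_real mult_ac flip: of_real_mult of_real_power)
    qed
    finally show ?thesis .
  qed
  have "(\<lambda>k. LINT \<xi>|lborel. (ft h \<xi> * cis (x \<bullet> \<xi>)) * complex_of_real (gauss (\<epsilon> k) \<xi>)) \<longlonglongrightarrow> (LINT \<xi>|lborel. ft h \<xi> * cis (x \<bullet> \<xi>))"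
  proof (rule integral_dominated_convergence)
    show "integrable lborel (\<lambda>\<xi>. norm (ft h \<xi>))" using fi by simp
    have "(\<lambda>k. (ft h \<xi> * cis (x \<bullet> \<xi>)) * complex_of_real (gauss (\<epsilon> k) \<xi>)) \<longlonglongrightarrow> (ft h \<xi> * cis (x \<bullet> \<xi>)) * complex_of_real 1" for \<xi>
      unfolding \<epsilon>_def by (intro tendsto_mult tendsto_const tendsto_of_real tendsto_gauss)
    then show "AE \<xi> in lborel. (\<lambda>k. (ft h \<xi> * cis (x \<bullet> \<xi>)) * complex_of_real (gauss (\<epsilon> k) \<xi>)) \<longlonglongrightarrow> ft h \<xi> * cis (x \<bullet> \<xi>)" by simp
    fix k
    have "gauss (\<epsilon> k) \<xi> \<le> 1" for \<xi> :: 'a using \<epsilon>[of k] by (simp add: gauss_def)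
    then show "AE \<xi> in lborel. norm ((ft h \<xi> * cis (x \<bullet> \<xi>)) * complex_of_real (gauss (\<epsilon> k) \<xi>)) \<le> norm (ft h \<xi>)"
      by (intro AE_I2) (auto simp: norm_mult gauss_nonneg intro!: mult_left_le)
  qed measurable
  moreover have "(\<lambda>k. LINT u|lborel. complex_of_real (sqrt (2 * pi) ^ DIM('a) * exp (- (norm u)\<^sup>2 / 2)) * h (x + (- (1 / real (Suc k))) *\<^sub>R u))
     \<longlonglongrightarrow> (LINT u|lborel. complex_of_real (sqrt (2 * pi) ^ DIM('a) * exp (- (norm (u::'a))\<^sup>2 / 2)) * h x)"
  proof (rule integral_dominated_convergence)
    have g1: "exp (- (norm u)\<^sup>2 / 2) = gauss 1 u" for u :: 'a by (simp add: gauss_def)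
    show "integrable lborel (\<lambda>u::'a. sqrt (2 * pi) ^ DIM('a) * exp (- (norm u)\<^sup>2 / 2) * M)" unfolding g1 using gauss_integrable(1)[of 1, where 'a='a] by simp
    have "(\<lambda>k. x + (- (1 / real (Suc k))) *\<^sub>R u) \<longlonglongrightarrow> x + (- 0) *\<^sub>R u" for u
      by (intro tendsto_intros LIMSEQ_Suc[OF lim_1_over_n])
    then have "(\<lambda>k. h (x + (- (1 / real (Suc k))) *\<^sub>R u)) \<longlonglongrightarrow> h x" for u
      by (intro isCont_tendsto_compose[OF cont]) simp
    then show "AE u in lborel. (\<lambda>k. complex_of_real (sqrt (2 * pi) ^ DIM('a) * exp (- (norm u)\<^sup>2 / 2)) * h (x + (- (1 / real (Suc k))) *\<^sub>R u))
      \<longlonglongrightarrow> complex_of_real (sqrt (2 * pi) ^ DIM('a) * exp (- (norm u)\<^sup>2 / 2)) * h x"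
      by (intro AE_I2 tendsto_mult tendsto_const)
    show "AE u in lborel. norm (complex_of_real (sqrt (2 * pi) ^ DIM('a) * exp (- (norm u)\<^sup>2 / 2)) * h (x + (- (1 / real (Suc k))) *\<^sub>R u)) \<le> sqrt (2 * pi) ^ DIM('a) * exp (- (norm u)\<^sup>2 / 2) * M" for k
      using bnd by (intro AE_I2) (simp add: norm_mult norm_power mult_left_mono)
  qed measurable
  ultimately have "(LINT \<xi>|lborel. ft h \<xi> * cis (x \<bullet> \<xi>)) = (LINT u|lborel. complex_of_real (sqrt (2 * pi) ^ DIM('a) * exp (- (norm (u::'a))\<^sup>2 / 2)) * h x)"
    unfolding eq by (rule LIMSEQ_unique)
  also have "\<dots> = complex_of_real ((2 * pi) ^ DIM('a)) * h x"
  proof -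
    have g1: "exp (- (norm u)\<^sup>2 / 2) = gauss 1 u" for u :: 'a by (simp add: gauss_def)
    have "(LINT u|lborel. complex_of_real (sqrt (2 * pi) ^ DIM('a) * gauss 1 (u::'a)) * h x) = complex_of_real (LINT u|lborel. sqrt (2 * pi) ^ DIM('a) * gauss 1 (u::'a)) * h x"
      by (subst integral_mult_left_zero) (simp only: integral_complex_of_real)
    also have "(LINT u|lborel. sqrt (2 * pi) ^ DIM('a) * gauss 1 (u::'a)) = (2 * pi) ^ DIM('a)"
    proof -
      have "sqrt (2 * pi) ^ DIM('a) * sqrt (2 * pi) ^ DIM('a) = (2 * pi) ^ DIM('a)"
        by (subst power_mult_distrib[symmetric]) simp
      then show ?thesis using gauss_integrable(2)[of 1, where 'a='a] by (subst integral_mult_right_zero) simp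
    qed
    finally show ?thesis unfolding g1 .
  qed
  finally show ?thesis .
qed

section \<open>Point evaluations on tube domains\<close>

lemma complex_point_add: "complex_point (x + u) (y + w) = complex_point x y + complex_point u w"
  by (simp add: complex_point_def vec_eq_iff complex_eq_iff)

lemma complex_point_mult:
  "t *s complex_point u w = complex_point (Re t *\<^sub>R u - Im t *\<^sub>R w) (Re t *\<^sub>R w + Im t *\<^sub>R u)"
  by (simp add: complex_point_def vec_eq_iff complex_eq_iff)

lemma complex_point_eq_iff: "complex_point x y = complex_point u v \<longleftrightarrow> x = u \<and> y = v"
  by (auto simp: complex_point_def vec_eq_iff)

lemma complex_point_in_tube [simp]: "complex_point x y \<in> tube_domain \<Omega> \<longleftrightarrow> y \<in> \<Omega>"
  by (auto simp: tube_domain_def complex_point_eq_iff)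

lemma continuous_complex_point [continuous_intros]:
  assumes "continuous_on S f" "continuous_on S g"
  shows "continuous_on S (\<lambda>t. complex_point (f t) (g t))"
  unfolding complex_point_def Complex_eq using assms by (intro continuous_intros)

lemma holomorphic_multi_on_line:
  fixes F :: "complex^'n \<Rightarrow> complex" and z v :: "complex^'n"
  assumes hol: "holomorphic_multi_on F D" and U: "\<And>t. t \<in> U \<Longrightarrow> z + t *s v \<in> D"
  shows "(\<lambda>t. F (z + t *s v)) holomorphic_on U"
proof (rule holomorphic_onI, unfold field_differentiable_def)
  fix t assume t: "t \<in> U"
  obtain F' where F': "(F has_derivative F') (at (z + t *s v))" "\<And>c v. F' (c *s v) = c * F' v"
    using hol U[OF t] unfolding holomorphic_multi_on_def by blast
  have lin: "bounded_linear (\<lambda>s. s *s v)"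
    by (intro linear_conv_bounded_linear[THEN iffD1] linearI) (auto simp: vec_eq_iff algebra_simps)
  have "((\<lambda>s. z + s *s v) has_derivative (\<lambda>s. s *s v)) (at t within U)"
    using has_derivative_add[OF has_derivative_const bounded_linear_imp_has_derivative[OF lin], of z "at t within U"] by simp
  from has_derivative_compose[OF this F'(1)]
  have "((\<lambda>s. F (z + s *s v)) has_derivative (\<lambda>s. F' (s *s v))) (at t within U)" .
  then have "((\<lambda>s. F (z + s *s v)) has_field_derivative F' v) (at t within U)"
    unfolding has_field_derivative_def by (simp add: F'(2) mult_commute_abs)
  then show "\<exists>f'. ((\<lambda>s. F (z + s *s v)) has_field_derivative f') (at t within U)" by blast
qed

lemma holomorphic_multi_on_continuous:
  assumes "holomorphic_multi_on F D" shows "continuous_on D F"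
  unfolding continuous_on_eq_continuous_within
proof
  fix z assume "z \<in> D"
  then obtain F' where "(F has_derivative F') (at z)" using assms unfolding holomorphic_multi_on_def by blast
  then show "continuous (at z within D) F" using has_derivative_continuous continuous_at_imp_continuous_at_within by blast
qed

lemma tube_continuous:
  assumes "holomorphic_multi_on F (tube_domain \<Omega>)" "continuous_on S f" "continuous_on S g" "\<And>s. s \<in> S \<Longrightarrow> g s \<in> \<Omega>"
  shows "continuous_on S (\<lambda>s. F (complex_point (f s) (g s)))"
  using assms by (intro continuous_on_compose2[OF holomorphic_multi_on_continuous[OF assms(1)]] continuous_complex_point) auto

text \<open>Cauchy's formula at the centre, stated as a bound by an extended integral, so that it
  can be integrated further without any integrability argument.\<close>

lemma circle_mean:
  fixes h :: "complex \<Rightarrow> complex"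
  assumes "h holomorphic_on U" "open U" "cball 0 1 \<subseteq> U"
  shows "ennreal (norm (h 0)) \<le> (\<integral>\<^sup>+t. indicator {0..1} t * ennreal (norm (h (cis (2 * pi * t)))) \<partial>lborel)"
proof -
  have hc: "continuous_on (cball 0 1) h" using assms holomorphic_on_imp_continuous_on continuous_on_subset by blast
  have hh: "h holomorphic_on ball 0 1" using assms ball_subset_cball holomorphic_on_subset by (metis subset_trans)
  have "((\<lambda>u. h u / (u - 0)) has_contour_integral 2 * of_real pi * \<i> * h 0) (circlepath 0 1)"
    by (rule Cauchy_integral_circlepath[OF hc hh]) simp
  then have "((\<lambda>t. h (cis (2 * pi * t)) / cis (2 * pi * t) * (2 * pi * \<i> * cis (2 * pi * t))) has_integral 2 * of_real pi * \<i> * h 0) {0..1}"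
    unfolding has_contour_integral
  proof (rule has_integral_eq[rotated])
    fix t :: real
    have "circlepath 0 1 t = cis (2 * pi * t)" by (simp add: circlepath cis_conv_exp mult_ac)
    moreover have "vector_derivative (circlepath 0 1) (at t) = 2 * pi * \<i> * cis (2 * pi * t)"
      unfolding vector_derivative_circlepath by (simp add: cis_conv_exp mult_ac)
    ultimately show "h (circlepath 0 1 t) / (circlepath 0 1 t - 0) * vector_derivative (circlepath 0 1) (at t)
      = h (cis (2 * pi * t)) / cis (2 * pi * t) * (2 * pi * \<i> * cis (2 * pi * t))" by simp
  qed
  then have "((\<lambda>t. 2 * pi * \<i> * h (cis (2 * pi * t))) has_integral 2 * of_real pi * \<i> * h 0) {0..1}"
    by (elim has_integral_eq[rotated]) simp
  then have "((\<lambda>t. (1 / (2 * pi * \<i>)) * (2 * pi * \<i> * h (cis (2 * pi * t)))) has_integral (1 / (2 * pi * \<i>)) * (2 * of_real pi * \<i> * h 0)) {0..1}"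
    by (rule has_integral_mult_right)
  then have hi: "((\<lambda>t. h (cis (2 * pi * t))) has_integral h 0) {0..1}" by simp
  have cont: "continuous_on {0..1} (\<lambda>t. h (cis (2 * pi * t)))"
    unfolding cis_conv_exp by (intro continuous_on_compose2[OF hc] continuous_intros) (auto simp: norm_mult)
  have si: "set_integrable lborel {0..1} (\<lambda>t. h (cis (2 * pi * t)))"
    using borel_integrable_atLeastAtMost'[OF cont] .
  have "h 0 = (LINT t:{0..1}|lborel. h (cis (2 * pi * t)))"
    using set_borel_integral_eq_integral(2)[OF si] hi by (simp add: integral_unique)
  also have "\<dots> = (LINT t|lborel. indicator {0..1} t *\<^sub>R h (cis (2 * pi * t)))" by (simp add: set_lebesgue_integral_def)
  finally have "ennreal (norm (h 0)) \<le> (\<integral>\<^sup>+t. ennreal (norm (indicator {0..1} t *\<^sub>R h (cis (2 * pi * t)))) \<partial>lborel)"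
    using integral_norm_bound_ennreal[of lborel "\<lambda>t. indicator {0..1} t *\<^sub>R h (cis (2 * pi * t))"] si
    by (simp add: set_integrable_def)
  also have "\<dots> = (\<integral>\<^sup>+t. indicator {0..1} t * ennreal (norm (h (cis (2 * pi * t)))) \<partial>lborel)"
    by (intro nn_integral_cong) (auto simp: indicator_def)
  finally show ?thesis .
qed

text \<open>Multiplication by unit complex numbers rotates the ball in the real space of pairs
  isometrically, so averaging the circle means over the ball gives a mean over the ball. Sliced by
  the imaginary part, this is at most the volume of the ball in one copy times \<open>M\<close>. The
  constant precedes all other quantifiers, as it will be applied to transported functions.\<close>

lemma hardy_point_bound:
  fixes \<rho> :: real
  assumes "\<rho> > 0"
  shows "\<exists>C>0. \<forall>(\<Omega> :: (real^'n) set) F x y M. holomorphic_multi_on F (tube_domain \<Omega>) \<longrightarrow> ball y \<rho> \<subseteq> \<Omega> \<longrightarrow>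
    (\<forall>t\<in>\<Omega>. (\<integral>\<^sup>+x. ennreal ((norm (F (complex_point x t)))\<^sup>2) \<partial>lborel) \<le> M) \<longrightarrow>
    ennreal ((norm (F (complex_point x y)))\<^sup>2) \<le> ennreal C * M"
proof -
  define B where "B = ball (0 :: (real^'n) \<times> (real^'n)) \<rho>"
  define b where "b = emeasure lborel B"
  define v where "v = emeasure lborel (ball (0 :: real^'n) \<rho>)"
  have b: "b > 0" "b < \<infinity>" unfolding b_def B_def using assms emeasure_bounded_finite[OF bounded_ball]
    by (auto intro!: emeasure_lborel_open_pos)
  have v: "v > 0" "v < \<infinity>" unfolding v_def using assms emeasure_bounded_finite[OF bounded_ball]
    by (auto intro!: emeasure_lborel_open_pos)
  define C where "C = enn2real v / enn2real b"
  have bv: "enn2real b > 0" "enn2real v > 0" using b v by (auto simp: enn2real_positive_iff)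
  then have C: "C > 0" "ennreal C = v / b"
    using b v by (auto simp: C_def divide_ennreal[symmetric])
  have "ennreal ((norm (F (complex_point x y)))\<^sup>2) \<le> ennreal C * M"
    if hol: "holomorphic_multi_on F (tube_domain \<Omega>)" and sub: "ball y \<rho> \<subseteq> \<Omega>"
      and M: "\<And>t. t \<in> \<Omega> \<Longrightarrow> (\<integral>\<^sup>+x. ennreal ((norm (F (complex_point x t)))\<^sup>2) \<partial>lborel) \<le> M"
    for \<Omega> :: "(real^'n) set" and F x y M
  proof -
    \<comment> \<open>The indicator confines the integrand to the tube, outside of which
      \<open>F\<close> is arbitrary, and thereby makes it Borel measurable.\<close>
    define \<Phi> where "\<Phi> p = indicator B p * ennreal ((norm (F (complex_point (x + fst p) (y + snd p))))\<^sup>2)" for p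
    have sub': "y + d \<in> \<Omega>" if "norm d < \<rho>" for d
      using that by (intro subsetD[OF sub]) (simp add: dist_norm)
    have Bsnd: "y + snd p \<in> \<Omega>" if "p \<in> B" for p
    proof -
      have "norm (snd p) < \<rho>" using that norm_snd_le[of "snd p" "fst p"] by (simp add: B_def)
      then show ?thesis by (rule sub')
    qed
    have contB: "continuous_on B (\<lambda>p. F (complex_point (x + fst p) (y + snd p)))"
      using Bsnd by (intro tube_continuous[OF hol] continuous_intros) auto
    have "(\<lambda>p. indicator B p *\<^sub>R (norm (F (complex_point (x + fst p) (y + snd p))))\<^sup>2) \<in> borel_measurable borel"
      by (intro borel_measurable_continuous_on_indicator continuous_intros contB) (simp add: B_def)
    then have "(\<lambda>p. ennreal (indicator B p *\<^sub>R (norm (F (complex_point (x + fst p) (y + snd p))))\<^sup>2)) \<in> borel_measurable borel"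
      by measurable
    moreover have "\<Phi> = (\<lambda>p. ennreal (indicator B p *\<^sub>R (norm (F (complex_point (x + fst p) (y + snd p))))\<^sup>2))"
      by (auto simp: \<Phi>_def indicator_def)
    ultimately have \<Phi>m[measurable]: "\<Phi> \<in> borel_measurable borel" by simp
    \<comment> \<open>Multiplication by \<open>cis (2 * pi * t)\<close> in real coordinates.\<close>
    define R where "R t p = (cos (2 * pi * t) *\<^sub>R fst p - sin (2 * pi * t) *\<^sub>R snd p, cos (2 * pi * t) *\<^sub>R snd p + sin (2 * pi * t) *\<^sub>R fst p)" 
      for t and p :: "(real^'n) \<times> (real^'n)"
    have Rlin: "linear (R t)" for t by (auto simp: linear_iff R_def algebra_simps)
    have Rnorm: "norm (R t p) = norm p" for t p
    proof -
      define c s where "c = cos (2 * pi * t)" and "s = sin (2 * pi * t)"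
      have cs: "c * c + s * s = 1" using sin_cos_squared_add3[of "2 * pi * t"] by (simp add: c_def s_def)
      have "R t p \<bullet> R t p = (c * c + s * s) * (fst p \<bullet> fst p + snd p \<bullet> snd p)"
        unfolding R_def c_def[symmetric] s_def[symmetric]
        by (simp add: inner_prod_def inner_diff_left inner_diff_right inner_add_left inner_add_right inner_commute[of "snd p" "fst p"] algebra_simps)
      then have "R t p \<bullet> R t p = p \<bullet> p" by (simp add: cs inner_prod_def)
      then show ?thesis by (simp add: norm_eq)
    qed
    have Rmod: "has_modulus (R t) 1" for t by (rule has_modulus_isometry[OF Rlin Rnorm])
    have Rm: "(\<lambda>q. R (fst q) (snd q)) \<in> borel_measurable borel"
      unfolding R_def by (intro borel_measurable_continuous_onI continuous_intros)
    have joint: "(\<lambda>q. \<Phi> (R (fst q) (snd q))) \<in> borel_measurable (borel \<Otimes>\<^sub>M borel)"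
      unfolding borel_prod by (rule measurable_compose[OF Rm \<Phi>m])
    have point: "indicator B p * ennreal ((norm (F (complex_point x y)))\<^sup>2) \<le> (\<integral>\<^sup>+t. indicator {0..1} t * \<Phi> (R t p) \<partial>lborel)" for p
    proof (cases "p \<in> B")
      case True
      obtain u w where p: "p = (u, w)" by (cases p)
      define z where "z = complex_point x y"
      define q where "q = complex_point u w"
      \<comment> \<open>An open set around the closed unit disc on which the complex line through
        the point in direction \<open>q\<close> stays inside the tube.\<close>
      define U where "U = {t :: complex. norm t * norm p < \<rho>}"
      have opU: "open U" unfolding U_def by (intro open_Collect_less continuous_intros)
      have cU: "cball 0 1 \<subseteq> U"
      proof
        fix t :: complex assume "t \<in> cball 0 1"
        then have "norm t * norm p \<le> 1 * norm p" by (intro mult_right_mono) auto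
        then show "t \<in> U" using True by (simp add: U_def B_def)
      qed
      have tq: "z + t *s q = complex_point (x + (Re t *\<^sub>R u - Im t *\<^sub>R w)) (y + (Re t *\<^sub>R w + Im t *\<^sub>R u))" for t
        by (simp add: z_def q_def complex_point_mult complex_point_add)
      have inD: "z + t *s q \<in> tube_domain \<Omega>" if "t \<in> U" for t
      proof -
        have "norm (Re t *\<^sub>R w + Im t *\<^sub>R u) \<le> norm t * norm p"
        proof (rule power2_le_imp_le)
          have "(norm (Re t *\<^sub>R w + Im t *\<^sub>R u))\<^sup>2 \<le> (norm (Re t *\<^sub>R w + Im t *\<^sub>R u))\<^sup>2 + (norm (Re t *\<^sub>R u - Im t *\<^sub>R w))\<^sup>2" by simp
          also have "\<dots> = ((Re t)\<^sup>2 + (Im t)\<^sup>2) * ((norm u)\<^sup>2 + (norm w)\<^sup>2)"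
            unfolding power2_norm_eq_inner by (simp add: inner_diff_left inner_diff_right inner_add_left inner_add_right inner_commute[of w u] power2_eq_square algebra_simps)
          also have "\<dots> = (norm t * norm p)\<^sup>2" by (simp add: p norm_Pair power_mult_distrib cmod_power2)
          finally show "(norm (Re t *\<^sub>R w + Im t *\<^sub>R u))\<^sup>2 \<le> (norm t * norm p)\<^sup>2" .
        qed simp
        then have "norm (Re t *\<^sub>R w + Im t *\<^sub>R u) < \<rho>" using that by (simp add: U_def)
        then have "y + (Re t *\<^sub>R w + Im t *\<^sub>R u) \<in> \<Omega>" by (rule sub')
        then show ?thesis unfolding tq by simp
      qed
      have "(\<lambda>t. (F (z + t *s q))\<^sup>2) holomorphic_on U"
        by (intro holomorphic_intros holomorphic_multi_on_line[OF hol inD])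
      from circle_mean[OF this opU cU]
      have "ennreal ((norm (F z))\<^sup>2) \<le> (\<integral>\<^sup>+t. indicator {0..1} t * ennreal ((norm (F (z + cis (2 * pi * t) *s q)))\<^sup>2) \<partial>lborel)"
        by (simp add: norm_power)
      also have "\<dots> = (\<integral>\<^sup>+t. indicator {0..1} t * \<Phi> (R t p) \<partial>lborel)"
      proof (rule nn_integral_cong)
        fix t
        have "R t p \<in> B" using True by (simp add: B_def Rnorm)
        moreover have "z + cis (2 * pi * t) *s q = complex_point (x + fst (R t p)) (y + snd (R t p))"
          by (simp add: tq R_def p)
        ultimately show "indicator {0..1} t * ennreal ((norm (F (z + cis (2 * pi * t) *s q)))\<^sup>2) = indicator {0..1} t * \<Phi> (R t p)"
          by (simp add: \<Phi>_def)
      qed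
      finally show ?thesis using True by (simp add: z_def)
    qed simp
    have "b * ennreal ((norm (F (complex_point x y)))\<^sup>2) = (\<integral>\<^sup>+p. indicator B p * ennreal ((norm (F (complex_point x y)))\<^sup>2) \<partial>lborel)"
      unfolding b_def by (subst nn_integral_multc) (auto simp: B_def intro!: borel_measurable_indicator)
    also have "\<dots> \<le> (\<integral>\<^sup>+p. \<integral>\<^sup>+t. indicator {0..1} t * \<Phi> (R t p) \<partial>lborel \<partial>lborel)"
      by (intro nn_integral_mono point)
    also have "\<dots> = (\<integral>\<^sup>+t. \<integral>\<^sup>+p. indicator {0..1} t * \<Phi> (R t p) \<partial>lborel \<partial>lborel)"
    proof (rule lborel_pair.Fubini')
      have "(\<lambda>q. indicator {0..1} (fst q) * \<Phi> (R (fst q) (snd q))) \<in> borel_measurable (borel \<Otimes>\<^sub>M borel)"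
        using joint by measurable
      then show "(\<lambda>(t, p). indicator {0..1} t * \<Phi> (R t p)) \<in> borel_measurable (lborel \<Otimes>\<^sub>M lborel)"
        by (simp add: split_beta' cong: measurable_cong_sets)
    qed
    also have "\<dots> = (\<integral>\<^sup>+t. indicator {0..1} (t::real) * (\<integral>\<^sup>+p. \<Phi> p \<partial>lborel) \<partial>lborel)"
    proof (rule nn_integral_cong)
      fix t :: real
      have Rt: "(\<lambda>p. \<Phi> (R t p)) \<in> borel_measurable borel"
        by (rule measurable_compose[OF measurable_linear[OF Rlin] \<Phi>m])
      have "(\<integral>\<^sup>+p. \<Phi> (R t p) \<partial>lborel) = (\<integral>\<^sup>+p. \<Phi> p \<partial>lborel)"
        using has_modulus_integral[OF Rmod \<Phi>m, of t] by simp
      then show "(\<integral>\<^sup>+p. indicator {0..1} t * \<Phi> (R t p) \<partial>lborel) = indicator {0..1} t * (\<integral>\<^sup>+p. \<Phi> p \<partial>lborel)"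
        using Rt by (subst nn_integral_cmult) auto
    qed
    also have "\<dots> = (\<integral>\<^sup>+p. \<Phi> p \<partial>lborel)" by (subst nn_integral_multc) auto
    also have "\<dots> = (\<integral>\<^sup>+w. \<integral>\<^sup>+u. \<Phi> (u, w) \<partial>lborel \<partial>lborel)"
      unfolding lborel_prod[symmetric] using \<Phi>m
      by (subst lborel_pair.nn_integral_snd[symmetric]) (auto simp: borel_prod lborel_prod)
    also have "\<dots> \<le> (\<integral>\<^sup>+w. indicator (ball (0::real^'n) \<rho>) w * M \<partial>lborel)"
    proof (rule nn_integral_mono)
      fix w :: "real^'n"
      show "(\<integral>\<^sup>+u. \<Phi> (u, w) \<partial>lborel) \<le> indicator (ball 0 \<rho>) w * M"
      proof (cases "w \<in> ball 0 \<rho>")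
        case True
        then have yw: "y + w \<in> \<Omega>" by (intro sub') simp
        have "(\<lambda>u. ennreal ((norm (F (complex_point u (y + w))))\<^sup>2)) \<in> borel_measurable borel"
        proof -
          have "continuous_on UNIV (\<lambda>u. F (complex_point u (y + w)))" using yw by (intro tube_continuous[OF hol] continuous_intros)
          then have [measurable]: "(\<lambda>u. F (complex_point u (y + w))) \<in> borel_measurable borel" by (rule borel_measurable_continuous_onI)
          show ?thesis by measurable
        qed
        from nn_integral_lborel_translate[OF this, of x]
        have "(\<integral>\<^sup>+u. ennreal ((norm (F (complex_point (x + u) (y + w))))\<^sup>2) \<partial>lborel) \<le> M"
          using M[OF yw] by (simp add: add.commute)
        moreover have "(\<integral>\<^sup>+u. \<Phi> (u, w) \<partial>lborel) \<le> (\<integral>\<^sup>+u. ennreal ((norm (F (complex_point (x + u) (y + w))))\<^sup>2) \<partial>lborel)"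
          by (intro nn_integral_mono) (auto simp: \<Phi>_def indicator_def)
        ultimately show ?thesis using True by simp
      next
        case False
        have "\<Phi> (u, w) = 0" for u
        proof -
          have "(u, w) \<notin> B" using False norm_snd_le[of w u] by (auto simp: B_def)
          then show ?thesis by (simp add: \<Phi>_def)
        qed
        then show ?thesis by simp
      qed
    qed
    also have "\<dots> = v * M" unfolding v_def by (subst nn_integral_multc) (auto intro!: borel_measurable_indicator)
    finally have "b * ennreal ((norm (F (complex_point x y)))\<^sup>2) \<le> v * M" .
    then have "(b * ennreal ((norm (F (complex_point x y)))\<^sup>2)) / b \<le> (v * M) / b" by (rule divide_right_mono_ennreal)
    then show ?thesis unfolding C(2) using b
      by (simp add: ennreal_mult_divide_eq mult.commute[of b] ennreal_divide_times ennreal_times_divide mult.commute[of M])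
  qed
  then show ?thesis using C(1) by blast
qed

section \<open>Functions with decay on horizontal slices\<close>

lemma nn_integral_inverse_square:
  assumes "c > 0"
  shows "(\<integral>\<^sup>+t. ennreal (inverse (1 + (c * t)\<^sup>2)) \<partial>lborel) < \<infinity>"
proof -
  have "integrable lborel (\<lambda>x::real. inverse (1 + x\<^sup>2))"
    using integrable_inverse_1_plus_square by (simp add: set_integrable_def einterval_def)
  then have "integrable lborel (\<lambda>x. inverse (1 + (0 + c * x)\<^sup>2))"
    using assms by (intro lborel_integrable_real_affine[of "\<lambda>x. inverse (1 + x\<^sup>2)"]) auto
  then show ?thesis
    by (subst (asm) integrable_iff_bounded) (simp add: abs_of_nonneg)
qed

text \<open>A product of one-dimensional kernels, so that integrability reduces to the line. It
  dominates exponentials of the norm as well as the damping factors used later.\<close>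

definition decay :: "real \<Rightarrow> 'a::euclidean_space \<Rightarrow> real" where
  "decay c x = (\<Prod>b\<in>Basis. inverse (1 + (c * (x \<bullet> b))\<^sup>2))"

lemma decay_nonneg: "decay c x \<ge> 0"
  unfolding decay_def by (intro prod_nonneg) simp

lemma decay_le_1: "decay c x \<le> 1"
  unfolding decay_def by (intro prod_le_1) (auto simp: inverse_le_1_iff)

lemma decay_measurable [measurable]: "decay c \<in> borel_measurable borel"
  unfolding decay_def[abs_def] by measurable

lemma integrable_decay:
  assumes "c > 0" shows "integrable lborel (decay c :: 'a::euclidean_space \<Rightarrow> real)"
proof (rule integrableI_bounded)
  have "(\<integral>\<^sup>+x. ennreal (norm (decay c (x::'a))) \<partial>lborel) = (\<integral>\<^sup>+x. (\<Prod>b\<in>Basis. ennreal (inverse (1 + (c * ((x::'a) \<bullet> b))\<^sup>2))) \<partial>lborel)"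
    by (intro nn_integral_cong) (simp add: decay_def prod_ennreal prod_nonneg)
  also have "\<dots> = (\<Prod>b\<in>(Basis::'a set). \<integral>\<^sup>+t. ennreal (inverse (1 + (c * t)\<^sup>2)) \<partial>lborel)"
    by (rule nn_integral_lborel_prod) auto
  also have "\<dots> < \<infinity>"
    using nn_integral_inverse_square[OF assms] by (simp add: power_less_top_ennreal)
  finally show "(\<integral>\<^sup>+x. ennreal (norm (decay c (x::'a))) \<partial>lborel) < \<infinity>" .
qed simp

text \<open>The norm dominates the average of the coordinates, which splits the exponential into
  factors with exponents \<open>u = (a / n) * \<bar>x \<bullet> b\<bar>\<close>. From
  \<open>exp u \<ge> (1 + u / 2)^2 \<ge> 1 + (u / 2)^2\<close> comes the constant
  \<open>a / (2 * n)\<close>.\<close>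

lemma exp_norm_le_decay:
  assumes "a > 0"
  obtains c where "c > 0" "\<And>x::'a::euclidean_space. exp (- a * norm x) \<le> decay c x"
proof -
  define n where "n = real DIM('a)"
  have n: "n > 0" by (simp add: n_def)
  define c where "c = a / (2 * n)"
  have "exp (- a * norm x) \<le> decay c x" for x :: 'a
  proof -
    have "(\<Sum>b\<in>Basis. (a / n) * \<bar>x \<bullet> b\<bar>) \<le> (\<Sum>b\<in>(Basis::'a set). (a / n) * norm x)"
      using assms n Basis_le_norm by (intro sum_mono mult_left_mono) auto
    also have "\<dots> = a * norm x" using n by (simp add: n_def)
    finally have "exp (- a * norm x) \<le> exp (\<Sum>b\<in>Basis. - ((a / n) * \<bar>x \<bullet> b\<bar>))" by (simp add: sum_negf)
    also have "\<dots> = (\<Prod>b\<in>Basis. exp (- ((a / n) * \<bar>x \<bullet> b\<bar>)))" by (simp add: exp_sum)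
    also have "\<dots> \<le> decay c x" unfolding decay_def
    proof (intro prod_mono conjI)
      fix b :: 'a
      define u where "u = (a / n) * \<bar>x \<bullet> b\<bar>"
      have u: "u \<ge> 0" using assms n by (simp add: u_def)
      have "1 + (c * (x \<bullet> b))\<^sup>2 = 1 + (u / 2)\<^sup>2" by (simp add: u_def c_def power_mult_distrib power_divide)
      also have "\<dots> \<le> (1 + u / 2)\<^sup>2" using u by (simp add: power2_sum)
      also have "\<dots> \<le> (exp (u / 2))\<^sup>2" using u by (intro power_mono exp_ge_add_one_self) auto
      also have "\<dots> = exp u" by (simp add: exp_double[symmetric])
      finally have "inverse (exp u) \<le> inverse (1 + (c * (x \<bullet> b))\<^sup>2)"
        by (intro le_imp_inverse_le) (auto simp: add_pos_nonneg)
      then show "exp (- ((a / n) * \<bar>x \<bullet> b\<bar>)) \<le> inverse (1 + (c * (x \<bullet> b))\<^sup>2)" by (simp add: exp_minus u_def)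
    qed simp
    finally show ?thesis .
  qed
  moreover have "c > 0" using assms n by (simp add: c_def)
  ultimately show thesis using that by blast
qed

lemma lborel_integral_translate:
  fixes f :: "'a::euclidean_space \<Rightarrow> complex"
  assumes [measurable]: "f \<in> borel_measurable borel"
  shows "(LINT x|lborel. f (x + a)) = (LINT x|lborel. f x)"
proof -
  have "(LINT x|lborel. f x) = (LINT x|distr lborel borel ((+) a). f x)" by (simp add: lborel_distr_plus)
  also have "\<dots> = (LINT x|lborel. f (a + x))" by (subst integral_distr) auto
  finally show ?thesis by (simp add: add.commute)
qed

lemma lborel_integrable_translate:
  fixes f :: "'a::euclidean_space \<Rightarrow> complex"
  assumes f: "integrable lborel f"
  shows "integrable lborel (\<lambda>x. f (x + a))"
proof -
  have [measurable]: "f \<in> borel_measurable borel" using f by simp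
  have "integrable (distr lborel borel ((+) a)) f" using f by (simp add: lborel_distr_plus)
  then show ?thesis by (subst (asm) integrable_distr_eq) (auto simp: add.commute)
qed

lemma unit_segment_integral:
  fixes h :: "real \<Rightarrow> complex"
  assumes "\<And>t. t \<in> {0..1} \<Longrightarrow> (G has_vector_derivative h t) (at t within {0..1})" "continuous_on {0..1} h"
  shows "(LINT t|lborel. indicator {0..1} t *\<^sub>R h t) = G 1 - G 0"
proof -
  have si: "set_integrable lborel {0..1} h" by (rule borel_integrable_atLeastAtMost'[OF assms(2)])
  have "(h has_integral G 1 - G 0) {0..1}"
    by (rule fundamental_theorem_of_calculus) (use assms in auto)
  then show ?thesis
    using set_borel_integral_eq_integral(2)[OF si] by (simp add: integral_unique set_lebesgue_integral_def)
qed

text \<open>All that the analysis uses of the cone: self-duality in the form of \<open>pos\<close>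
  and \<open>sep\<close>, and homogeneity together with adjoints of equal modulus.\<close>

locale tube_cone =
  fixes \<Omega> :: "(real^'n) set" and e :: "real^'n"
  assumes open_cone: "open \<Omega>" and e_in: "e \<in> \<Omega>"
    and add_closure: "\<And>u v. u \<in> \<Omega> \<Longrightarrow> v \<in> closure \<Omega> \<Longrightarrow> u + v \<in> \<Omega>"
    and scale: "\<And>k u. k > 0 \<Longrightarrow> u \<in> \<Omega> \<Longrightarrow> k *\<^sub>R u \<in> \<Omega>"
    and pos: "\<And>x \<xi>. x \<in> \<Omega> \<Longrightarrow> \<xi> \<in> closure \<Omega> \<Longrightarrow> \<xi> \<noteq> 0 \<Longrightarrow> x \<bullet> \<xi> > 0"
    and sep: "\<And>\<xi>. \<xi> \<notin> closure \<Omega> \<Longrightarrow> \<exists>y\<in>\<Omega>. y \<bullet> \<xi> < 0"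
    and trans: "\<And>y. y \<in> \<Omega> \<Longrightarrow> \<exists>g g' J. linear g \<and> g ` \<Omega> = \<Omega> \<and> has_modulus g J \<and> linear g' \<and> g' ` \<Omega> = \<Omega> \<and>
      has_modulus g' J \<and> (\<forall>x y. g x \<bullet> y = x \<bullet> g' y) \<and> g e = y"
begin

lemma pos_nonneg: "x \<in> \<Omega> \<Longrightarrow> \<xi> \<in> closure \<Omega> \<Longrightarrow> x \<bullet> \<xi> \<ge> 0"
  using pos[of x \<xi>] by (cases "\<xi> = 0") (auto intro: less_imp_le)

lemma add_cone: "u \<in> \<Omega> \<Longrightarrow> v \<in> \<Omega> \<Longrightarrow> u + v \<in> \<Omega>"
  using add_closure closure_subset by blast

lemma convex_cone: "convex \<Omega>"
  unfolding convex_alt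
proof (intro ballI allI impI)
  fix x y and u :: real assume xy: "x \<in> \<Omega>" "y \<in> \<Omega>" and u: "0 \<le> u \<and> u \<le> 1"
  consider "u = 0" | "u = 1" | "0 < u" "u < 1" using u by force
  then show "(1 - u) *\<^sub>R x + u *\<^sub>R y \<in> \<Omega>"
    using xy by cases (auto intro!: add_cone scale)
qed

text \<open>The point \<open>y\<close> can be moved by \<open>d / 2\<close> in the direction
  opposite to \<xi> and still has nonnegative product with \<xi>. This yields exponential decay on
  the support of the transforms.\<close>

lemma coercive:
  assumes "y \<in> \<Omega>"
  obtains \<kappa> where "\<kappa> > 0" "\<And>\<xi>. \<xi> \<in> closure \<Omega> \<Longrightarrow> y \<bullet> \<xi> \<ge> \<kappa> * norm \<xi>"
proof -
  obtain d where d: "d > 0" "ball y d \<subseteq> \<Omega>" using open_cone assms by (meson open_contains_ball)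
  have "y \<bullet> \<xi> \<ge> (d / 2) * norm \<xi>" if "\<xi> \<in> closure \<Omega>" for \<xi>
  proof (cases "\<xi> = 0")
    case False
    define w where "w = y - (d / 2 / norm \<xi>) *\<^sub>R \<xi>"
    have "w \<in> ball y d" using d False by (simp add: w_def dist_norm)
    then have "w \<bullet> \<xi> \<ge> 0" using d pos_nonneg that by blast
    then have "y \<bullet> \<xi> \<ge> (d / 2 / norm \<xi>) * (norm \<xi>)\<^sup>2" by (simp add: w_def inner_diff_left power2_norm_eq_inner)
    also have "(d / 2 / norm \<xi>) * (norm \<xi>)\<^sup>2 = (d / 2) * norm \<xi>" using False by (simp add: power2_eq_square)
    finally show ?thesis .
  qed simp
  then show thesis using that[of "d / 2"] d by simp
qed

end

text \<open>One integrable majorant serves for all slices: it justifies the contour shift and bounds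
  the Fourier transforms uniformly in the height.\<close>

locale nice_function = tube_cone \<Omega> e for \<Omega> :: "(real^'n) set" and e +
  fixes f :: "complex^'n \<Rightarrow> complex" and A c :: real
  assumes hol: "holomorphic_multi_on f (tube_domain \<Omega>)" and c_pos: "c > 0"
    and dom: "\<And>x y. y \<in> \<Omega> \<Longrightarrow> norm (f (complex_point x y)) \<le> A * decay c x"
begin

section \<open>Slices and their Fourier transforms\<close>

definition fy :: "real^'n \<Rightarrow> real^'n \<Rightarrow> complex" where "fy y x = f (complex_point x y)"

lemma A_nonneg: "A \<ge> 0"
proof -
  have "0 \<le> A * decay c (0::real^'n)" using dom[OF e_in, of 0] norm_ge_zero by (rule order_trans[rotated])
  moreover have "decay c (0::real^'n) = 1" by (simp add: decay_def)
  ultimately show ?thesis by simp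
qed

lemma fy_cont: "y \<in> \<Omega> \<Longrightarrow> continuous_on UNIV (fy y)"
  unfolding fy_def[abs_def] by (intro tube_continuous[OF hol] continuous_intros)

lemma fy_measurable: "y \<in> \<Omega> \<Longrightarrow> fy y \<in> borel_measurable borel"
  using fy_cont by (rule borel_measurable_continuous_onI)

lemma fy_integrable: "y \<in> \<Omega> \<Longrightarrow> integrable lborel (fy y)"
proof (rule Bochner_Integration.integrable_bound)
  assume y: "y \<in> \<Omega>"
  show "integrable lborel (\<lambda>x::real^'n. A * decay c x)" using integrable_decay[OF c_pos, where 'a="real^'n"] by simp
  show "fy y \<in> borel_measurable lborel" using fy_measurable[OF y] by simp
  show "AE x in lborel. norm (fy y x) \<le> norm (A * decay c x)"
    using dom[OF y] A_nonneg by (intro AE_I2) (simp add: fy_def abs_of_nonneg decay_nonneg)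
qed

text \<open>The holomorphic function f(z) exp(-i z.\<xi>) at z = x + iy. Its slice integrals are the
  transforms multiplied by the factor that should make them independent of the height.\<close>

definition H :: "real^'n \<Rightarrow> real^'n \<Rightarrow> real^'n \<Rightarrow> complex" where
  "H \<xi> x y = fy y x * cis (- (x \<bullet> \<xi>)) * complex_of_real (exp (y \<bullet> \<xi>))"

lemma H_integrable: "y \<in> \<Omega> \<Longrightarrow> integrable lborel (\<lambda>x. H \<xi> x y)"
  unfolding H_def by (intro integrable_mult_left integrable_mult_cis fy_integrable) measurable

lemma H_integral: "(LINT x|lborel. H \<xi> x y) = complex_of_real (exp (y \<bullet> \<xi>)) * ft (fy y) \<xi>"
  unfolding H_def ft_def by (simp add: mult.commute)

lemma segment_cone:
  assumes "y \<in> \<Omega>" "y + v \<in> \<Omega>" "t \<in> {0..1}" shows "y + t *\<^sub>R v \<in> \<Omega>"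
proof -
  have "(1 - t) *\<^sub>R y + t *\<^sub>R (y + v) \<in> \<Omega>" using assms convex_cone by (auto simp: convex_alt)
  moreover have "(1 - t) *\<^sub>R y + t *\<^sub>R (y + v) = y + t *\<^sub>R v" by (simp add: algebra_simps)
  ultimately show ?thesis by simp
qed

text \<open>Integrated over \<open>x\<close>, the left-hand side is exactly the difference of the two slice integrals, and the
  right-hand side vanishes by translation invariance; no limit of long rectangles is needed.\<close>

lemma rectangle:
  assumes "y \<in> \<Omega>" "y + v \<in> \<Omega>"
  shows "(LINT s|lborel. indicator {0..1} s *\<^sub>R H \<xi> (x + s *\<^sub>R v) y) - (LINT s|lborel. indicator {0..1} s *\<^sub>R H \<xi> (x + s *\<^sub>R v) (y + v))
    = \<i> * (LINT t|lborel. indicator {0..1} t *\<^sub>R H \<xi> x (y + t *\<^sub>R v)) - \<i> * (LINT t|lborel. indicator {0..1} t *\<^sub>R H \<xi> (x + v) (y + t *\<^sub>R v))"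
proof -
  define U where "U = {\<tau> :: complex. y + Im \<tau> *\<^sub>R v \<in> \<Omega>}"
  define h where "h \<tau> = f (complex_point x y + \<tau> *s complex_point v 0) * exp (- \<i> * (complex_of_real (x \<bullet> \<xi>) + \<i> * complex_of_real (y \<bullet> \<xi>) + \<tau> * complex_of_real (v \<bullet> \<xi>)))" for \<tau>
  have cp: "complex_point x y + \<tau> *s complex_point v 0 = complex_point (x + Re \<tau> *\<^sub>R v) (y + Im \<tau> *\<^sub>R v)" for \<tau>
    by (simp add: complex_point_mult complex_point_add)
  have h: "h \<tau> = H \<xi> (x + Re \<tau> *\<^sub>R v) (y + Im \<tau> *\<^sub>R v)" for \<tau>
  proof -
    have "- \<i> * (complex_of_real (x \<bullet> \<xi>) + \<i> * complex_of_real (y \<bullet> \<xi>) + \<tau> * complex_of_real (v \<bullet> \<xi>))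
      = \<i> * complex_of_real (- ((x + Re \<tau> *\<^sub>R v) \<bullet> \<xi>)) + complex_of_real ((y + Im \<tau> *\<^sub>R v) \<bullet> \<xi>)"
      by (simp add: complex_eq_iff inner_add_left)
    then have "exp (- \<i> * (complex_of_real (x \<bullet> \<xi>) + \<i> * complex_of_real (y \<bullet> \<xi>) + \<tau> * complex_of_real (v \<bullet> \<xi>)))
      = cis (- ((x + Re \<tau> *\<^sub>R v) \<bullet> \<xi>)) * complex_of_real (exp ((y + Im \<tau> *\<^sub>R v) \<bullet> \<xi>))"
      by (simp only: exp_add cis_conv_exp exp_of_real)
    then show ?thesis unfolding h_def cp H_def fy_def by (simp only: mult.assoc)
  qed
  have opU: "open U" unfolding U_def
  proof -
    have "open ((\<lambda>\<tau>::complex. y + Im \<tau> *\<^sub>R v) -` \<Omega>)" by (intro open_vimage open_cone continuous_intros)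
    then show "open {\<tau>. y + Im \<tau> *\<^sub>R v \<in> \<Omega>}" by (simp add: vimage_def)
  qed
  have convU: "convex U" unfolding convex_alt
  proof (intro ballI allI impI)
    fix a b and u :: real assume ab: "a \<in> U" "b \<in> U" and u: "0 \<le> u \<and> u \<le> 1"
    have "(1 - u) *\<^sub>R (y + Im a *\<^sub>R v) + u *\<^sub>R (y + Im b *\<^sub>R v) \<in> \<Omega>"
      using ab u convex_cone unfolding U_def convex_alt by blast
    then show "(1 - u) *\<^sub>R a + u *\<^sub>R b \<in> U" by (simp add: U_def algebra_simps)
  qed
  have hol_h: "h holomorphic_on U" unfolding h_def
    by (intro holomorphic_intros holomorphic_multi_on_line[OF hol]) (auto simp: cp U_def)
  \<comment> \<open>On a convex domain a primitive takes the place of Cauchy's theorem: each side of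
    the unit square becomes a difference of corner values.\<close>
  obtain P where P: "\<And>\<tau>. \<tau> \<in> U \<Longrightarrow> (P has_field_derivative h \<tau>) (at \<tau> within U)"
    using holomorphic_convex_primitive'[OF convU opU hol_h] by blast
  have P': "(P has_field_derivative h \<tau>) (at \<tau>)" if "\<tau> \<in> U" for \<tau>
    using P[OF that] at_within_open[OF that opU] by simp
  have inU: "Complex s t \<in> U" if "t \<in> {0..1}" for s t
    using segment_cone[OF assms that] by (simp add: U_def)
  have contH: "continuous_on S (\<lambda>p. H \<xi> (a p) (b p))" if "continuous_on S a" "continuous_on S b" "\<And>p. p \<in> S \<Longrightarrow> b p \<in> \<Omega>"
    for S :: "real set" and a b
    unfolding H_def fy_def cis_conv_exp using that by (intro continuous_intros tube_continuous[OF hol]) auto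
  have hor: "(LINT s|lborel. indicator {0..1} s *\<^sub>R H \<xi> (x + s *\<^sub>R v) (y + k *\<^sub>R v)) = P (Complex 1 k) - P (Complex 0 k)"
    if k: "k \<in> {0..1}" for k
  proof (rule unit_segment_integral)
    fix s :: real assume "s \<in> {0..1}"
    have "((\<lambda>s. Complex s k) has_vector_derivative 1) (at s within {0..1})"
      unfolding Complex_eq by (auto intro!: derivative_eq_intros simp: has_vector_derivative_def scaleR_conv_of_real)
    from field_vector_diff_chain_within[OF this, of P "h (Complex s k)"]
    have "((P \<circ> (\<lambda>s. Complex s k)) has_vector_derivative 1 * h (Complex s k)) (at s within {0..1})"
      using P'[OF inU[OF k]] by (auto intro: has_field_derivative_at_within)
    then show "((\<lambda>s. P (Complex s k)) has_vector_derivative H \<xi> (x + s *\<^sub>R v) (y + k *\<^sub>R v)) (at s within {0..1})"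
      by (simp add: o_def h)
  next
    show "continuous_on {0..1} (\<lambda>s. H \<xi> (x + s *\<^sub>R v) (y + k *\<^sub>R v))"
      by (intro contH continuous_intros segment_cone[OF assms k])
  qed
  have ver: "\<i> * (LINT t|lborel. indicator {0..1} t *\<^sub>R H \<xi> (x + k *\<^sub>R v) (y + t *\<^sub>R v)) = P (Complex k 1) - P (Complex k 0)" for k
  proof -
    have "(LINT t|lborel. indicator {0..1} t *\<^sub>R (\<i> * H \<xi> (x + k *\<^sub>R v) (y + t *\<^sub>R v))) = P (Complex k 1) - P (Complex k 0)"
    proof (rule unit_segment_integral)
      fix t :: real assume t: "t \<in> {0..1}"
      have "((\<lambda>t. Complex k t) has_vector_derivative \<i>) (at t within {0..1})"
        unfolding Complex_eq has_vector_derivative_def by (auto intro!: derivative_eq_intros simp: scaleR_conv_of_real)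
      from field_vector_diff_chain_within[OF this, of P "h (Complex k t)"]
      have "((P \<circ> (\<lambda>t. Complex k t)) has_vector_derivative \<i> * h (Complex k t)) (at t within {0..1})"
        using P'[OF inU[OF t]] by (auto intro: has_field_derivative_at_within)
      then show "((\<lambda>t. P (Complex k t)) has_vector_derivative \<i> * H \<xi> (x + k *\<^sub>R v) (y + t *\<^sub>R v)) (at t within {0..1})"
        by (simp add: o_def h)
    next
      show "continuous_on {0..1} (\<lambda>t. \<i> * H \<xi> (x + k *\<^sub>R v) (y + t *\<^sub>R v))"
        by (intro contH continuous_intros segment_cone[OF assms])
    qed
    moreover have "(LINT t|lborel. indicator {0..1} t *\<^sub>R (\<i> * H \<xi> (x + k *\<^sub>R v) (y + t *\<^sub>R v)))
       = \<i> * (LINT t|lborel. indicator {0..1} t *\<^sub>R H \<xi> (x + k *\<^sub>R v) (y + t *\<^sub>R v))"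
      by (subst integral_mult_right_zero[symmetric]) (simp add: mult_scaleR_right)
    ultimately show ?thesis by simp
  qed
  show ?thesis using hor[of 0] hor[of 1] ver[of 0] ver[of 1] by simp
qed

lemma shift_invariant:
  assumes y: "y \<in> \<Omega>" "y' \<in> \<Omega>"
  shows "(LINT x|lborel. H \<xi> x y) = (LINT x|lborel. H \<xi> x y')"
proof -
  define v where "v = y' - y"
  have yv: "y + v \<in> \<Omega>" using y by (simp add: v_def)
  define I where "I = (\<lambda>s::real. indicator {0..1} s :: real)"
  have Im[measurable]: "I \<in> borel_measurable borel" by (simp add: I_def)
  have Ii: "integrable lborel I" unfolding I_def by (intro integrable_real_indicator) auto
  have Ii1: "(LINT s|lborel. I s) = 1" unfolding I_def by simp
  have hor: "(LINT x|lborel. LINT s|lborel. I s *\<^sub>R H \<xi> (x + s *\<^sub>R v) w) = (LINT x|lborel. H \<xi> x w)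
      \<and> integrable lborel (\<lambda>x. LINT s|lborel. I s *\<^sub>R H \<xi> (x + s *\<^sub>R v) w)" if w: "w \<in> \<Omega>" for w
  proof -
    have Hi: "integrable lborel (\<lambda>x. H \<xi> x w)" by (rule H_integrable[OF w])
    have Hm[measurable]: "(\<lambda>x. H \<xi> x w) \<in> borel_measurable borel" using Hi by simp
    have m: "(\<lambda>(s, x). I s *\<^sub>R H \<xi> (x + s *\<^sub>R v) w) \<in> borel_measurable (lborel \<Otimes>\<^sub>M lborel)"
    proof -
      have "(\<lambda>p. snd p + fst p *\<^sub>R v) \<in> borel \<Otimes>\<^sub>M borel \<rightarrow>\<^sub>M borel" by measurable
      from measurable_compose[OF this Hm] show ?thesis by (simp add: split_beta' cong: measurable_cong_sets)
    qed
    have nrm: "(LINT x|lborel. norm (I s *\<^sub>R H \<xi> (x + s *\<^sub>R v) w)) = I s * (LINT x|lborel. norm (H \<xi> x w))" for s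
    proof -
      have "(LINT x|lborel. complex_of_real (norm (H \<xi> (x + s *\<^sub>R v) w))) = (LINT x|lborel. complex_of_real (norm (H \<xi> x w)))"
        by (rule lborel_integral_translate[of "\<lambda>x. complex_of_real (norm (H \<xi> x w))"]) measurable
      then show ?thesis by (simp add: I_def)
    qed
    have pi: "integrable (lborel \<Otimes>\<^sub>M lborel) (\<lambda>(s, x). I s *\<^sub>R H \<xi> (x + s *\<^sub>R v) w)"
    proof (rule lborel_pair.Fubini_integrable[OF m])
      show "integrable lborel (\<lambda>s. LINT x|lborel. norm (case (s, x) of (s, x) \<Rightarrow> I s *\<^sub>R H \<xi> (x + s *\<^sub>R v) w))"
        using Ii unfolding split nrm by simp
      show "AE s in lborel. integrable lborel (\<lambda>x. case (s, x) of (s, x) \<Rightarrow> I s *\<^sub>R H \<xi> (x + s *\<^sub>R v) w)"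
        using lborel_integrable_translate[OF Hi] by simp
    qed
    have "(LINT x|lborel. LINT s|lborel. I s *\<^sub>R H \<xi> (x + s *\<^sub>R v) w) = (LINT s|lborel. LINT x|lborel. I s *\<^sub>R H \<xi> (x + s *\<^sub>R v) w)"
      using lborel_pair.Fubini_integral[OF pi] .
    also have "\<dots> = (LINT s|lborel. I s *\<^sub>R (LINT x|lborel. H \<xi> x w))"
      by (simp add: lborel_integral_translate[OF Hm])
    also have "\<dots> = (LINT x|lborel. H \<xi> x w)" using Ii1 Ii by (subst integral_scaleR_left) auto
    finally show ?thesis using lborel_pair.integrable_snd[OF pi] by simp
  qed
  \<comment> \<open>Both vertical sides are values of this one integrable function, at
    \<open>x\<close> and at \<open>x + v\<close>, and so cancel after integration over
    \<open>x\<close>.\<close>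
  define Cc where "Cc x = (LINT t|lborel. I t *\<^sub>R H \<xi> x (y + t *\<^sub>R v))" for x
  have Ci: "integrable lborel Cc"
  proof -
    have [measurable]: "(\<lambda>(t, x). I t *\<^sub>R H \<xi> x (y + t *\<^sub>R v)) \<in> borel_measurable (lborel \<Otimes>\<^sub>M lborel)"
    proof -
      have "(\<lambda>p. indicator ({0..1} \<times> UNIV) p *\<^sub>R H \<xi> (snd p) (y + fst p *\<^sub>R v)) \<in> borel_measurable (borel :: (real \<times> (real^'n)) measure)"
        unfolding H_def fy_def cis_conv_exp
        using segment_cone[OF y(1) yv]
        by (intro borel_measurable_continuous_on_indicator continuous_intros tube_continuous[OF hol]) (auto intro!: borel_closed closed_Times)
      moreover have "(\<lambda>p. indicator ({0..1} \<times> UNIV) p *\<^sub>R H \<xi> (snd p) (y + fst p *\<^sub>R v)) = (\<lambda>(t, x). I t *\<^sub>R H \<xi> x (y + t *\<^sub>R v))"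
        by (auto simp: I_def indicator_def fun_eq_iff)
      ultimately show ?thesis unfolding lborel_prod by simp
    qed
    define K where "K = exp (\<bar>y \<bullet> \<xi>\<bar> + \<bar>v \<bullet> \<xi>\<bar>)"
    have bound: "norm (I t *\<^sub>R H \<xi> x (y + t *\<^sub>R v)) \<le> norm (complex_of_real (I t) * complex_of_real (A * K * decay c x))" for t x
    proof (cases "t \<in> {0..1}")
      case True
      have "\<bar>t * (v \<bullet> \<xi>)\<bar> \<le> 1 * \<bar>v \<bullet> \<xi>\<bar>" unfolding abs_mult using True by (intro mult_right_mono) auto
      then have "exp ((y + t *\<^sub>R v) \<bullet> \<xi>) \<le> K" unfolding K_def by (simp add: inner_add_left)
      moreover have "norm (fy (y + t *\<^sub>R v) x) \<le> A * decay c x" unfolding fy_def by (rule dom[OF segment_cone[OF y(1) yv True]])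
      ultimately have "norm (fy (y + t *\<^sub>R v) x) * exp ((y + t *\<^sub>R v) \<bullet> \<xi>) \<le> (A * decay c x) * K"
        by (intro mult_mono) (auto simp: A_nonneg decay_nonneg)
      moreover have "A * K * decay c x \<ge> 0" by (simp add: K_def A_nonneg decay_nonneg)
      ultimately show ?thesis using True by (simp add: H_def I_def norm_mult mult_ac abs_of_nonneg del: of_real_mult)
    qed (simp add: I_def)
    have "integrable (lborel \<Otimes>\<^sub>M lborel) (\<lambda>(t, x). complex_of_real (I t) * complex_of_real (A * K * decay c (x::real^'n)))"
      using Ii integrable_decay[OF c_pos, where 'a="real^'n"] by (intro integrable_pair_mult) (auto simp del: of_real_mult)
    then have "integrable (lborel \<Otimes>\<^sub>M lborel) (\<lambda>(t, x). I t *\<^sub>R H \<xi> x (y + t *\<^sub>R v))"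
      by (rule Bochner_Integration.integrable_bound) (use bound in \<open>auto intro!: AE_I2\<close>)
    from lborel_pair.integrable_snd[OF this] show ?thesis by (simp add: Cc_def[abs_def])
  qed
  have Cm: "Cc \<in> borel_measurable borel" using Ci by simp
  have "(LINT x|lborel. H \<xi> x y) - (LINT x|lborel. H \<xi> x (y + v)) =
     (LINT x|lborel. LINT s|lborel. I s *\<^sub>R H \<xi> (x + s *\<^sub>R v) y) - (LINT x|lborel. LINT s|lborel. I s *\<^sub>R H \<xi> (x + s *\<^sub>R v) (y + v))"
    using hor[OF y(1)] hor[OF yv] by simp
  also have "\<dots> = (LINT x|lborel. (LINT s|lborel. I s *\<^sub>R H \<xi> (x + s *\<^sub>R v) y) - (LINT s|lborel. I s *\<^sub>R H \<xi> (x + s *\<^sub>R v) (y + v)))"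
    using hor[OF y(1)] hor[OF yv] by (intro Bochner_Integration.integral_diff[symmetric]) auto
  also have "\<dots> = (LINT x|lborel. \<i> * Cc x - \<i> * Cc (x + v))"
    unfolding I_def Cc_def rectangle[OF y(1) yv] ..
  also have "\<dots> = (LINT x|lborel. \<i> * Cc x) - (LINT x|lborel. \<i> * Cc (x + v))"
    using Ci lborel_integrable_translate[OF Ci] by (intro Bochner_Integration.integral_diff) auto
  also have "\<dots> = 0" using lborel_integral_translate[OF Cm, of v] by simp
  finally show ?thesis by (simp add: v_def)
qed

text \<open>The function \<open>g\<close> of the Fourier-Laplace representation, read off at height
  \<open>e\<close>; by \<open>ft_fy\<close> every other height gives the same.\<close>

definition gg :: "real^'n \<Rightarrow> complex" where "gg \<xi> = complex_of_real (exp (e \<bullet> \<xi>)) * ft (fy e) \<xi>"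

lemma ft_fy: "y \<in> \<Omega> \<Longrightarrow> ft (fy y) \<xi> = complex_of_real (exp (- (y \<bullet> \<xi>))) * gg \<xi>"
proof -
  assume y: "y \<in> \<Omega>"
  have "complex_of_real (exp (y \<bullet> \<xi>)) * ft (fy y) \<xi> = gg \<xi>"
    using shift_invariant[OF y e_in, of \<xi>] by (simp add: H_integral gg_def)
  then have "complex_of_real (exp (- (y \<bullet> \<xi>))) * gg \<xi> = complex_of_real (exp (- (y \<bullet> \<xi>)) * exp (y \<bullet> \<xi>)) * ft (fy y) \<xi>"
    by (metis mult.assoc of_real_mult)
  then show ?thesis by (simp add: exp_add[symmetric])
qed

lemma gg_measurable [measurable]: "gg \<in> borel_measurable borel"
  unfolding gg_def[abs_def] using ft_measurable[OF fy_measurable[OF e_in]] by measurable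

definition A' :: real where "A' = A * (LINT x|lborel. decay c (x::real^'n))"

lemma ft_fy_bound: "y \<in> \<Omega> \<Longrightarrow> norm (ft (fy y) \<xi>) \<le> A'"
proof -
  assume y: "y \<in> \<Omega>"
  have "norm (ft (fy y) \<xi>) \<le> (LINT x|lborel. norm (fy y x))" by (rule ft_bound)
  also have "\<dots> \<le> (LINT x|lborel. A * decay c (x::real^'n))"
    using fy_integrable[OF y] integrable_decay[OF c_pos, where 'a="real^'n"] dom[OF y, folded fy_def] by (intro integral_mono) auto
  finally show ?thesis by (simp add: A'_def)
qed

lemma gg_bound': "y \<in> \<Omega> \<Longrightarrow> norm (gg \<xi>) \<le> exp (y \<bullet> \<xi>) * A'"
proof -
  assume y: "y \<in> \<Omega>"
  have "exp (y \<bullet> \<xi>) * (exp (- (y \<bullet> \<xi>)) * norm (gg \<xi>)) \<le> exp (y \<bullet> \<xi>) * A'"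
    using ft_fy_bound[OF y, of \<xi>] by (intro mult_left_mono) (auto simp: ft_fy[OF y] norm_mult)
  then show ?thesis by (simp add: mult.assoc[symmetric] exp_add[symmetric])
qed

text \<open>Outside the closed cone some \<open>y\<close> in the cone has
  \<open>y \<bullet> \<xi> < 0\<close>; multiples of \<open>y\<close> send the bound
  \<open>exp (y \<bullet> \<xi>) * A'\<close> to 0.\<close>

lemma gg_support: "\<xi> \<notin> closure \<Omega> \<Longrightarrow> gg \<xi> = 0"
proof -
  assume "\<xi> \<notin> closure \<Omega>"
  then obtain y where y: "y \<in> \<Omega>" "y \<bullet> \<xi> < 0" using sep by blast
  have "norm (gg \<xi>) \<le> exp (real (Suc k) * (y \<bullet> \<xi>)) * A'" for k
    using gg_bound'[OF scale[OF _ y(1), of "real (Suc k)"], of \<xi>] by simp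
  moreover have "(\<lambda>k. exp (real (Suc k) * (y \<bullet> \<xi>)) * A') \<longlonglongrightarrow> 0 * A'"
  proof (intro tendsto_mult tendsto_const)
    have "(\<lambda>k. (exp (y \<bullet> \<xi>)) ^ Suc k) \<longlonglongrightarrow> 0"
      using y by (intro LIMSEQ_Suc LIMSEQ_power_zero) simp
    then show "(\<lambda>k. exp (real (Suc k) * (y \<bullet> \<xi>))) \<longlonglongrightarrow> 0" by (simp only: exp_of_nat_mult)
  qed
  ultimately have "norm (gg \<xi>) \<le> 0 * A'" by (intro LIMSEQ_le_const) auto
  then show ?thesis by simp
qed

lemma scaled_e: "(1 / real (Suc k)) *\<^sub>R e \<in> \<Omega>"
  using scale[OF _ e_in, of "1 / real (Suc k)"] by simp

lemma gg_bound: "norm (gg \<xi>) \<le> A'"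
proof -
  have "norm (gg \<xi>) \<le> exp ((1 / real (Suc k)) * (e \<bullet> \<xi>)) * A'" for k
    using gg_bound'[OF scaled_e, of \<xi> k] by simp
  moreover have "(\<lambda>k. exp ((1 / real (Suc k)) * (e \<bullet> \<xi>)) * A') \<longlonglongrightarrow> exp (0 * (e \<bullet> \<xi>)) * A'"
    by (intro tendsto_intros LIMSEQ_Suc[OF lim_1_over_n])
  ultimately have "norm (gg \<xi>) \<le> exp (0 * (e \<bullet> \<xi>)) * A'" by (intro LIMSEQ_le_const) auto
  then show ?thesis by simp
qed

lemma ft_fy_integrable: "y \<in> \<Omega> \<Longrightarrow> integrable lborel (ft (fy y))"
proof -
  assume y: "y \<in> \<Omega>"
  obtain \<kappa> where k: "\<kappa> > 0" "\<And>\<xi>. \<xi> \<in> closure \<Omega> \<Longrightarrow> y \<bullet> \<xi> \<ge> \<kappa> * norm \<xi>" using coercive[OF y] by blast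
  obtain c' where c': "c' > 0" "\<And>x::real^'n. exp (- \<kappa> * norm x) \<le> decay c' x" using exp_norm_le_decay[OF k(1)] by blast
  have A': "A' \<ge> 0" using gg_bound[of 0] norm_ge_zero by (rule order_trans[rotated])
  show ?thesis
  proof (rule Bochner_Integration.integrable_bound)
    show "integrable lborel (\<lambda>\<xi>::real^'n. A' * decay c' \<xi>)" using integrable_decay[OF c'(1), where 'a="real^'n"] by simp
    show "ft (fy y) \<in> borel_measurable lborel" using ft_measurable[OF fy_measurable[OF y]] by simp
    have "norm (ft (fy y) \<xi>) \<le> norm (A' * decay c' \<xi>)" for \<xi>
    proof (cases "\<xi> \<in> closure \<Omega>")
      case True
      have "norm (ft (fy y) \<xi>) = norm (gg \<xi>) * exp (- (y \<bullet> \<xi>))" by (simp add: ft_fy[OF y] norm_mult)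
      also have "\<dots> \<le> A' * exp (- \<kappa> * norm \<xi>)" using gg_bound k(2)[OF True] by (intro mult_mono) (auto simp: A')
      also have "\<dots> \<le> A' * decay c' \<xi>" by (intro mult_left_mono c' A')
      finally show ?thesis using A' by (simp add: abs_of_nonneg decay_nonneg)
    qed (simp add: ft_fy[OF y] gg_support)
    then show "AE \<xi> in lborel. norm (ft (fy y) \<xi>) \<le> norm (A' * decay c' \<xi>)" by simp
  qed
qed

text \<open>Inversion written as a double transform, so that the square of the slice becomes the
  transform of a convolution to which Plancherel's inequality applies.\<close>

lemma fy_inversion: "y \<in> \<Omega> \<Longrightarrow> ft (ft (fy y)) (- x) = complex_of_real ((2 * pi) ^ CARD('n)) * fy y x"
proof -
  assume y: "y \<in> \<Omega>"
  have "norm (fy y x) \<le> A" for x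
    using dom[OF y, of x] mult_left_le[OF decay_le_1 A_nonneg, of c x] by (simp add: fy_def)
  moreover have "isCont (fy y) x" using fy_cont[OF y] by (simp add: continuous_on_eq_continuous_at)
  ultimately show ?thesis
    using fourier_inversion[OF fy_integrable[OF y] _ _ ft_fy_integrable[OF y], of A x]
    by (simp add: ft_def[of "ft (fy y)"] inner_commute)
qed

end

section \<open>The fourth power integral\<close>

definition convol :: "('a::euclidean_space \<Rightarrow> complex) \<Rightarrow> 'a \<Rightarrow> complex" where
  "convol G z = (LINT w|lborel. G w * G (z - w))"

lemma convol_pair_integrable:
  fixes G :: "'a::euclidean_space \<Rightarrow> complex"
  assumes G: "integrable lborel G"
  shows "integrable (lborel \<Otimes>\<^sub>M lborel) (\<lambda>(w, z). G w * G (z - w))"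
proof -
  have Gm[measurable]: "G \<in> borel_measurable borel" using G by simp
  have nG: "(\<lambda>z. complex_of_real (norm (G z))) \<in> borel_measurable borel" by measurable
  have n: "(LINT z|lborel. norm (G w * G (z - w))) = norm (G w) * (LINT z|lborel. norm (G z))" for w
  proof -
    have "(LINT z|lborel. complex_of_real (norm (G (z + - w)))) = (LINT z|lborel. complex_of_real (norm (G z)))"
      by (rule lborel_integral_translate[OF nG])
    then show ?thesis by (simp add: norm_mult)
  qed
  show ?thesis
  proof (rule lborel_pair.Fubini_integrable)
    show "(\<lambda>(w, z). G w * G (z - w)) \<in> borel_measurable (lborel \<Otimes>\<^sub>M lborel)" by measurable
    show "integrable lborel (\<lambda>w. LINT z|lborel. norm (case (w, z) of (w, z) \<Rightarrow> G w * G (z - w)))"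
      unfolding split n using G by simp
    show "AE w in lborel. integrable lborel (\<lambda>z. case (w, z) of (w, z) \<Rightarrow> G w * G (z - w))"
      using lborel_integrable_translate[OF G, of "- _"] by simp
  qed
qed

lemma convol_integrable: "integrable lborel G \<Longrightarrow> integrable lborel (convol G)"
  using lborel_pair.integrable_snd[OF convol_pair_integrable] by (simp add: convol_def[abs_def])

lemma ft_convol:
  fixes G :: "'a::euclidean_space \<Rightarrow> complex"
  assumes G: "integrable lborel G"
  shows "ft (convol G) \<xi> = (ft G \<xi>)\<^sup>2"
proof -
  have Gm[measurable]: "G \<in> borel_measurable borel" using G by simp
  have pm: "(\<lambda>(w, z). (G w * G (z - w)) * cis (- (z \<bullet> \<xi>))) \<in> borel_measurable (lborel \<Otimes>\<^sub>M lborel)" by measurable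
  have pi: "integrable (lborel \<Otimes>\<^sub>M lborel) (\<lambda>(w, z). (G w * G (z - w)) * cis (- (z \<bullet> \<xi>)))"
    by (rule Bochner_Integration.integrable_bound[OF convol_pair_integrable[OF G] pm]) (auto simp: norm_mult)
  have "ft (convol G) \<xi> = (LINT z|lborel. LINT w|lborel. (G w * G (z - w)) * cis (- (z \<bullet> \<xi>)))"
    unfolding ft_def convol_def by simp
  also have "\<dots> = (LINT w|lborel. LINT z|lborel. (G w * G (z - w)) * cis (- (z \<bullet> \<xi>)))"
    using lborel_pair.Fubini_integral[OF pi] .
  also have "\<dots> = (LINT w|lborel. (G w * cis (- (w \<bullet> \<xi>))) * ft G \<xi>)"
  proof (rule Bochner_Integration.integral_cong[OF refl])
    fix w
    have m: "(\<lambda>z. G z * cis (- (z \<bullet> \<xi>))) \<in> borel_measurable borel" by measurable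
    have "(LINT z|lborel. (G w * G (z - w)) * cis (- (z \<bullet> \<xi>))) = (LINT z|lborel. (G w * cis (- (w \<bullet> \<xi>))) * (G (z + - w) * cis (- ((z + - w) \<bullet> \<xi>))))"
    proof (rule Bochner_Integration.integral_cong[OF refl])
      fix z
      have "cis (- (z \<bullet> \<xi>)) = cis (- (w \<bullet> \<xi>)) * cis (- ((z - w) \<bullet> \<xi>))" by (simp add: cis_mult inner_diff_left)
      then show "(G w * G (z - w)) * cis (- (z \<bullet> \<xi>)) = (G w * cis (- (w \<bullet> \<xi>))) * (G (z + - w) * cis (- ((z + - w) \<bullet> \<xi>)))" by simp
    qed
    also have "\<dots> = (G w * cis (- (w \<bullet> \<xi>))) * (LINT z|lborel. G (z + - w) * cis (- ((z + - w) \<bullet> \<xi>)))"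
      by (rule integral_mult_right_zero)
    also have "(LINT z|lborel. G (z + - w) * cis (- ((z + - w) \<bullet> \<xi>))) = ft G \<xi>"
      unfolding ft_def by (rule lborel_integral_translate[OF m])
    finally show "(LINT z|lborel. (G w * G (z - w)) * cis (- (z \<bullet> \<xi>))) = (G w * cis (- (w \<bullet> \<xi>))) * ft G \<xi>" .
  qed
  also have "\<dots> = (ft G \<xi>)\<^sup>2" by (simp add: ft_def power2_eq_square)
  finally show ?thesis .
qed

context tube_cone
begin

section \<open>Homogeneity of the volume and of the Laplace transform\<close>

lemma closure_add: "u \<in> closure \<Omega> \<Longrightarrow> v \<in> closure \<Omega> \<Longrightarrow> u + v \<in> closure \<Omega>"
proof -
  assume uv: "u \<in> closure \<Omega>" "v \<in> closure \<Omega>"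
  have "(1 / real (Suc k)) *\<^sub>R e + u + v \<in> \<Omega>" for k
    using scale[OF _ e_in, of "1 / real (Suc k)"] uv by (intro add_closure) auto
  moreover have "(\<lambda>k. (1 / real (Suc k)) *\<^sub>R e + u + v) \<longlonglongrightarrow> 0 *\<^sub>R e + u + v"
    by (intro tendsto_intros LIMSEQ_Suc[OF lim_1_over_n])
  ultimately show ?thesis unfolding closure_sequential by (intro exI[of _ "\<lambda>k. (1 / real (Suc k)) *\<^sub>R e + u + v"]) simp
qed

lemma aut_inj:
  assumes "linear g" "g ` \<Omega> = \<Omega>" shows "inj g"
proof -
  have "\<Omega> \<subseteq> range g" using assms by blast
  moreover have "span \<Omega> = UNIV" using affine_hull_open[OF open_cone] affine_hull_subset_span[of \<Omega>] e_in by auto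
  moreover have "subspace (range g)" using assms(1) by (simp add: linear_subspace_image)
  ultimately have "surj g" by (metis span_minimal top.extremum_uniqueI)
  then show ?thesis using assms(1) linear_surjective_imp_injective by blast
qed

lemma aut_mem:
  assumes "linear g" "g ` \<Omega> = \<Omega>"
  shows "g x \<in> \<Omega> \<longleftrightarrow> x \<in> \<Omega>" "g x \<in> closure \<Omega> \<longleftrightarrow> x \<in> closure \<Omega>"
proof -
  note inj = aut_inj[OF assms]
  show "g x \<in> \<Omega> \<longleftrightarrow> x \<in> \<Omega>" using inj assms(2) by (metis inj_image_mem_iff)
  have "g ` closure \<Omega> = closure \<Omega>" using closure_injective_linear_image[OF assms(1) inj, of \<Omega>] assms(2) by simp
  then show "g x \<in> closure \<Omega> \<longleftrightarrow> x \<in> closure \<Omega>" using inj by (metis inj_image_mem_iff)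
qed

text \<open>Formed with the closed cone, because that is where \<open>gg\<close> is known to be
  supported.\<close>

definition V :: "real^'n \<Rightarrow> ennreal" where
  "V z = (\<integral>\<^sup>+w. indicator (closure \<Omega>) w * indicator (closure \<Omega>) (z - w) \<partial>lborel)"

definition L :: "real^'n \<Rightarrow> ennreal" where
  "L z = (\<integral>\<^sup>+y. indicator \<Omega> y * ennreal (exp (- 2 * (y \<bullet> z))) \<partial>lborel)"

lemma closure_borel [measurable]: "closure \<Omega> \<in> sets borel" by simp
lemma cone_borel [measurable]: "\<Omega> \<in> sets borel" using open_cone by simp

lemma VL_const:
  assumes "z \<in> \<Omega>" shows "V z * L z = V e * L e"
proof -
  obtain g g' J where g: "linear g" "g ` \<Omega> = \<Omega>" "has_modulus g J" and g': "linear g'" "g' ` \<Omega> = \<Omega>" "has_modulus g' J"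
    and adj: "\<And>x y. g x \<bullet> y = x \<bullet> g' y" and ge: "g e = z" using trans[OF assms] by blast
  have "V z = ennreal J * (\<integral>\<^sup>+w. indicator (closure \<Omega>) (g w) * indicator (closure \<Omega>) (z - g w) \<partial>lborel)"
    unfolding V_def by (rule has_modulus_integral[OF g(3)]) measurable
  also have "(\<integral>\<^sup>+w. indicator (closure \<Omega>) (g w) * indicator (closure \<Omega>) (z - g w) \<partial>lborel) = V e"
  proof -
    have "z - g w = g (e - w)" for w using g(1) ge by (simp add: linear_diff)
    then show ?thesis unfolding V_def by (intro nn_integral_cong) (auto simp: indicator_def aut_mem[OF g(1,2)])
  qed
  finally have V: "V z = ennreal J * V e" .
  have "L e = ennreal J * (\<integral>\<^sup>+y. indicator \<Omega> (g' y) * ennreal (exp (- 2 * (g' y \<bullet> e))) \<partial>lborel)"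
    unfolding L_def by (rule has_modulus_integral[OF g'(3)]) measurable
  also have "(\<integral>\<^sup>+y. indicator \<Omega> (g' y) * ennreal (exp (- 2 * (g' y \<bullet> e))) \<partial>lborel) = L z"
  proof -
    \<comment> \<open>The adjoint carries the Laplace transform at \<open>z\<close> back to
      \<open>e\<close>, so its factor \<open>J\<close> appears on the side opposite to that of the
      volume.\<close>
    have "g' y \<bullet> e = y \<bullet> z" for y using adj[of e y] ge by (simp add: inner_commute)
    then show ?thesis unfolding L_def by (intro nn_integral_cong) (auto simp: indicator_def aut_mem[OF g'(1,2)])
  qed
  finally have "L e = ennreal J * L z" .
  then show ?thesis unfolding V by (simp add: mult_ac)
qed

text \<open>By coercivity at \<open>e\<close>: if \<open>w\<close> and \<open>e - w\<close> are both
  in the closed cone, then \<open>e \<bullet> w \<le> e \<bullet> e\<close> bounds \<open>w\<close>;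
  and the exponential in \<open>L e\<close> decays with the norm.\<close>

lemma VL_finite: "V e * L e < \<infinity>"
proof -
  obtain \<kappa> where k: "\<kappa> > 0" "\<And>\<xi>. \<xi> \<in> closure \<Omega> \<Longrightarrow> e \<bullet> \<xi> \<ge> \<kappa> * norm \<xi>" using coercive[OF e_in] by blast
  obtain c where c: "c > 0" "\<And>x::real^'n. exp (- (2 * \<kappa>) * norm x) \<le> decay c x" using exp_norm_le_decay[of "2 * \<kappa>"] k(1) by auto
  have "V e \<le> (\<integral>\<^sup>+w. indicator (cball (0::real^'n) (e \<bullet> e / \<kappa>)) w \<partial>lborel)" unfolding V_def
  proof (rule nn_integral_mono)
    fix w
    have "norm w \<le> e \<bullet> e / \<kappa>" if "w \<in> closure \<Omega>" "e - w \<in> closure \<Omega>"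
    proof -
      have "e \<bullet> (e - w) \<ge> 0" using pos_nonneg[OF e_in that(2)] .
      then show ?thesis using k(2)[OF that(1)] k(1) by (simp add: inner_diff_right field_simps)
    qed
    then show "(indicator (closure \<Omega>) w * indicator (closure \<Omega>) (e - w) :: ennreal) \<le> indicator (cball 0 (e \<bullet> e / \<kappa>)) w"
      by (auto simp: indicator_def)
  qed
  also have "\<dots> < \<infinity>" using emeasure_bounded_finite[OF bounded_cball] by (subst nn_integral_indicator) auto
  finally have V: "V e < \<infinity>" .
  have "L e \<le> (\<integral>\<^sup>+y. ennreal (norm (decay c (y::real^'n))) \<partial>lborel)" unfolding L_def
  proof (rule nn_integral_mono)
    fix y
    have "exp (- 2 * (y \<bullet> e)) \<le> decay c y" if "y \<in> \<Omega>"
    proof -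
      have "y \<in> closure \<Omega>" using that closure_subset by blast
      then have "exp (- 2 * (y \<bullet> e)) \<le> exp (- (2 * \<kappa>) * norm y)" using k(2)[of y] by (simp add: inner_commute)
      then show ?thesis by (rule order_trans[OF _ c(2)])
    qed
    then show "indicator \<Omega> y * ennreal (exp (- 2 * (y \<bullet> e))) \<le> ennreal (norm (decay c y))"
      by (auto simp: indicator_def decay_nonneg intro!: ennreal_leI)
  qed
  also have "\<dots> < \<infinity>" using integrable_decay[OF c(1), where 'a="real^'n"] by (simp add: integrable_iff_bounded)
  finally show ?thesis using V by (simp add: ennreal_mult_less_top)
qed

text \<open>\<open>VL_const\<close> is available only on the open cone, whereas the convolution
  lives on the closed one; a convex set has negligible boundary.\<close>

lemma AE_interior: "AE z in lborel. z \<in> closure \<Omega> \<longrightarrow> z \<in> \<Omega>"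
proof -
  have "negligible (frontier \<Omega>)" by (rule negligible_convex_frontier[OF convex_cone])
  then have "frontier \<Omega> \<in> null_sets lebesgue" by (simp add: negligible_iff_null_sets)
  then have "frontier \<Omega> \<in> null_sets lborel" by (simp add: null_sets_completion_iff)
  then show ?thesis by (rule AE_I') (auto simp: frontier_def interior_open[OF open_cone])
qed

end

context nice_function
begin

text \<open>Plancherel's inequality at the heights \<open>e / (k + 1)\<close>, followed by Fatou's
  lemma as they tend to 0 and the exponential factor tends to 1.\<close>

lemma gg_L2:
  assumes M: "\<And>y. y \<in> \<Omega> \<Longrightarrow> (\<integral>\<^sup>+x. ennreal ((norm (f (complex_point x y)))\<^sup>2) \<partial>lborel) \<le> M"
  shows "(\<integral>\<^sup>+\<xi>. ennreal ((norm (gg \<xi>))\<^sup>2) \<partial>lborel) \<le> ennreal ((2 * pi) ^ CARD('n)) * M"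
proof -
  define yk where "yk k = (1 / real (Suc k)) *\<^sub>R e" for k
  have yk: "yk k \<in> \<Omega>" for k unfolding yk_def by (rule scaled_e)
  have [measurable]: "ft (fy (yk k)) \<in> borel_measurable borel" for k by (intro ft_measurable fy_measurable yk)
  have "(\<lambda>k. (exp (- (yk k \<bullet> \<xi>)))\<^sup>2 * (norm (gg \<xi>))\<^sup>2) \<longlonglongrightarrow> (exp (- ((0 *\<^sub>R e) \<bullet> \<xi>)))\<^sup>2 * (norm (gg \<xi>))\<^sup>2" for \<xi>
    unfolding yk_def by (intro tendsto_intros LIMSEQ_Suc[OF lim_1_over_n])
  then have "(\<lambda>k. ennreal ((norm (ft (fy (yk k)) \<xi>))\<^sup>2)) \<longlonglongrightarrow> ennreal ((norm (gg \<xi>))\<^sup>2)" for \<xi>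
    by (intro tendsto_ennrealI) (simp add: ft_fy[OF yk] norm_mult power_mult_distrib)
  then have "liminf (\<lambda>k. ennreal ((norm (ft (fy (yk k)) \<xi>))\<^sup>2)) = ennreal ((norm (gg \<xi>))\<^sup>2)" for \<xi>
    by (rule lim_imp_Liminf[OF sequentially_bot])
  then have "(\<integral>\<^sup>+\<xi>. ennreal ((norm (gg \<xi>))\<^sup>2) \<partial>lborel) = (\<integral>\<^sup>+\<xi>. liminf (\<lambda>k. ennreal ((norm (ft (fy (yk k)) \<xi>))\<^sup>2)) \<partial>lborel)"
    by simp
  also have "\<dots> \<le> liminf (\<lambda>k. \<integral>\<^sup>+\<xi>. ennreal ((norm (ft (fy (yk k)) \<xi>))\<^sup>2) \<partial>lborel)"
    by (rule nn_integral_liminf) measurable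
  also have "\<dots> \<le> ennreal ((2 * pi) ^ CARD('n)) * M"
  proof (rule order_trans[OF Liminf_le_Limsup[OF sequentially_bot] Limsup_bounded[OF always_eventually]], rule allI)
    fix k
    have "(\<integral>\<^sup>+\<xi>. ennreal ((norm (ft (fy (yk k)) \<xi>))\<^sup>2) \<partial>lborel) \<le> ennreal ((2 * pi) ^ DIM(real^'n)) * (\<integral>\<^sup>+x. ennreal ((norm (fy (yk k) x))\<^sup>2) \<partial>lborel)"
      by (rule plancherel_le[OF fy_integrable[OF yk]])
    also have "\<dots> \<le> ennreal ((2 * pi) ^ DIM(real^'n)) * M"
      unfolding fy_def by (intro mult_left_mono M yk) simp
    finally show "(\<integral>\<^sup>+\<xi>. ennreal ((norm (ft (fy (yk k)) \<xi>))\<^sup>2) \<partial>lborel) \<le> ennreal ((2 * pi) ^ CARD('n)) * M" by simp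
  qed
  finally show ?thesis .
qed

text \<open>The transform of the convolution is the square of \<open>(2 * pi) ^ CARD('n)\<close>
  times the slice, reflected; its squared modulus contains the fourth power of that constant, hence
  the exponent \<open>4 * CARD('n)\<close>.\<close>

lemma fourth_power_slice:
  assumes y: "y \<in> \<Omega>"
  shows "ennreal ((2 * pi) ^ (4 * CARD('n))) * (\<integral>\<^sup>+x. ennreal ((norm (f (complex_point x y))) ^ 4) \<partial>lborel)
     \<le> ennreal ((2 * pi) ^ CARD('n)) * (\<integral>\<^sup>+z. ennreal ((norm (convol (ft (fy y)) z))\<^sup>2) \<partial>lborel)"
proof -
  let ?G = "ft (fy y)"
  have Gi: "integrable lborel ?G" by (rule ft_fy_integrable[OF y])
  have Ci: "integrable lborel (convol ?G)" by (rule convol_integrable[OF Gi])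
  have [measurable]: "fy y \<in> borel_measurable borel" by (rule fy_measurable[OF y])
  have m: "(\<lambda>\<xi>. ennreal ((norm (ft (convol ?G) \<xi>))\<^sup>2)) \<in> borel_measurable borel"
    using ft_measurable[of "convol ?G"] Ci by simp
  have mm: "has_modulus (\<lambda>x::real^'n. - x) 1" by (rule has_modulus_isometry) (auto simp: linear_iff)
  have "ennreal ((2 * pi) ^ (4 * CARD('n))) * (\<integral>\<^sup>+x. ennreal ((norm (f (complex_point x y))) ^ 4) \<partial>lborel)
    = (\<integral>\<^sup>+x. ennreal ((2 * pi) ^ (4 * CARD('n))) * ennreal ((norm (fy y x)) ^ 4) \<partial>lborel)"
    unfolding fy_def[symmetric] by (rule nn_integral_cmult[symmetric]) measurable
  also have "\<dots> = (\<integral>\<^sup>+x. ennreal ((norm (ft (convol ?G) (- x)))\<^sup>2) \<partial>lborel)"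
  proof (rule nn_integral_cong)
    fix x
    have "norm (ft (convol ?G) (- x)) = ((2 * pi) ^ CARD('n) * norm (fy y x))\<^sup>2"
      unfolding ft_convol[OF Gi] fy_inversion[OF y] by (simp add: norm_mult norm_power)
    moreover have "(X\<^sup>2)\<^sup>2 = X ^ 4" for X :: real by (simp add: power2_eq_square power4_eq_xxxx mult.assoc)
    ultimately have "(norm (ft (convol ?G) (- x)))\<^sup>2 = ((2 * pi) ^ CARD('n) * norm (fy y x)) ^ 4" by simp
    then have "(norm (ft (convol ?G) (- x)))\<^sup>2 = (2 * pi) ^ (4 * CARD('n)) * (norm (fy y x)) ^ 4"
      by (simp only: power_mult_distrib[of _ "norm _"] power_mult[symmetric] mult.commute[of 4])
    then show "ennreal ((2 * pi) ^ (4 * CARD('n))) * ennreal ((norm (fy y x)) ^ 4) = ennreal ((norm (ft (convol ?G) (- x)))\<^sup>2)"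
      by (simp only:) (rule ennreal_mult[symmetric], simp_all)
  qed
  also have "\<dots> = (\<integral>\<^sup>+\<xi>. ennreal ((norm (ft (convol ?G) \<xi>))\<^sup>2) \<partial>lborel)"
    using has_modulus_integral[OF mm m] by simp
  also have "\<dots> \<le> ennreal ((2 * pi) ^ CARD('n)) * (\<integral>\<^sup>+z. ennreal ((norm (convol ?G z))\<^sup>2) \<partial>lborel)"
    using plancherel_le[OF Ci] by simp
  finally show ?thesis .
qed

definition N :: "real^'n \<Rightarrow> ennreal" where
  "N z = (\<integral>\<^sup>+w. ennreal ((norm (gg w))\<^sup>2) * ennreal ((norm (gg (z - w)))\<^sup>2) \<partial>lborel)"

lemma N_support: "z \<notin> closure \<Omega> \<Longrightarrow> N z = 0"
proof -
  assume z: "z \<notin> closure \<Omega>"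
  have zero: "ennreal ((norm (gg w))\<^sup>2) * ennreal ((norm (gg (z - w)))\<^sup>2) = 0" for w
  proof -
    have "w \<notin> closure \<Omega> \<or> z - w \<notin> closure \<Omega>" using z closure_add[of w "z - w"] by auto
    then show ?thesis using gg_support by auto
  qed
  show ?thesis unfolding N_def zero by simp
qed

lemma N_measurable [measurable]: "N \<in> borel_measurable borel"
  unfolding N_def[abs_def] by measurable

lemma V_measurable [measurable]: "V \<in> borel_measurable borel"
  unfolding V_def[abs_def] by measurable

lemma N_integral: "(\<integral>\<^sup>+z. N z \<partial>lborel) = (\<integral>\<^sup>+w. ennreal ((norm (gg w))\<^sup>2) \<partial>lborel)\<^sup>2"
proof -
  let ?I = "\<integral>\<^sup>+w. ennreal ((norm (gg w))\<^sup>2) \<partial>lborel"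
  have m: "(\<lambda>w. ennreal ((norm (gg w))\<^sup>2)) \<in> borel_measurable borel" by measurable
  have "(\<integral>\<^sup>+z. N z \<partial>lborel) = (\<integral>\<^sup>+w. \<integral>\<^sup>+z. ennreal ((norm (gg w))\<^sup>2) * ennreal ((norm (gg (z - w)))\<^sup>2) \<partial>lborel \<partial>lborel)"
    unfolding N_def by (rule lborel_pair.Fubini') measurable
  also have "\<dots> = (\<integral>\<^sup>+w. ennreal ((norm (gg w))\<^sup>2) * ?I \<partial>lborel)"
  proof (rule nn_integral_cong)
    fix w :: "real^'n"
    have "(\<integral>\<^sup>+z. ennreal ((norm (gg (z + - w)))\<^sup>2) \<partial>lborel) = ?I" by (rule nn_integral_lborel_translate[OF m])
    then show "(\<integral>\<^sup>+z. ennreal ((norm (gg w))\<^sup>2) * ennreal ((norm (gg (z - w)))\<^sup>2) \<partial>lborel) = ennreal ((norm (gg w))\<^sup>2) * ?I"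
      by (subst nn_integral_cmult) auto
  qed
  also have "\<dots> = ?I\<^sup>2" by (subst nn_integral_multc) (auto simp: power2_eq_square)
  finally show ?thesis .
qed

text \<open>The exponentials of \<open>w\<close> and \<open>z - w\<close> multiply to one in
  \<open>z\<close> alone. The Cauchy-Schwarz inequality then separates the indicator of the support,
  which gives \<open>V z\<close>, from the product of the values of \<open>gg\<close>.\<close>

lemma convol_bound:
  assumes y: "y \<in> \<Omega>"
  shows "ennreal ((norm (convol (ft (fy y)) z))\<^sup>2) \<le> ennreal (exp (- 2 * (y \<bullet> z))) * (V z * N z)"
proof -
  let ?I = "\<lambda>w. indicator (closure \<Omega>) w * indicator (closure \<Omega>) (z - w) :: ennreal"
  let ?a = "\<lambda>w. ennreal (norm (gg w)) * ennreal (norm (gg (z - w)))"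
  have Im: "?I \<in> borel_measurable lborel" and am: "?a \<in> borel_measurable lborel" by measurable
  have pt: "ennreal (norm (ft (fy y) w * ft (fy y) (z - w))) = ennreal (exp (- (y \<bullet> z))) * (?I w * ?a w)" for w
  proof -
    have "norm (ft (fy y) w * ft (fy y) (z - w)) = exp (- (y \<bullet> w)) * exp (- (y \<bullet> (z - w))) * (norm (gg w) * norm (gg (z - w)))"
      by (simp add: ft_fy[OF y] norm_mult)
    also have "exp (- (y \<bullet> w)) * exp (- (y \<bullet> (z - w))) = exp (- (y \<bullet> z))"
      by (simp add: exp_add[symmetric] inner_diff_right)
    finally have "ennreal (norm (ft (fy y) w * ft (fy y) (z - w))) = ennreal (exp (- (y \<bullet> z))) * ?a w"
      by (simp add: ennreal_mult)
    moreover have "?a w = ?I w * ?a w"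
      using gg_support[of w] gg_support[of "z - w"] by (auto simp: indicator_def)
    ultimately show ?thesis by simp
  qed
  have "ennreal (norm (convol (ft (fy y)) z)) \<le> (\<integral>\<^sup>+w. ennreal (norm (ft (fy y) w * ft (fy y) (z - w))) \<partial>lborel)"
  proof (cases "integrable lborel (\<lambda>w. ft (fy y) w * ft (fy y) (z - w))")
    case True
    then show ?thesis unfolding convol_def by (rule integral_norm_bound_ennreal)
  next
    case False
    then show ?thesis unfolding convol_def by (simp add: not_integrable_integral_eq)
  qed
  also have "\<dots> = ennreal (exp (- (y \<bullet> z))) * (\<integral>\<^sup>+w. ?I w * ?a w \<partial>lborel)"
    unfolding pt by (rule nn_integral_cmult) measurable
  finally have "(ennreal (norm (convol (ft (fy y)) z)))\<^sup>2 \<le> (ennreal (exp (- (y \<bullet> z))) * (\<integral>\<^sup>+w. ?I w * ?a w \<partial>lborel))\<^sup>2"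
    by (rule power_mono) simp
  also have "\<dots> = ennreal (exp (- 2 * (y \<bullet> z))) * (\<integral>\<^sup>+w. ?I w * ?a w \<partial>lborel)\<^sup>2"
    by (simp add: power_mult_distrib ennreal_power exp_double[symmetric])
  also have "\<dots> \<le> ennreal (exp (- 2 * (y \<bullet> z))) * ((\<integral>\<^sup>+w. (?I w)\<^sup>2 \<partial>lborel) * (\<integral>\<^sup>+w. (?a w)\<^sup>2 \<partial>lborel))"
    by (rule mult_left_mono[OF Cauchy_Schwarz_nn_integral[OF Im am]]) simp
  also have "(\<integral>\<^sup>+w. (?I w)\<^sup>2 \<partial>lborel) = V z" unfolding V_def by (intro nn_integral_cong) (auto simp: indicator_def)
  also have "(\<integral>\<^sup>+w. (?a w)\<^sup>2 \<partial>lborel) = N z" unfolding N_def by (intro nn_integral_cong) (simp add: power_mult_distrib ennreal_power)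
  finally show ?thesis by (simp add: ennreal_power)
qed

lemma fourth_power_measurable:
  "(\<lambda>p. indicator \<Omega> (snd p) * ennreal ((norm (f (complex_point (fst p) (snd p)))) ^ 4)) \<in> borel_measurable (borel \<Otimes>\<^sub>M borel)"
proof -
  have o: "open (UNIV \<times> \<Omega> :: ((real^'n) \<times> (real^'n)) set)" using open_cone by (intro open_Times) auto
  have "(\<lambda>p. indicator (UNIV \<times> \<Omega>) p *\<^sub>R (norm (f (complex_point (fst p) (snd p)))) ^ 4) \<in> borel_measurable borel"
    using o by (intro borel_measurable_continuous_on_indicator continuous_intros tube_continuous[OF hol]) auto
  then have "(\<lambda>p. ennreal (indicator (UNIV \<times> \<Omega>) p *\<^sub>R (norm (f (complex_point (fst p) (snd p)))) ^ 4)) \<in> borel_measurable borel"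
    by measurable
  moreover have "(\<lambda>p. ennreal (indicator (UNIV \<times> \<Omega>) p *\<^sub>R (norm (f (complex_point (fst p) (snd p)))) ^ 4))
     = (\<lambda>p. indicator \<Omega> (snd p) * ennreal ((norm (f (complex_point (fst p) (snd p)))) ^ 4))"
    by (auto simp: indicator_def fun_eq_iff)
  ultimately show ?thesis unfolding borel_prod by (simp only:)
qed

text \<open>Integrating over \<open>y\<close> before \<open>z\<close> produces \<open>L z\<close>,
  which meets \<open>V z\<close> in a product constant almost everywhere on the support of
  \<open>N\<close>; what remains is the integral of \<open>N\<close>.\<close>

lemma fourth_power_bound:
  assumes M: "\<And>y. y \<in> \<Omega> \<Longrightarrow> (\<integral>\<^sup>+x. ennreal ((norm (f (complex_point x y)))\<^sup>2) \<partial>lborel) \<le> M"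
  shows "ennreal ((2 * pi) ^ (4 * CARD('n))) *
      (\<integral>\<^sup>+p. indicator \<Omega> (snd p) * ennreal ((norm (f (complex_point (fst p) (snd p)))) ^ 4) \<partial>lborel)
    \<le> ennreal ((2 * pi) ^ CARD('n)) * ((V e * L e) * (ennreal ((2 * pi) ^ CARD('n)) * M)\<^sup>2)"
proof -
  let ?P = "ennreal ((2 * pi) ^ (4 * CARD('n)))" and ?R = "ennreal ((2 * pi) ^ CARD('n))"
  let ?f = "\<lambda>x y. ennreal ((norm (f (complex_point x y))) ^ 4)"
  have "(\<integral>\<^sup>+p. indicator \<Omega> (snd p) * ?f (fst p) (snd p) \<partial>lborel) = (\<integral>\<^sup>+y. \<integral>\<^sup>+x. indicator \<Omega> y * ?f x y \<partial>lborel \<partial>lborel)"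
    unfolding lborel_prod[symmetric]
  proof (subst lborel_pair.nn_integral_snd[symmetric])
    have "borel_measurable (lborel \<Otimes>\<^sub>M lborel) = (borel_measurable (borel \<Otimes>\<^sub>M borel) :: ((real^'n) \<times> (real^'n) \<Rightarrow> ennreal) set)"
      by (intro measurable_cong_sets sets_pair_measure_cong) auto
    then show "(\<lambda>p. indicator \<Omega> (snd p) * ?f (fst p) (snd p)) \<in> borel_measurable (lborel \<Otimes>\<^sub>M lborel)"
      using fourth_power_measurable by (simp only:)
  qed simp
  then have "?P * (\<integral>\<^sup>+p. indicator \<Omega> (snd p) * ?f (fst p) (snd p) \<partial>lborel) = (\<integral>\<^sup>+y. ?P * (\<integral>\<^sup>+x. indicator \<Omega> y * ?f x y \<partial>lborel) \<partial>lborel)"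
  proof -
    have "(\<lambda>y. \<integral>\<^sup>+x. indicator \<Omega> y * ?f x y \<partial>lborel) \<in> borel_measurable lborel"
    proof (rule lborel.borel_measurable_nn_integral)
      have "(\<lambda>q. (snd q, fst q)) \<in> borel \<Otimes>\<^sub>M borel \<rightarrow>\<^sub>M borel \<Otimes>\<^sub>M borel" by measurable
      from measurable_compose[OF this fourth_power_measurable]
      show "(\<lambda>(y, x). indicator \<Omega> y * ?f x y) \<in> borel_measurable (lborel \<Otimes>\<^sub>M lborel)"
        by (simp add: split_beta' cong: measurable_cong_sets)
    qed
    moreover assume "(\<integral>\<^sup>+p. indicator \<Omega> (snd p) * ?f (fst p) (snd p) \<partial>lborel) = (\<integral>\<^sup>+y. \<integral>\<^sup>+x. indicator \<Omega> y * ?f x y \<partial>lborel \<partial>lborel)"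
    ultimately show ?thesis by (simp only: nn_integral_cmult)
  qed
  also have "\<dots> \<le> (\<integral>\<^sup>+y. \<integral>\<^sup>+z. ?R * (V z * N z * (indicator \<Omega> y * ennreal (exp (- 2 * (y \<bullet> z))))) \<partial>lborel \<partial>lborel)"
  proof (rule nn_integral_mono)
    fix y
    show "?P * (\<integral>\<^sup>+x. indicator \<Omega> y * ?f x y \<partial>lborel) \<le> (\<integral>\<^sup>+z. ?R * (V z * N z * (indicator \<Omega> y * ennreal (exp (- 2 * (y \<bullet> z))))) \<partial>lborel)"
    proof (cases "y \<in> \<Omega>")
      case True
      have "?P * (\<integral>\<^sup>+x. ?f x y \<partial>lborel) \<le> ?R * (\<integral>\<^sup>+z. ennreal ((norm (convol (ft (fy y)) z))\<^sup>2) \<partial>lborel)"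
        by (rule fourth_power_slice[OF True])
      also have "\<dots> \<le> ?R * (\<integral>\<^sup>+z. ennreal (exp (- 2 * (y \<bullet> z))) * (V z * N z) \<partial>lborel)"
        by (intro mult_left_mono nn_integral_mono convol_bound True) simp
      also have "\<dots> = (\<integral>\<^sup>+z. ?R * (ennreal (exp (- 2 * (y \<bullet> z))) * (V z * N z)) \<partial>lborel)"
        by (rule nn_integral_cmult[symmetric]) measurable
      finally show ?thesis using True by (simp add: mult_ac)
    qed simp
  qed
  also have "\<dots> = (\<integral>\<^sup>+z. \<integral>\<^sup>+y. ?R * (V z * N z * (indicator \<Omega> y * ennreal (exp (- 2 * (y \<bullet> z))))) \<partial>lborel \<partial>lborel)"
    by (rule lborel_pair.Fubini') measurable
  also have "\<dots> = (\<integral>\<^sup>+z. ?R * (V z * N z * L z) \<partial>lborel)"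
    unfolding L_def by (subst nn_integral_cmult, measurable, subst nn_integral_cmult, measurable)
  also have "\<dots> \<le> (\<integral>\<^sup>+z. ?R * ((V e * L e) * N z) \<partial>lborel)"
  proof (rule nn_integral_mono_AE)
    show "AE z in lborel. ?R * (V z * N z * L z) \<le> ?R * ((V e * L e) * N z)"
      using AE_interior
    proof eventually_elim
      fix z assume z: "z \<in> closure \<Omega> \<longrightarrow> z \<in> \<Omega>"
      show "?R * (V z * N z * L z) \<le> ?R * ((V e * L e) * N z)"
      proof (cases "z \<in> \<Omega>")
        case True
        then have "V z * N z * L z = (V e * L e) * N z" using VL_const[OF True] by (metis mult.assoc mult.commute)
        then show ?thesis by simp
      next
        case False
        then show ?thesis using N_support z by simp
      qed
    qed
  qed
  also have "\<dots> = ?R * ((V e * L e) * (\<integral>\<^sup>+z. N z \<partial>lborel))"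
    by (subst nn_integral_cmult, measurable, subst nn_integral_cmult, measurable)
  also have "\<dots> \<le> ?R * ((V e * L e) * (?R * M)\<^sup>2)"
    unfolding N_integral by (intro mult_left_mono power_mono gg_L2 M) auto
  finally show ?thesis .
qed

end

section \<open>Approximation and transport\<close>

lemma tube_domainE:
  assumes "z \<in> tube_domain \<Omega>" obtains x y where "z = complex_point x y" "y \<in> \<Omega>"
  using assms by (auto simp: tube_domain_def)

lemma holomorphic_multi_on_const: "holomorphic_multi_on (\<lambda>z. k) D"
  unfolding holomorphic_multi_on_def by (auto intro!: exI[of _ "\<lambda>v. 0"] derivative_eq_intros)

lemma holomorphic_multi_on_mult:
  assumes "holomorphic_multi_on F D" "holomorphic_multi_on G D"
  shows "holomorphic_multi_on (\<lambda>z. F z * G z) D"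
  unfolding holomorphic_multi_on_def
proof
  fix z assume z: "z \<in> D"
  obtain F' where F': "(F has_derivative F') (at z)" "\<And>c v. F' (c *s v) = c * F' v"
    using assms(1) z unfolding holomorphic_multi_on_def by blast
  obtain G' where G': "(G has_derivative G') (at z)" "\<And>c v. G' (c *s v) = c * G' v"
    using assms(2) z unfolding holomorphic_multi_on_def by blast
  show "\<exists>H'. ((\<lambda>z. F z * G z) has_derivative H') (at z) \<and> (\<forall>c v. H' (c *s v) = c * H' v)"
    by (rule exI, rule conjI, rule has_derivative_mult[OF F'(1) G'(1)]) (simp add: F'(2) G'(2) algebra_simps)
qed

lemma holomorphic_multi_on_inverse:
  assumes "holomorphic_multi_on F D" "\<And>z. z \<in> D \<Longrightarrow> F z \<noteq> 0"
  shows "holomorphic_multi_on (\<lambda>z. inverse (F z)) D"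
  unfolding holomorphic_multi_on_def
proof
  fix z assume z: "z \<in> D"
  obtain F' where F': "(F has_derivative F') (at z)" "\<And>c v. F' (c *s v) = c * F' v"
    using assms(1) z unfolding holomorphic_multi_on_def by blast
  show "\<exists>H'. ((\<lambda>z. inverse (F z)) has_derivative H') (at z) \<and> (\<forall>c v. H' (c *s v) = c * H' v)"
    by (rule exI, rule conjI, rule Deriv.has_derivative_inverse[OF assms(2)[OF z] F'(1)]) (simp add: F'(2))
qed

lemma holomorphic_multi_on_prod:
  assumes "finite I" "\<And>i. i \<in> I \<Longrightarrow> holomorphic_multi_on (F i) D"
  shows "holomorphic_multi_on (\<lambda>z. \<Prod>i\<in>I. F i z) D"
  using assms
  by (induction I rule: finite_induct) (auto intro: holomorphic_multi_on_const holomorphic_multi_on_mult)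

lemma holomorphic_multi_on_linear_compose:
  fixes T :: "complex^'n \<Rightarrow> complex^'m"
  assumes hol: "holomorphic_multi_on F D'" and T: "linear T" "\<And>c v. T (c *s v) = c *s T v"
    and sub: "\<And>z. z \<in> D \<Longrightarrow> w + T z \<in> D'"
  shows "holomorphic_multi_on (\<lambda>z. F (w + T z)) D"
  unfolding holomorphic_multi_on_def
proof
  fix z assume z: "z \<in> D"
  obtain F' where F': "(F has_derivative F') (at (w + T z))" "\<And>c v. F' (c *s v) = c * F' v"
    using hol sub[OF z] unfolding holomorphic_multi_on_def by blast
  have "((\<lambda>z. w + T z) has_derivative T) (at z)"
    using has_derivative_add[OF has_derivative_const bounded_linear_imp_has_derivative, of T w "at z"] T(1)
    by (simp add: linear_conv_bounded_linear)
  from has_derivative_compose[OF this F'(1)]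
  show "\<exists>H'. ((\<lambda>z. F (w + T z)) has_derivative H') (at z) \<and> (\<forall>c v. H' (c *s v) = c * H' v)"
    by (intro exI conjI) (auto simp: T(2) F'(2))
qed

text \<open>The affine function 1 - i \<epsilon> z.v. For \<open>v\<close> in the cone and
  \<epsilon> nonnegative its real part is at least 1 on the tube by self-duality, so its inverse is
  holomorphic and of modulus at most 1.\<close>

definition damp_factor :: "real \<Rightarrow> real^'n \<Rightarrow> complex^'n \<Rightarrow> complex" where
  "damp_factor \<epsilon> v z = 1 - \<i> * complex_of_real \<epsilon> * (\<Sum>j\<in>UNIV. z $ j * complex_of_real (v $ j))"

lemma damp_factor_point:
  "damp_factor \<epsilon> v (complex_point x y) = Complex (1 + \<epsilon> * (y \<bullet> v)) (- (\<epsilon> * (x \<bullet> v)))"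
proof -
  have "(\<Sum>j\<in>UNIV. complex_point x y $ j * complex_of_real (v $ j)) = Complex (x \<bullet> v) (y \<bullet> v)"
    by (simp add: complex_eq_iff complex_point_def inner_vec_def)
  then show ?thesis unfolding damp_factor_def by (simp add: complex_eq_iff)
qed

lemma holomorphic_damp_factor:
  fixes v :: "real^'n"
  shows "holomorphic_multi_on (damp_factor \<epsilon> v) D"
  unfolding holomorphic_multi_on_def
proof
  fix z :: "complex^'n"
  let ?T = "\<lambda>z::complex^'n. - (\<i> * complex_of_real \<epsilon>) * (\<Sum>j\<in>UNIV. z $ j * complex_of_real (v $ j))"
  have T: "linear ?T"
  proof (rule linearI)
    show "?T (u + w) = ?T u + ?T w" for u w by (simp add: distrib_right sum.distrib distrib_left)
    show "?T (r *\<^sub>R u) = r *\<^sub>R ?T u" for r u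
      unfolding vector_scaleR_component by (simp add: scaleR_conv_of_real sum_distrib_left mult_ac)
  qed
  have der: "((\<lambda>z. 1 + ?T z) has_derivative ?T) (at z)"
    using has_derivative_add[OF has_derivative_const bounded_linear_imp_has_derivative, of ?T 1 "at z"] T
    unfolding linear_conv_bounded_linear by simp
  have eq: "damp_factor \<epsilon> v = (\<lambda>z. 1 + ?T z)" by (auto simp: damp_factor_def)
  have mult: "?T (c *s u) = c * ?T u" for c u by (simp add: sum_distrib_left mult_ac)
  show "\<exists>H'. (damp_factor \<epsilon> v has_derivative H') (at z) \<and> (\<forall>c v. H' (c *s v) = c * H' v)"
    unfolding eq by (rule exI[of _ ?T], rule conjI, rule der) (intro allI mult)
qed

text \<open>The product of two factors per basis vector makes the decay explicit without choosing a basis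
  inside the cone: \<open>e + s b\<close> and \<open>e - s b\<close> cannot both be almost orthogonal to \<open>x\<close> unless \<open>b\<close> is.\<close>

definition damp :: "real^'n \<Rightarrow> real \<Rightarrow> real \<Rightarrow> complex^'n \<Rightarrow> complex" where
  "damp e s \<epsilon> z = (\<Prod>b\<in>Basis. inverse (damp_factor \<epsilon> (e + s *\<^sub>R b) z * damp_factor \<epsilon> (e - s *\<^sub>R b) z)
     * inverse (damp_factor \<epsilon> (e + s *\<^sub>R b) z * damp_factor \<epsilon> (e - s *\<^sub>R b) z))"

context tube_cone
begin

lemma damp_factor_norm:
  assumes "y \<in> \<Omega>" "v \<in> \<Omega>" "\<epsilon> \<ge> 0"
  shows "(norm (damp_factor \<epsilon> v (complex_point x y)))\<^sup>2 \<ge> 1 + (\<epsilon> * (x \<bullet> v))\<^sup>2"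
proof -
  have "v \<in> closure \<Omega>" using assms closure_subset by blast
  then have "\<epsilon> * (y \<bullet> v) \<ge> 0" using pos_nonneg[OF assms(1)] assms(3) by simp
  then have "1\<^sup>2 \<le> (1 + \<epsilon> * (y \<bullet> v))\<^sup>2" by (intro power_mono) auto
  then show ?thesis by (simp add: damp_factor_point cmod_power2)
qed

lemma damp_factor_nonzero:
  assumes "y \<in> \<Omega>" "v \<in> \<Omega>" "\<epsilon> \<ge> 0"
  shows "damp_factor \<epsilon> v (complex_point x y) \<noteq> 0"
proof
  assume "damp_factor \<epsilon> v (complex_point x y) = 0"
  then have "1 + (\<epsilon> * (x \<bullet> v))\<^sup>2 \<le> 0" using damp_factor_norm[OF assms, of x] by simp
  then show False using zero_le_power2[of "\<epsilon> * (x \<bullet> v)"] by linarith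
qed

lemma damp_holomorphic:
  assumes s: "\<And>b. b \<in> Basis \<Longrightarrow> e + s *\<^sub>R b \<in> \<Omega> \<and> e - s *\<^sub>R b \<in> \<Omega>" and "\<epsilon> \<ge> 0"
  shows "holomorphic_multi_on (damp e s \<epsilon>) (tube_domain \<Omega>)"
  unfolding damp_def[abs_def] using damp_factor_nonzero[OF _ _ assms(2)] s
  by (intro holomorphic_multi_on_prod holomorphic_multi_on_mult holomorphic_multi_on_inverse holomorphic_damp_factor)
     (auto simp: tube_domain_def)

lemma damp_norm:
  assumes s: "\<And>b. b \<in> Basis \<Longrightarrow> e + s *\<^sub>R b \<in> \<Omega> \<and> e - s *\<^sub>R b \<in> \<Omega>" and eps: "\<epsilon> \<ge> 0" and y: "y \<in> \<Omega>"
  shows "norm (damp e s \<epsilon> (complex_point x y)) \<le> decay (\<epsilon> * s) x"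
  unfolding damp_def decay_def prod_norm[symmetric]
proof (intro prod_mono conjI)
  fix b :: "real^'n" assume b: "b \<in> Basis"
  let ?p = "damp_factor \<epsilon> (e + s *\<^sub>R b) (complex_point x y)" and ?q = "damp_factor \<epsilon> (e - s *\<^sub>R b) (complex_point x y)"
  define P where "P = \<epsilon> * (x \<bullet> (e + s *\<^sub>R b))"
  define Q where "Q = \<epsilon> * (x \<bullet> (e - s *\<^sub>R b))"
  have p: "(norm ?p)\<^sup>2 \<ge> 1 + P\<^sup>2" and q: "(norm ?q)\<^sup>2 \<ge> 1 + Q\<^sup>2"
    using damp_factor_norm[OF y _ eps] s[OF b] by (auto simp: P_def Q_def)
  have PQ: "\<epsilon> * s * (x \<bullet> b) = (P - Q) / 2" by (simp add: P_def Q_def inner_add_right inner_diff_right algebra_simps)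
  have "1 + (\<epsilon> * s * (x \<bullet> b))\<^sup>2 \<le> 1 + P\<^sup>2 + Q\<^sup>2"
  proof -
    have "((P - Q) / 2)\<^sup>2 + (((P + Q) / 2)\<^sup>2 + (P\<^sup>2 + Q\<^sup>2) / 2) = P\<^sup>2 + Q\<^sup>2" by (simp add: power2_eq_square field_simps)
    moreover have "((P + Q) / 2)\<^sup>2 + (P\<^sup>2 + Q\<^sup>2) / 2 \<ge> 0" by (intro add_nonneg_nonneg) auto
    moreover have "1 + u \<le> 1 + p + q" if "u + w = p + q" "w \<ge> 0" for u w p q :: real using that by linarith
    ultimately show ?thesis unfolding PQ by blast
  qed
  also have "\<dots> \<le> (1 + P\<^sup>2) * (1 + Q\<^sup>2)" by (simp add: algebra_simps)
  also have "\<dots> \<le> (norm ?p)\<^sup>2 * (norm ?q)\<^sup>2" using p q by (intro mult_mono) auto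
  \<comment> \<open>Squares of norms arise because \<open>damp\<close> contains each inverse
    twice.\<close>
  also have "\<dots> = norm (?p * ?q) * norm (?p * ?q)" by (simp add: norm_mult power2_eq_square mult_ac)
  finally have "inverse (norm (?p * ?q) * norm (?p * ?q)) \<le> inverse (1 + (\<epsilon> * s * (x \<bullet> b))\<^sup>2)"
    by (intro le_imp_inverse_le) (auto simp: add_pos_nonneg)
  then show "norm (inverse (?p * ?q) * inverse (?p * ?q)) \<le> inverse (1 + (\<epsilon> * s * (x \<bullet> b))\<^sup>2)"
    by (simp add: norm_mult norm_inverse)
qed simp

lemma damp_limit: "(\<lambda>k. damp e s (1 / real (Suc k)) z) \<longlonglongrightarrow> 1"
proof -
  have f: "(\<lambda>k. damp_factor (1 / real (Suc k)) v z) \<longlonglongrightarrow> 1 - \<i> * complex_of_real 0 * (\<Sum>j\<in>UNIV. z $ j * complex_of_real (v $ j))" for v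
    unfolding damp_factor_def by (intro tendsto_intros LIMSEQ_Suc[OF lim_1_over_n])
  have "(\<lambda>k. damp e s (1 / real (Suc k)) z) \<longlonglongrightarrow> (\<Prod>b\<in>(Basis :: (real^'n) set). inverse (1 * 1) * inverse (1 * 1))"
    unfolding damp_def by (intro tendsto_prod tendsto_mult tendsto_inverse) (use f in auto)
  then show ?thesis by simp
qed

text \<open>The point bound degenerates at the boundary, where balls in the cone shrink. Shifting by
  a multiple of \<open>e\<close> leaves room for a ball of fixed radius at every point and samples
  only slices already bounded by \<open>M\<close>; the damping only decreases moduli.\<close>

lemma hardy_fourth_power:
  assumes hol: "holomorphic_multi_on F (tube_domain \<Omega>)" and "M < \<infinity>"
    and M: "\<And>t. t \<in> \<Omega> \<Longrightarrow> (\<integral>\<^sup>+x. ennreal ((norm (F (complex_point x t)))\<^sup>2) \<partial>lborel) \<le> M"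
  shows "ennreal ((2 * pi) ^ (4 * CARD('n))) *
      (\<integral>\<^sup>+p. indicator \<Omega> (snd p) * ennreal ((norm (F (complex_point (fst p) (snd p)))) ^ 4) \<partial>lborel)
    \<le> ennreal ((2 * pi) ^ CARD('n)) * ((V e * L e) * (ennreal ((2 * pi) ^ CARD('n)) * M)\<^sup>2)" (is "?P * _ \<le> ?B")
proof -
  obtain d where d: "d > 0" "ball e d \<subseteq> \<Omega>" using open_cone e_in by (meson open_contains_ball)
  define s where "s = d / 2"
  have s: "e + s *\<^sub>R b \<in> \<Omega> \<and> e - s *\<^sub>R b \<in> \<Omega>" if "b \<in> Basis" for b
    using d that by (auto simp: s_def dist_norm intro!: subsetD[OF d(2)])
  have s0: "s > 0" using d by (simp add: s_def)
  define \<delta> where "\<delta> k = 1 / real (Suc k)" for k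
  have \<delta>: "\<delta> k > 0" for k by (simp add: \<delta>_def)
  define f where "f k z = F (complex_point 0 (\<delta> k *\<^sub>R e) + z) * damp e s (\<delta> k) z" for k z
  have shift: "complex_point 0 (\<delta> k *\<^sub>R e) + complex_point x y = complex_point x (y + \<delta> k *\<^sub>R e)" for k x y
    by (simp add: complex_point_add[symmetric] add.commute)
  have yin: "y + \<delta> k *\<^sub>R e \<in> \<Omega>" if "y \<in> \<Omega>" for k y using that scale[OF \<delta> e_in] by (intro add_cone)
  \<comment> \<open>The ball of radius \<open>d\<close> around \<open>e\<close>, scaled by
    \<open>\<delta> k\<close> and translated by \<open>y\<close>.\<close>
  have ballin: "ball (y + \<delta> k *\<^sub>R e) (\<delta> k * d) \<subseteq> \<Omega>" if y: "y \<in> \<Omega>" for k y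
  proof
    fix w assume w: "w \<in> ball (y + \<delta> k *\<^sub>R e) (\<delta> k * d)"
    define u where "u = (1 / \<delta> k) *\<^sub>R (w - y)"
    have wu: "w = y + \<delta> k *\<^sub>R u" using \<delta>[of k] by (simp add: u_def)
    have "norm (\<delta> k *\<^sub>R (e - u)) < \<delta> k * d" using w by (simp add: wu dist_norm scaleR_diff_right)
    then have "norm (e - u) < d" using \<delta>[of k] by simp
    then have "u \<in> \<Omega>" using d by (auto simp: dist_norm)
    then show "w \<in> \<Omega>" unfolding wu by (intro add_cone y scale \<delta>)
  qed
  have nice: "\<exists>A. nice_function \<Omega> e (f k) A (\<delta> k * s)" for k
  proof -
    obtain C where C: "C > 0" "\<And>x y. ball y (\<delta> k * d) \<subseteq> \<Omega> \<Longrightarrow> ennreal ((norm (F (complex_point x y)))\<^sup>2) \<le> ennreal C * M"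
      using hardy_point_bound[of "\<delta> k * d", where 'n='n] \<delta>[of k] d hol M by (metis mult_pos_pos)
    define A where "A = sqrt (C * enn2real M)"
    have Fb: "norm (F (complex_point x (y + \<delta> k *\<^sub>R e))) \<le> A" if "y \<in> \<Omega>" for x y
    proof -
      have "ennreal ((norm (F (complex_point x (y + \<delta> k *\<^sub>R e))))\<^sup>2) \<le> ennreal C * M" by (rule C(2)[OF ballin[OF that]])
      also have "ennreal C * M = ennreal (C * enn2real M)" using assms(2) C(1) by (simp add: ennreal_mult)
      finally have "(norm (F (complex_point x (y + \<delta> k *\<^sub>R e))))\<^sup>2 \<le> C * enn2real M" using C(1) by (simp add: ennreal_le_iff)
      then show ?thesis unfolding A_def by (rule real_le_rsqrt)
    qed
    have "nice_function \<Omega> e (f k) A (\<delta> k * s)"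
    proof unfold_locales
      have "holomorphic_multi_on (\<lambda>z. F (complex_point 0 (\<delta> k *\<^sub>R e) + z)) (tube_domain \<Omega>)"
        by (rule holomorphic_multi_on_linear_compose[OF hol linear_ident]) (auto elim!: tube_domainE simp: shift yin)
      then show "holomorphic_multi_on (f k) (tube_domain \<Omega>)"
        unfolding f_def using \<delta>[of k] by (intro holomorphic_multi_on_mult damp_holomorphic s) auto
      show "\<delta> k * s > 0" using \<delta> s0 by simp
      show "norm (f k (complex_point x y)) \<le> A * decay (\<delta> k * s) x" if "y \<in> \<Omega>" for x y
        unfolding f_def norm_mult shift using Fb[OF that] damp_norm[OF s _ that] \<delta>[of k]
        by (intro mult_mono) (auto intro: order_trans[OF norm_ge_zero] less_imp_le)
    qed
    then show ?thesis by blast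
  qed
  have fle: "(norm (f k (complex_point x y)))\<^sup>2 \<le> (norm (F (complex_point x (y + \<delta> k *\<^sub>R e))))\<^sup>2" if "y \<in> \<Omega>" for k x y
  proof -
    have "norm (damp e s (\<delta> k) (complex_point x y)) \<le> 1"
      using damp_norm[OF s _ that, of "\<delta> k" x] \<delta>[of k] decay_le_1[of "\<delta> k * s" x] by simp
    then have "norm (f k (complex_point x y)) \<le> norm (F (complex_point x (y + \<delta> k *\<^sub>R e)))"
      unfolding f_def norm_mult shift by (intro mult_left_le) auto
    then show ?thesis by (intro power_mono) auto
  qed
  have Mf: "(\<integral>\<^sup>+x. ennreal ((norm (f k (complex_point x y)))\<^sup>2) \<partial>lborel) \<le> M" if "y \<in> \<Omega>" for k y
    by (rule order_trans[OF nn_integral_mono M[OF yin[OF that]]]) (use fle[OF that] in \<open>auto intro!: ennreal_leI\<close>)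
  let ?g = "\<lambda>G p. indicator \<Omega> (snd p) * ennreal ((norm (G (complex_point (fst p) (snd p)))) ^ 4)"
  have bound: "?P * (\<integral>\<^sup>+p. ?g (f k) p \<partial>lborel) \<le> ?B" for k
    using nice[of k] nice_function.fourth_power_bound[OF _ Mf] by blast
  have meas: "?g (f k) \<in> borel_measurable lborel" for k
    using nice[of k] nice_function.fourth_power_measurable by (auto simp: borel_prod)
  have lim: "(\<lambda>k. ?g (f k) p) \<longlonglongrightarrow> ?g F p" for p
  proof (cases "snd p \<in> \<Omega>")
    case True
    have "(\<lambda>k. \<delta> k) \<longlonglongrightarrow> 0" unfolding \<delta>_def by (rule LIMSEQ_Suc[OF lim_1_over_n])
    then have "(\<lambda>k. snd p + \<delta> k *\<^sub>R e) \<longlonglongrightarrow> snd p + 0 *\<^sub>R e" by (intro tendsto_intros)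
    then have l1: "(\<lambda>k. snd p + \<delta> k *\<^sub>R e) \<longlonglongrightarrow> snd p" by simp
    have "continuous_on \<Omega> (\<lambda>y. F (complex_point (fst p) y))" by (intro tube_continuous[OF hol] continuous_intros)
    then have "(\<lambda>k. F (complex_point (fst p) (snd p + \<delta> k *\<^sub>R e))) \<longlonglongrightarrow> F (complex_point (fst p) (snd p))"
      by (rule continuous_on_tendsto_compose[OF _ l1 True]) (simp add: yin[OF True])
    moreover have "(\<lambda>k. damp e s (\<delta> k) (complex_point (fst p) (snd p))) \<longlonglongrightarrow> 1" unfolding \<delta>_def by (rule damp_limit)
    ultimately have "(\<lambda>k. f k (complex_point (fst p) (snd p))) \<longlonglongrightarrow> F (complex_point (fst p) (snd p)) * 1"
      unfolding f_def shift by (rule tendsto_mult)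
    then have "(\<lambda>k. ennreal ((norm (f k (complex_point (fst p) (snd p)))) ^ 4)) \<longlonglongrightarrow> ennreal ((norm (F (complex_point (fst p) (snd p)))) ^ 4)"
      by (intro tendsto_ennrealI tendsto_power tendsto_norm) simp
    then show ?thesis using True by simp
  qed simp
  have "(\<integral>\<^sup>+p. ?g F p \<partial>lborel) = (\<integral>\<^sup>+p. liminf (\<lambda>k. ?g (f k) p) \<partial>lborel)"
    using lim_imp_Liminf[OF sequentially_bot lim] by simp
  also have "\<dots> \<le> liminf (\<lambda>k. \<integral>\<^sup>+p. ?g (f k) p \<partial>lborel)"
    by (rule nn_integral_liminf) (rule meas)
  also have "\<dots> \<le> ?B / ?P"
  proof (rule order_trans[OF Liminf_le_Limsup[OF sequentially_bot] Limsup_bounded[OF always_eventually]], rule allI)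
    fix k
    have "?P * (\<integral>\<^sup>+p. ?g (f k) p \<partial>lborel) / ?P \<le> ?B / ?P" by (rule divide_right_mono_ennreal[OF bound])
    then show "(\<integral>\<^sup>+p. ?g (f k) p \<partial>lborel) \<le> ?B / ?P" by (subst (asm) mult.commute) (simp add: ennreal_mult_divide_eq)
  qed
  finally have "?P * (\<integral>\<^sup>+p. ?g F p \<partial>lborel) \<le> ?P * (?B / ?P)" by (rule mult_left_mono) simp
  also have "?P * (?B / ?P) = ?B"
    by (subst ennreal_times_divide, subst mult.commute, rule ennreal_mult_divide_eq) auto
  finally show ?thesis .
qed

text \<open>Compose \<open>F\<close> with the complexification of \<open>g\<close>. The tube is
  preserved, the slice integrals are divided by \<open>J\<close>, and the point bound at
  \<open>e\<close> with the fixed radius \<open>d\<close> becomes one at \<open>g e\<close>.\<close>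

lemma transport_bound:
  assumes d: "d > 0" "ball e d \<subseteq> \<Omega>"
  shows "\<exists>C>0. \<forall>F M g J x. holomorphic_multi_on F (tube_domain \<Omega>) \<longrightarrow>
    (\<forall>t\<in>\<Omega>. (\<integral>\<^sup>+x. ennreal ((norm (F (complex_point x t)))\<^sup>2) \<partial>lborel) \<le> M) \<longrightarrow> linear g \<longrightarrow> g ` \<Omega> = \<Omega> \<longrightarrow> has_modulus g J \<longrightarrow>
    ennreal J * ennreal ((norm (F (complex_point x (g e))))\<^sup>2) \<le> ennreal C * M"
proof -
  obtain C where C: "C > 0" "\<And>(\<Omega>::(real^'n) set) F x y M. holomorphic_multi_on F (tube_domain \<Omega>) \<Longrightarrow> ball y d \<subseteq> \<Omega> \<Longrightarrow>
    (\<forall>t\<in>\<Omega>. (\<integral>\<^sup>+x. ennreal ((norm (F (complex_point x t)))\<^sup>2) \<partial>lborel) \<le> M) \<Longrightarrow>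
    ennreal ((norm (F (complex_point x y)))\<^sup>2) \<le> ennreal C * M"
    using hardy_point_bound[OF d(1), where 'n='n] by metis
  have "ennreal J * ennreal ((norm (F (complex_point x (g e))))\<^sup>2) \<le> ennreal C * M"
    if hol: "holomorphic_multi_on F (tube_domain \<Omega>)"
      and M: "\<forall>t\<in>\<Omega>. (\<integral>\<^sup>+x. ennreal ((norm (F (complex_point x t)))\<^sup>2) \<partial>lborel) \<le> M"
      and g: "linear g" "g ` \<Omega> = \<Omega>" "has_modulus g J" for F M g J x
  proof -
    have J: "J > 0" using has_modulus_pos[OF g(3)] .
    have gm: "g t \<in> \<Omega> \<longleftrightarrow> t \<in> \<Omega>" for t by (rule aut_mem[OF g(1,2)])
    have "surj g" using aut_inj[OF g(1,2)] g(1) linear_inj_imp_surj by blast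
    then obtain x0 where x0: "x = g x0" by (metis surjD)
    \<comment> \<open>The complexification of \<open>g\<close>, acting separately on real and
      imaginary parts; it is complex linear.\<close>
    define T where "T z = complex_point (g (\<chi> j. Re (z $ j))) (g (\<chi> j. Im (z $ j)))" for z :: "complex^'n"
    have Tp: "T (complex_point a b) = complex_point (g a) (g b)" for a b by (simp add: T_def complex_point_def)
    have cpx: "\<exists>a b. z = complex_point a b" for z :: "complex^'n"
      by (intro exI[of _ "\<chi> j. Re (z $ j)"] exI[of _ "\<chi> j. Im (z $ j)"]) (simp add: complex_point_def vec_eq_iff)
    have Tc: "T (c *s v) = c *s T v" for c v
    proof -
      obtain a b where v: "v = complex_point a b" using cpx by blast
      show ?thesis using g(1) unfolding v complex_point_mult Tp by (simp add: linear_diff linear_add linear_scale)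
    qed
    have Tadd: "T (z + w) = T z + T w" for z w
    proof -
      obtain a b a' b' where "z = complex_point a b" "w = complex_point a' b'" using cpx by metis
      then show ?thesis using g(1) by (simp add: complex_point_add[symmetric] Tp linear_add)
    qed
    have scal: "k *\<^sub>R z = complex_of_real k *s z" for k and z :: "complex^'n" by (simp add: vec_eq_iff scaleR_conv_of_real[symmetric])
    have Tlin: "linear T" by (rule linearI) (simp_all add: Tadd scal Tc)
    have hol': "holomorphic_multi_on (\<lambda>z. F (T z)) (tube_domain \<Omega>)"
    proof -
      have "holomorphic_multi_on (\<lambda>z. F (0 + T z)) (tube_domain \<Omega>)"
        by (rule holomorphic_multi_on_linear_compose[OF hol Tlin Tc]) (auto elim!: tube_domainE simp: Tp gm)
      then show ?thesis by simp
    qed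
    have M': "(\<integral>\<^sup>+x. ennreal ((norm (F (T (complex_point x t))))\<^sup>2) \<partial>lborel) \<le> M / ennreal J" if t: "t \<in> \<Omega>" for t
    proof -
      have gt: "g t \<in> \<Omega>" using gm t by simp
      have "continuous_on UNIV (\<lambda>u. F (complex_point u (g t)))" using gt by (intro tube_continuous[OF hol] continuous_intros)
      then have [measurable]: "(\<lambda>u. F (complex_point u (g t))) \<in> borel_measurable borel" by (rule borel_measurable_continuous_onI)
      have m: "(\<lambda>u. ennreal ((norm (F (complex_point u (g t))))\<^sup>2)) \<in> borel_measurable borel" by measurable
      have "ennreal J * (\<integral>\<^sup>+x. ennreal ((norm (F (complex_point (g x) (g t))))\<^sup>2) \<partial>lborel) \<le> M"
        unfolding has_modulus_integral[OF g(3) m, symmetric] using M gt by blast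
      then have "(\<integral>\<^sup>+x. ennreal ((norm (F (complex_point (g x) (g t))))\<^sup>2) \<partial>lborel) * ennreal J / ennreal J \<le> M / ennreal J"
        by (intro divide_right_mono_ennreal) (simp add: mult.commute)
      then show ?thesis using J by (simp add: Tp ennreal_mult_divide_eq)
    qed
    have "ennreal ((norm (F (T (complex_point x0 e))))\<^sup>2) \<le> ennreal C * (M / ennreal J)"
      by (rule C(2)[OF hol' d(2)]) (use M' in blast)
    then have "ennreal J * ennreal ((norm (F (complex_point x (g e))))\<^sup>2) \<le> ennreal J * (ennreal C * (M / ennreal J))"
      unfolding Tp x0 by (rule mult_left_mono) simp
    also have "\<dots> = ennreal C * (M * ennreal J / ennreal J)" by (simp add: ennreal_times_divide mult_ac)
    also have "\<dots> = ennreal C * M" using J by (simp add: ennreal_mult_divide_eq)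
    finally show ?thesis .
  qed
  then show ?thesis using C(1) by blast
qed

end

section \<open>The embedding\<close>

lemma jordan_tube_cone:
  fixes m :: "real^'n \<Rightarrow> real^'n \<Rightarrow> real^'n"
  assumes "euclidean_jordan_algebra m e"
  shows "tube_cone (jordan_cone m) e"
proof -
  interpret J: euclidean_jordan m e by unfold_locales (rule assms)
  have Om: "jordan_cone m = J.Om" by (simp add: J.Om_def)
  show ?thesis unfolding Om
  proof unfold_locales
    show "open J.Om" by (rule J.open_Om)
    show "e \<in> J.Om" by (rule J.unit_in_Om)
    show "u + v \<in> J.Om" if u: "u \<in> J.Om" and v: "v \<in> closure J.Om" for u v
      unfolding J.Om_iff
    proof (intro ballI impI)
      fix y assume y: "y \<in> J.Q" "y \<noteq> 0"
      have "u \<bullet> y > 0" using J.Om_inner_pos[OF u y] .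
      moreover have "v \<bullet> y \<ge> 0" using v y J.Q_inner by (simp add: J.closure_Om)
      ultimately show "(u + v) \<bullet> y > 0" by (simp add: inner_add_left)
    qed
    show "k *\<^sub>R u \<in> J.Om" if "k > 0" "u \<in> J.Om" for k u
      using that by (simp add: J.Om_iff)
    show "x \<bullet> \<xi> > 0" if "x \<in> J.Om" "\<xi> \<in> closure J.Om" "\<xi> \<noteq> 0" for x \<xi>
      using that J.Om_inner_pos by (simp add: J.closure_Om)
    show "\<exists>y\<in>J.Om. y \<bullet> \<xi> < 0" if xi: "\<xi> \<notin> closure J.Om" for \<xi>
    proof -
      obtain a where a: "\<xi> \<bullet> m a a < 0" using xi unfolding J.closure_Om J.Q_iff by (auto simp: not_le)
      \<comment> \<open>Small enough that adding \<open>\<epsilon> *\<^sub>R e\<close>, which pushes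
        the square into the open cone, keeps the product with \<xi> negative; the 1 guards against
        division by 0.\<close>
      define \<epsilon> where "\<epsilon> = - (\<xi> \<bullet> m a a) / (2 * (\<bar>\<xi> \<bullet> e\<bar> + 1))"
      have \<epsilon>: "\<epsilon> > 0" unfolding \<epsilon>_def using a by (intro divide_pos_pos) auto
      have "\<epsilon> * (\<xi> \<bullet> e) \<le> \<epsilon> * (\<bar>\<xi> \<bullet> e\<bar> + 1)" using \<epsilon> by (intro mult_left_mono) auto
      also have "\<dots> = - (\<xi> \<bullet> m a a) / 2" unfolding \<epsilon>_def by (simp add: field_simps add_nonneg_eq_0_iff)
      finally have "\<xi> \<bullet> m a a + \<epsilon> * (\<xi> \<bullet> e) < 0" using a by linarith
      then have "(m a a + \<epsilon> *\<^sub>R e) \<bullet> \<xi> < 0" by (simp add: inner_add_right inner_commute[of _ \<xi>])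
      moreover have "m a a + \<epsilon> *\<^sub>R e \<in> J.Om" using \<epsilon> by (intro J.Q_plus_unit_interior) (auto simp: J.Q_def)
      ultimately show ?thesis by blast
    qed
    show "\<exists>g g' J. linear g \<and> g ` J.Om = J.Om \<and> has_modulus g J \<and> linear g' \<and> g' ` J.Om = J.Om \<and>
      has_modulus g' J \<and> (\<forall>x y. g x \<bullet> y = x \<bullet> g' y) \<and> g e = y" if "y \<in> J.Om" for y
      using J.Om_transitive[OF that] unfolding J.cone_aut_def by blast
  qed
qed

text \<open>The exponent of \<open>\<Delta>\<close> is exactly what the pointwise bound compensates when \<open>p - 4\<close> of the
  \<open>p\<close> factors are estimated pointwise. Here \<open>0 powr x = 0\<close>, so a zero of \<open>\<Delta>\<close> is harmless.\<close>

lemma weighted_power_le: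
  fixes a D K q p :: real
  assumes "a \<ge> 0" "D \<ge> 0" "a\<^sup>2 * D powr q \<le> K" "p \<ge> 4"
  shows "a powr p * D powr (q * ((p - 4) / 2)) \<le> K powr ((p - 4) / 2) * a ^ 4"
proof (cases "a = 0 \<or> D = 0")
  case True
  then show ?thesis by auto
next
  case False
  then have pos: "a > 0" "D > 0" using assms by auto
  have "a powr p = a powr 4 * a powr (p - 4)" by (simp add: powr_add[symmetric])
  also have "a powr (p - 4) = (a\<^sup>2) powr ((p - 4) / 2)"
  proof -
    have "(a powr 2) powr ((p - 4) / 2) = a powr (p - 4)"
    proof -
      have "2 * ((p - 4) / 2) = p - 4" by simp
      then show ?thesis by (simp only: powr_powr)
    qed
    then show ?thesis using pos by simp
  qed
  finally have "a powr p * D powr (q * ((p - 4) / 2)) = a ^ 4 * ((a\<^sup>2) powr ((p - 4) / 2) * (D powr q) powr ((p - 4) / 2))"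
    using pos by (simp add: powr_powr)
  also have "\<dots> = a ^ 4 * (a\<^sup>2 * D powr q) powr ((p - 4) / 2)" using pos by (simp add: powr_mult)
  also have "\<dots> \<le> a ^ 4 * K powr ((p - 4) / 2)" using assms pos by (intro mult_left_mono powr_mono2) auto
  finally show ?thesis by (simp add: mult.commute)
qed

theorem theorem1p3:
  fixes \<Omega> :: "(real^'n) set"
    and m :: "real^'n \<Rightarrow> real^'n \<Rightarrow> real^'n" and e :: "real^'n"
    and \<Delta> :: "real^'n \<Rightarrow> real" and r :: nat and n p \<nu> :: real
  assumes "irreducible_symmetric_cone \<Omega>"
    and "euclidean_jordan_algebra m e"
    and "\<Omega> = jordan_cone m"
    and "r = jordan_rank m e"
    and "is_jordan_det m e \<Delta>"
    and "n = real CARD('n)"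
    and "4 \<le> p"
    and "\<nu> = n / real r * (p / 2 - 1)"
  shows "\<exists>C>0. \<forall>F \<in> hardy_space \<Omega> 2.
           F \<in> bergman_space \<Omega> \<Delta> r p \<nu> \<and>
           bergman_norm \<Omega> \<Delta> r p \<nu> F \<le> C * hardy_norm \<Omega> 2 F"
proof -
  interpret J: euclidean_jordan m e by unfold_locales (rule assms(2))
  interpret K: tube_cone \<Omega> e unfolding assms(3) by (rule jordan_tube_cone[OF assms(2)])
  have Om: "\<Omega> = J.Om" by (simp add: J.Om_def assms(3))
  define q where "q = n / real r"
  have r: "r > 0" using J.rank_pos assms(4) by simp
  have n: "n > 0" using assms(6) by simp
  have q: "q > 0" using r n by (simp add: q_def)
  \<comment> \<open>The weight in the Bergman integral already takes \<open>n / r\<close> off \<nu>,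
    so the factor \<open>p / 2 - 1\<close> drops to \<open>p / 2 - 2\<close>.\<close>
  have nq: "\<nu> - real CARD('n) / real r = q * ((p - 4) / 2)"
    using r by (simp add: assms(8) q_def assms(6)[symmetric] field_simps)
  obtain d where d: "d > 0" "ball e d \<subseteq> \<Omega>" using K.open_cone K.e_in by (meson open_contains_ball)
  obtain C0 where C0: "C0 > 0" "\<And>F M g J x. holomorphic_multi_on F (tube_domain \<Omega>) \<Longrightarrow>
    (\<forall>t\<in>\<Omega>. (\<integral>\<^sup>+x. ennreal ((norm (F (complex_point x t)))\<^sup>2) \<partial>lborel) \<le> M) \<Longrightarrow> linear g \<Longrightarrow> g ` \<Omega> = \<Omega> \<Longrightarrow> has_modulus g J \<Longrightarrow>
    ennreal J * ennreal ((norm (F (complex_point x (g e))))\<^sup>2) \<le> ennreal C0 * M"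
    using K.transport_bound[OF d] by metis
  have \<Delta>cont: "isCont \<Delta> y" for y
    using assms(5) unfolding is_jordan_det_def by (blast intro: continuous_real_polymonial_function)
  let ?P = "ennreal ((2 * pi) ^ (4 * CARD('n)))" and ?R = "ennreal ((2 * pi) ^ CARD('n))"
  define C1 where "C1 = enn2real (?R * ((K.V e * K.L e) * ?R\<^sup>2) / ?P)"
  have C1: "ennreal C1 = ?R * ((K.V e * K.L e) * ?R\<^sup>2) / ?P"
  proof -
    have finite_div: "X / ennreal c < \<infinity>" if "X < \<infinity>" "c > 0" for X c
      using that by (auto simp: less_top[symmetric] ennreal_divide_eq_top_iff)
    have "?R * ((K.V e * K.L e) * ?R\<^sup>2) < \<infinity>" using K.VL_finite by (simp add: ennreal_mult_less_top power_less_top_ennreal)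
    then have "?R * ((K.V e * K.L e) * ?R\<^sup>2) / ?P < \<infinity>" by (rule finite_div) simp
    then show ?thesis unfolding C1_def by simp
  qed
  define C2 where "C2 = C0 powr ((p - 4) / 2) * C1"
  have C2: "C2 \<ge> 0" by (simp add: C2_def C1_def)
  \<comment> \<open>The summand 1 keeps the constant positive when \<open>C2\<close> is 0.\<close>
  have main: "F \<in> bergman_space \<Omega> \<Delta> r p \<nu> \<and> bergman_norm \<Omega> \<Delta> r p \<nu> F \<le> (C2 powr (1 / p) + 1) * hardy_norm \<Omega> 2 F"
    if F: "F \<in> hardy_space \<Omega> 2" for F
  proof -
    have hol: "holomorphic_multi_on F (tube_domain \<Omega>)" and fin: "hardy_sup \<Omega> 2 F < \<infinity>" using F by (auto simp: hardy_space_def)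
    define M where "M = hardy_sup \<Omega> 2 F"
    define \<mu> where "\<mu> = enn2real M"
    have M\<mu>: "M = ennreal \<mu>" using fin by (simp add: \<mu>_def M_def)
    have \<mu>0: "\<mu> \<ge> 0" by (simp add: \<mu>_def)
    have Mb: "(\<integral>\<^sup>+x. ennreal ((norm (F (complex_point x t)))\<^sup>2) \<partial>lborel) \<le> M" if "t \<in> \<Omega>" for t
    proof -
      have "(\<integral>\<^sup>+x. ennreal (norm (F (complex_point x t)) powr 2) \<partial>lborel) \<le> M"
        unfolding M_def hardy_sup_def by (rule SUP_upper[OF that])
      then show ?thesis by simp
    qed
    have regular: "\<Delta> y > 0 \<and> (norm (F (complex_point x y)))\<^sup>2 * \<Delta> y powr q \<le> C0 * \<mu>"
      if y: "y \<in> \<Omega>" "jordan_regular m e y" for x y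
    proof -
      have irr: "irreducible_symmetric_cone J.Om" using assms(1) Om by simp
      have pos: "\<Delta> y > 0" and "\<exists>g. J.cone_aut (\<Delta> y powr (real DIM(real^'n) / real (jordan_rank m e))) g \<and> g e = y"
        using J.regular_det[OF irr assms(5) y(2)] y(1) Om by auto
      then obtain g where "J.cone_aut (\<Delta> y powr q) g" and ge: "g e = y" by (auto simp: q_def assms(4,6))
      then have g: "linear g" "g ` \<Omega> = \<Omega>" "has_modulus g (\<Delta> y powr q)" by (auto simp: J.cone_aut_def Om)
      have "ennreal (\<Delta> y powr q) * ennreal ((norm (F (complex_point x (g e))))\<^sup>2) \<le> ennreal C0 * M"
        by (rule C0(2)[OF hol _ g]) (use Mb in blast)
      then have "ennreal (\<Delta> y powr q * (norm (F (complex_point x y)))\<^sup>2) \<le> ennreal (C0 * \<mu>)"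
        using C0(1) \<mu>0 by (simp add: ge M\<mu> ennreal_mult)
      then have "\<Delta> y powr q * (norm (F (complex_point x y)))\<^sup>2 \<le> C0 * \<mu>" using C0(1) \<mu>0 by (simp add: ennreal_le_iff)
      then show ?thesis using pos by (simp add: mult.commute)
    qed
    \<comment> \<open>At elements that are not regular the bound, and the sign of \<Delta>, are
      limits of those at regular ones.\<close>
    have point: "\<Delta> y \<ge> 0 \<and> (norm (F (complex_point x y)))\<^sup>2 * \<Delta> y powr q \<le> C0 * \<mu>" if y: "y \<in> \<Omega>" for x y
    proof -
      obtain u where u: "\<And>k. u k \<in> \<Omega>" "\<And>k. jordan_regular m e (u k)" "u \<longlonglongrightarrow> y"
        using J.regular_dense y Om by blast
      have \<Delta>l: "(\<lambda>k. \<Delta> (u k)) \<longlonglongrightarrow> \<Delta> y" by (rule isCont_tendsto_compose[OF \<Delta>cont u(3)])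
      have nn: "\<Delta> y \<ge> 0" using \<Delta>l by (rule LIMSEQ_le_const) (use regular[OF u(1,2)] in \<open>auto intro: less_imp_le\<close>)
      have "continuous_on \<Omega> (\<lambda>y. F (complex_point x y))" by (intro tube_continuous[OF hol] continuous_intros)
      then have "(\<lambda>k. F (complex_point x (u k))) \<longlonglongrightarrow> F (complex_point x y)"
        by (rule continuous_on_tendsto_compose[OF _ u(3) y]) (simp add: u(1))
      \<comment> \<open>If \<open>\<Delta> y\<close> is 0, continuity of the power rests on
        \<open>q > 0\<close> and on \<Delta> being nonnegative along the sequence.\<close>
      moreover have "(\<lambda>k. \<Delta> (u k) powr q) \<longlonglongrightarrow> \<Delta> y powr q"
        by (rule tendsto_powr'[OF \<Delta>l tendsto_const])
           (use q regular[OF u(1,2)] in \<open>auto intro!: always_eventually less_imp_le\<close>)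
      ultimately have "(\<lambda>k. (norm (F (complex_point x (u k))))\<^sup>2 * \<Delta> (u k) powr q) \<longlonglongrightarrow> (norm (F (complex_point x y)))\<^sup>2 * \<Delta> y powr q"
        by (intro tendsto_mult tendsto_power tendsto_norm)
      then have "(norm (F (complex_point x y)))\<^sup>2 * \<Delta> y powr q \<le> C0 * \<mu>"
        by (rule LIMSEQ_le_const2) (use regular[OF u(1,2)] in auto)
      then show ?thesis using nn by simp
    qed
    let ?k = "(C0 * \<mu>) powr ((p - 4) / 2)"
    let ?I4 = "\<integral>\<^sup>+z. indicator \<Omega> (snd z) * ennreal ((norm (F (complex_point (fst z) (snd z)))) ^ 4) \<partial>lborel"
    have I4: "?I4 \<le> ennreal (C1 * \<mu>\<^sup>2)"
    proof -
      have "?P * ?I4 \<le> ?R * ((K.V e * K.L e) * (?R * M)\<^sup>2)"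
        by (rule K.hardy_fourth_power[OF hol _ Mb]) (use fin in \<open>auto simp: M_def\<close>)
      then have "?I4 * ?P / ?P \<le> ?R * ((K.V e * K.L e) * (?R * M)\<^sup>2) / ?P"
        by (intro divide_right_mono_ennreal) (simp add: mult.commute)
      then have "?I4 \<le> ?R * ((K.V e * K.L e) * (?R * M)\<^sup>2) / ?P"
        by (subst (asm) ennreal_mult_divide_eq) auto
      also have "\<dots> = (M\<^sup>2 * (?R * ((K.V e * K.L e) * ?R\<^sup>2))) / ?P" by (simp add: power_mult_distrib mult_ac)
      also have "\<dots> = M\<^sup>2 * ennreal C1" unfolding C1 by (rule ennreal_times_divide[symmetric])
      also have "\<dots> = ennreal (C1 * \<mu>\<^sup>2)" unfolding M\<mu> using \<mu>0 by (simp add: ennreal_power ennreal_mult C1_def mult.commute)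
      finally show ?thesis .
    qed
    have "bergman_integral \<Omega> \<Delta> r p \<nu> F \<le> (\<integral>\<^sup>+z. ennreal ?k * (indicator \<Omega> (snd z) * ennreal ((norm (F (complex_point (fst z) (snd z)))) ^ 4)) \<partial>lborel)"
      unfolding bergman_integral_def nq
    proof (rule nn_integral_mono, goal_cases)
      case (1 z)
      obtain x y where z: "z = (x, y)" by (cases z)
      show ?case
      proof (cases "y \<in> \<Omega>")
        case True
        have "norm (F (complex_point x y)) powr p * \<Delta> y powr (q * ((p - 4) / 2)) \<le> ?k * (norm (F (complex_point x y))) ^ 4"
          using point[OF True, of x] assms(7) by (intro weighted_power_le) auto
        then have "ennreal (norm (F (complex_point x y)) powr p * \<Delta> y powr (q * ((p - 4) / 2))) \<le> ennreal ?k * ennreal ((norm (F (complex_point x y))) ^ 4)"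
          by (subst ennreal_mult[symmetric]) (auto intro: ennreal_leI)
        then show ?thesis using True by (simp add: z)
      qed (simp add: z)
    qed
    also have "\<dots> \<le> ennreal ?k * ennreal (C1 * \<mu>\<^sup>2)"
    proof (cases "?k = 0")
      case False
      have "(\<integral>\<^sup>+z. ennreal ?k * (indicator \<Omega> (snd z) * ennreal ((norm (F (complex_point (fst z) (snd z)))) ^ 4)) \<partial>lborel) = ennreal ?k * ?I4"
      proof (rule nn_integral_cmult)
        have "(\<lambda>z. indicator (UNIV \<times> \<Omega>) z *\<^sub>R (norm (F (complex_point (fst z) (snd z)))) ^ 4) \<in> borel_measurable borel"
          using K.open_cone by (intro borel_measurable_continuous_on_indicator continuous_intros tube_continuous[OF hol]) (auto intro!: borel_open open_Times)
        then have "(\<lambda>z. ennreal (indicator (UNIV \<times> \<Omega>) z *\<^sub>R (norm (F (complex_point (fst z) (snd z)))) ^ 4)) \<in> borel_measurable borel"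
          by measurable
        moreover have "(\<lambda>z. ennreal (indicator (UNIV \<times> \<Omega>) z *\<^sub>R (norm (F (complex_point (fst z) (snd z)))) ^ 4))
           = (\<lambda>z. indicator \<Omega> (snd z) * ennreal ((norm (F (complex_point (fst z) (snd z)))) ^ 4))"
          by (auto simp: indicator_def fun_eq_iff)
        ultimately have "(\<lambda>z. indicator \<Omega> (snd z) * ennreal ((norm (F (complex_point (fst z) (snd z)))) ^ 4)) \<in> borel_measurable borel"
          by (simp only:)
        then show "(\<lambda>z. indicator \<Omega> (snd z) * ennreal ((norm (F (complex_point (fst z) (snd z)))) ^ 4)) \<in> borel_measurable lborel"
          by simp
      qed
      then show ?thesis using I4 by (simp add: mult_left_mono)
    next
      case True
      then show ?thesis unfolding True by simp
    qed
    also have "\<dots> = ennreal (?k * (C1 * \<mu>\<^sup>2))" by (simp add: ennreal_mult C1_def)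
    finally have B: "bergman_integral \<Omega> \<Delta> r p \<nu> F \<le> ennreal (?k * (C1 * \<mu>\<^sup>2))" .
    then have "bergman_integral \<Omega> \<Delta> r p \<nu> F < \<infinity>" using order_le_less_trans by fastforce
    then have mem: "F \<in> bergman_space \<Omega> \<Delta> r p \<nu>" using hol by (simp add: bergman_space_def)
    \<comment> \<open>The pointwise bound contributes the exponent \<open>(p - 4) / 2\<close> of
      \<mu> and the fourth power integral contributes 2; their sum \<open>p / 2\<close> becomes the
      \<open>1 / 2\<close> of the Hardy norm after the \<open>p\<close>-th root.\<close>
    have kC: "?k * (C1 * \<mu>\<^sup>2) = C2 * \<mu> powr (p / 2)"
    proof (cases "\<mu> = 0")
      case False
      then have "\<mu> > 0" using \<mu>0 by simp
      have "?k * (C1 * \<mu>\<^sup>2) = C2 * (\<mu> powr ((p - 4) / 2) * \<mu> powr 2)"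
        using C0(1) \<mu>0 by (simp add: C2_def powr_mult)
      also have "\<mu> powr ((p - 4) / 2) * \<mu> powr 2 = \<mu> powr (p / 2)"
        unfolding powr_add[symmetric] by (simp add: field_simps)
      finally show ?thesis .
    qed simp
    have "enn2real (bergman_integral \<Omega> \<Delta> r p \<nu> F) \<le> C2 * \<mu> powr (p / 2)"
      using enn2real_mono[OF B] C2 by (simp add: kC)
    then have "bergman_norm \<Omega> \<Delta> r p \<nu> F \<le> (C2 * \<mu> powr (p / 2)) powr (1 / p)"
      unfolding bergman_norm_def using assms(7) by (intro powr_mono2) auto
    also have "\<dots> = C2 powr (1 / p) * \<mu> powr (1 / 2)"
      using assms(7) C2 by (simp add: powr_mult powr_powr)
    also have "\<dots> \<le> (C2 powr (1 / p) + 1) * \<mu> powr (1 / 2)" by (intro mult_right_mono) auto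
    also have "\<mu> powr (1 / 2) = hardy_norm \<Omega> 2 F" by (simp add: hardy_norm_def \<mu>_def M_def)
    finally show ?thesis using mem by simp
  qed
  show ?thesis
    by (rule exI[of _ "C2 powr (1 / p) + 1"]) (use main in \<open>auto intro: add_nonneg_pos\<close>)
qed

end
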